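(* Assume: $\mathrm L$ is a spline-admissible operator with null space $\mathcal N_{\mathrm L}$ of dimension $N_0\ge0$, null-space frequencies $\{\bm k_1,\dots,\bm k_{N_0}\}$, pseudoinverse $\mathrm L^\dagger$ and Green's function $g_{\mathrm L}=\mathrm L^\dagger Ш$; $\nu_1,\dots,\nu_M\in\mathcal C_{\mathrm L}(\mathbb T^d)$ are linearly independent, $M\ge N_0$, and $\bm\nu=(\nu_1,\dots,\nu_M)$ is injective on $\mathcal N_{\mathrm L}$ (i.e. $p\in\mathcal N_{\mathrm L}$ and $\langle\nu_m,p\rangle=0$ for all $m$ imply $p=0$); $E:\mathbb R^M\times\mathbb R^M\to\mathbb R_+\cup\{\infty\}$ is such that $E(\bm z,\cdot)$ is lower semi-continuous, convex, coercive and proper for each $\bm z\in\mathbb R^M$; $\bm y\in\mathbb R^M$; and $\lambda>0$. Then the solution set $$\mathcal V=\arg\min_{f\in\mathcal M_{\mathrm L}(\mathbb T^d)}\ E(\bm y,\bm\nu(f))+\lambda\|\mathrm Lf\|_{\mathcal M},\qquad \bm\nu(f)=(\langle\nu_1,f\rangle,\dots,\langle\nu_M,f\rangle),$$ is nonempty, convex and compact for the weak* topology of $\mathcal M_{\mathrm L}(\mathbb T^d)$ (as dual of $\mathcal C_{\mathrm L}(\mathbb T^d)$). Moreover, every extreme point of $\mathcal V$ is a periodic $\mathrm L$-spline of the form $f_{\mathrm{ext}}=\sum_{k=1}^Ka_kg_{\mathrm L}(\cdot-\bm x_k)+p$ with $K\le M$, $\bm x_k\in\mathbb T^d$, $p\in\mathcal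 N_{\mathrm L}$, and $\bm a=(a_1,\dots,a_K)\in\mathbb R^K$ satisfying $\mathbf M\bm a=\bm 0$, where $M[n,k]=e^{-\mathrm i\langle\bm k_n,\bm x_k\rangle}$.
   Context: Let $d\ge1$, $\mathbb T^d=\mathbb R^d/2\pi\mathbb Z^d$, $\mathcal S(\mathbb T^d)$ the smooth periodic functions and $\mathcal S'(\mathbb T^d)$ its dual; for $f\in L_1$, $\langle f,\varphi\rangle=(2\pi)^{-d}\int f\varphi$. With $e_{\bm k}(\bm x)=e^{\mathrm i\langle\bm x,\bm k\rangle}$, each $f\in\mathcal S'$ expands uniquely as $f=\sum\widehat f[\bm k]e_{\bm k}$ with slowly growing coefficients. The Dirac comb $Ш$ is given by $\langle Ш,\varphi\rangle=\varphi(\bm 0)$. Operators in $\mathcal L_{\mathrm{SI}}(\mathcal S'(\mathbb T^d))$ act by $\mathrm Lf=\sum\widehat L[\bm k]\widehat f[\bm k]e_{\bm k}$ with slowly growing $\widehat L$; $\mathrm L^*$ has Fourier sequence $\overline{\widehat L[\bm k]}$. $\mathrm L$ is spline-admissible if its null space $\mathcal N_{\mathrm L}$ is finite-dimensional and it admits a pseudoinverse $\mathrm L^\dagger\in\mathcal L_{\mathrm{SI}}$ ($\mathrm L\mathrm L^\dagger\mathrm L=\mathrm L$, $\mathrm L^\dagger\mathrm L\mathrm L^\dagger=\mathrm L^\dagger$, $\mathrm L\mathrm L^\dagger$ and $\mathrm L^\dagger\mathrm L$ self-adjoint); then $N_{\mathrm L}=\{\bm k:\widehat L[\bm k]=0\}=\{\bm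 k_1,\dots,\bm k_{N_0}\}$, $\mathcal N_{\mathrm L}=\mathrm{Span}\{e_{\bm k_n}\}$, $\mathrm L^\dagger$ has Fourier sequence $1/\widehat L[\bm k]$ off $N_{\mathrm L}$ and $0$ on it, and $\mathrm{Proj}_{\mathcal N_{\mathrm L}}f:=\sum_n\widehat f[\bm k_n]e_{\bm k_n}$. $\mathcal C(\mathbb T^d)$: continuous periodic functions with $\|\cdot\|_\infty$; $\mathcal M(\mathbb T^d)=\mathcal C(\mathbb T^d)'$: periodic finite Radon measures with total variation norm $\|\cdot\|_{\mathcal M}$, viewed inside $\mathcal S'$. Native space $\mathcal M_{\mathrm L}(\mathbb T^d)=\{f\in\mathcal S':\mathrm Lf\in\mathcal M(\mathbb T^d)\}$ (norm $\|\mathrm Lf\|_{\mathcal M}+\|\mathrm{Proj}_{\mathcal N_{\mathrm L}}f\|_2$); measurement space $\mathcal C_{\mathrm L}(\mathbb T^d)=\{g\in\mathcal S':(\mathrm L^\dagger)^*g\in\mathcal C(\mathbb T^d)\}$ (norm $\max(\|(\mathrm L^\dagger)^*g\|_\infty,\|\mathrm{Proj}_{\mathcal N_{\mathrm L}}g\|_2)$); $\mathcal M_{\mathrm L}$ is the dual of $\mathcal C_{\mathrm L}$, so $\langle\nu,f\rangle$ is defined for $\nu\in\mathcal C_{\mathrm L}$, $f\in\mathcal M_{\mathrm L}$. A periodic $\mathrm L$-spline is $f\in\mathcal S'$ with $\mathrm Lf=\sum_{k=1}^Ka_kШ(\cdot-\bm x_k)$ for finitely many knots $\bm x_k$ and weights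 $a_k$.
   Formalization: The setting is taken to be real: f, the ν_m and p are real-valued and L is a real operator (L̂[−k] is the conjugate of L̂[k]); otherwise ν(f) need not lie in R^M and real weights a_k can fail (e.g. L = i·Id). *)

theory Defs
  imports "HOL-Analysis.Analysis"
begin

text \<open>Periodic distributions on the torus (R/2 pi Z)^d are represented by their
Fourier coefficient sequences, indexed by frequencies in int^('d::finite) (the dimension d
is the cardinality of the finite index type 'd).  Points of the torus are
represented by points of real^'d.\<close>

type_synonym 'd tdist = "int^('d::finite) \<Rightarrow> complex"

definition rvec :: "int^('d::finite) \<Rightarrow> real^('d::finite)" where
  "rvec k = (\<chi> i. real_of_int (k$i))"

text \<open>Membership in S'(T^d): slowly growing Fourier coefficients.\<close>
definition slowly_growing :: "('d::finite) tdist \<Rightarrow> bool" where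
  "slowly_growing c \<longleftrightarrow> (\<exists>C (N::nat). \<forall>k. cmod (c k) \<le> C * (1 + norm (rvec k)) ^ N)"

definition real_dist :: "('d::finite) tdist \<Rightarrow> bool" where
  "real_dist c \<longleftrightarrow> (\<forall>k. c (- k) = cnj (c k))"

definition trigpoly :: "('d::finite) tdist \<Rightarrow> bool" where
  "trigpoly \<phi> \<longleftrightarrow> finite {k. \<phi> k \<noteq> 0}"

definition tp_eval :: "('d::finite) tdist \<Rightarrow> real^('d::finite) \<Rightarrow> complex" where
  "tp_eval \<phi> x = (\<Sum>k\<in>{k. \<phi> k \<noteq> 0}. \<phi> k * cis (x \<bullet> rvec k))"

definition supnorm :: "('d::finite) tdist \<Rightarrow> real" where
  "supnorm \<phi> = (SUP x. cmod (tp_eval \<phi> x))"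

text \<open>Duality pairing <u, phi> = (2 pi)^(-d) int u phi with a trigonometric polynomial.\<close>
definition dpair :: "('d::finite) tdist \<Rightarrow> ('d::finite) tdist \<Rightarrow> complex" where
  "dpair u \<phi> = (\<Sum>k\<in>{k. \<phi> k \<noteq> 0}. u (- k) * \<phi> k)"

text \<open>M(T^d) = C(T^d)': distributions that extend to bounded linear functionals on
C(T^d) (trigonometric polynomials are dense in C(T^d)); total variation norm = dual norm.\<close>
definition is_measure :: "('d::finite) tdist \<Rightarrow> bool" where
  "is_measure u \<longleftrightarrow> slowly_growing u \<and>
     (\<exists>C. \<forall>\<phi>. trigpoly \<phi> \<longrightarrow> cmod (dpair u \<phi>) \<le> C * supnorm \<phi>)"

definition mnorm :: "('d::finite) tdist \<Rightarrow> real" where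
  "mnorm u = Sup {cmod (dpair u \<phi>) | \<phi>. trigpoly \<phi> \<and> supnorm \<phi> \<le> 1}"

definition periodic_cont :: "(real^('d::finite) \<Rightarrow> complex) \<Rightarrow> bool" where
  "periodic_cont F \<longleftrightarrow> continuous_on UNIV F \<and>
     (\<forall>x i. F (x + (2 * pi) *\<^sub>R axis i 1) = F x)"

definition fcoef :: "(real^('d::finite) \<Rightarrow> complex) \<Rightarrow> ('d::finite) tdist" where
  "fcoef F k = integral (cbox 0 (\<chi> i. 2 * pi)) (\<lambda>x. F x * cis (- (x \<bullet> rvec k)))
               / complex_of_real ((2 * pi) ^ CARD('d))"

definition is_cont :: "('d::finite) tdist \<Rightarrow> bool" where
  "is_cont c \<longleftrightarrow> (\<exists>F. periodic_cont F \<and> fcoef F = c)"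

definition cfun :: "('d::finite) tdist \<Rightarrow> real^('d::finite) \<Rightarrow> complex" where
  "cfun c = (SOME F. periodic_cont F \<and> fcoef F = c)"

text \<open>Pairing of a measure u with a continuous function w (by continuous extension
from trigonometric polynomials).\<close>
definition mc_pair :: "('d::finite) tdist \<Rightarrow> ('d::finite) tdist \<Rightarrow> complex" where
  "mc_pair u w = (THE z. \<forall>e>0. \<exists>\<delta>>0. \<forall>\<phi>. trigpoly \<phi> \<and>
      (SUP x. cmod (tp_eval \<phi> x - cfun w x)) < \<delta> \<longrightarrow> cmod (dpair u \<phi> - z) < e)"

text \<open>Shift-invariant operators, given by their Fourier multiplier sequence.\<close>
definition Lop :: "('d::finite) tdist \<Rightarrow> ('d::finite) tdist \<Rightarrow> ('d::finite) tdist" where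
  "Lop L f = (\<lambda>k. L k * f k)"

definition adj :: "('d::finite) tdist \<Rightarrow> ('d::finite) tdist" where
  "adj L = (\<lambda>k. cnj (L k))"

definition nullset :: "('d::finite) tdist \<Rightarrow> (int^'d) set" where
  "nullset L = {k. L k = 0}"

definition pinv :: "('d::finite) tdist \<Rightarrow> ('d::finite) tdist" where
  "pinv L = (\<lambda>k. if L k = 0 then 0 else 1 / L k)"

definition real_op :: "('d::finite) tdist \<Rightarrow> bool" where
  "real_op L \<longleftrightarrow> (\<forall>k. L (- k) = cnj (L k))"

text \<open>Spline admissibility: L in L_SI, finite-dimensional null space, and existence of a
Moore-Penrose pseudoinverse in L_SI (written in the Fourier domain).\<close>
definition spline_admissible :: "('d::finite) tdist \<Rightarrow> bool" where
  "spline_admissible L \<longleftrightarrow> slowly_growing L \<and> finite (nullset L) \<and>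
     (\<exists>D. slowly_growing D \<and>
        (\<forall>k. L k * D k * L k = L k \<and> D k * L k * D k = D k \<and>
             cnj (L k * D k) = L k * D k \<and> cnj (D k * L k) = D k * L k))"

definition native_sp :: "('d::finite) tdist \<Rightarrow> ('d::finite) tdist set" where
  "native_sp L = {f. slowly_growing f \<and> real_dist f \<and> is_measure (Lop L f)}"

definition meas_sp :: "('d::finite) tdist \<Rightarrow> ('d::finite) tdist set" where
  "meas_sp L = {g. slowly_growing g \<and> real_dist g \<and> is_cont (Lop (adj (pinv L)) g)}"

definition null_sp :: "('d::finite) tdist \<Rightarrow> ('d::finite) tdist set" where
  "null_sp L = {p. slowly_growing p \<and> real_dist p \<and> Lop L p = (\<lambda>_. 0)}"

text \<open>Duality pairing <g, f> between C_L and M_L: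
 <(L^dagger)^* g, L f> + null-space part.\<close>
definition nu_pair :: "('d::finite) tdist \<Rightarrow> ('d::finite) tdist \<Rightarrow> ('d::finite) tdist \<Rightarrow> complex" where
  "nu_pair L g f = mc_pair (Lop L f) (Lop (adj (pinv L)) g) + (\<Sum>k\<in>nullset L. g k * f (- k))"

definition weakstar :: "('d::finite) tdist \<Rightarrow> ('d::finite) tdist topology" where
  "weakstar L = topology_generated_by
     (insert (native_sp L) {{f \<in> native_sp L. nu_pair L g f \<in> U} | g U. g \<in> meas_sp L \<and> open U})"

definition convex_dset :: "('d::finite) tdist set \<Rightarrow> bool" where
  "convex_dset V \<longleftrightarrow> (\<forall>f\<in>V. \<forall>g\<in>V. \<forall>t::real. 0 \<le> t \<and> t \<le> 1 \<longrightarrow>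
      (\<lambda>k. complex_of_real t * f k + complex_of_real (1 - t) * g k) \<in> V)"

definition extreme_dist :: "('d::finite) tdist \<Rightarrow> ('d::finite) tdist set \<Rightarrow> bool" where
  "extreme_dist f V \<longleftrightarrow> f \<in> V \<and> \<not> (\<exists>g\<in>V. \<exists>h\<in>V. g \<noteq> h \<and> (\<exists>t::real. 0 < t \<and> t < 1 \<and>
      f = (\<lambda>k. complex_of_real t * g k + complex_of_real (1 - t) * h k)))"

text \<open>Measurement vector nu(f) (the pairings are real in this real-valued setting).\<close>
definition meas_vec :: "('d::finite) tdist \<Rightarrow> ('m \<Rightarrow> 'd tdist) \<Rightarrow> ('d::finite) tdist \<Rightarrow> real^'m" where
  "meas_vec L \<nu> f = (\<chi> m. Re (nu_pair L (\<nu> m) f))"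

definition solset :: "('d::finite) tdist \<Rightarrow> (real^'m \<Rightarrow> real^'m \<Rightarrow> ennreal) \<Rightarrow> real^'m
    \<Rightarrow> ('m \<Rightarrow> 'd tdist) \<Rightarrow> real \<Rightarrow> ('d::finite) tdist set" where
  "solset L E y \<nu> lam = {f \<in> native_sp L. \<forall>g \<in> native_sp L.
      E y (meas_vec L \<nu> f) + ennreal (lam * mnorm (Lop L f))
        \<le> E y (meas_vec L \<nu> g) + ennreal (lam * mnorm (Lop L g))}"

text \<open>Fourier coefficients of the shifted Green's function g_L(. - x0), g_L = L^dagger Sha.\<close>
definition green_shift :: "('d::finite) tdist \<Rightarrow> real^('d::finite) \<Rightarrow> ('d::finite) tdist" where
  "green_shift L x0 = (\<lambda>k. pinv L k * cis (- (rvec k \<bullet> x0)))"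

end

theory Submission
  imports Defs
begin

text \<open>Trigonometric polynomials are dense in the continuous periodic functions, so on norm-bounded sets
the weak* topology is the topology of pointwise convergence of Fourier coefficients, in which such sets
are compact and the cost is lower semicontinuous. This gives existence and weak* compactness.

For an extreme point \<open>f\<close> let \<open>u = Lop L f\<close>, and consider the ideal of trigonometric polynomials \<open>w\<close> with
\<open>w * u = 0\<close>. If its common zeros contain \<open>CARD('m) + 1\<close> distinct points of the torus, Lagrange
interpolation at these points yields that many linearly independent products \<open>w * u\<close>; counting
constraints, a nontrivial combination \<open>v\<close> of them equals \<open>Lop L h\<close> for some \<open>h\<close> that no measurement sees.
As \<open>v\<close> has a bounded density with respect to \<open>u\<close>, small perturbations of \<open>f\<close> by \<open>h\<close> in both directions have
average cost at most that of \<open>f\<close>, contradicting extremality. Hence there are at most \<open>CARD('m)\<close> common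
zeros, and a compactness argument shows that \<open>u\<close> annihilates every trigonometric polynomial vanishing
on them, so that \<open>u\<close> is a combination of Dirac masses.\<close>

subsection \<open>Trigonometric polynomials\<close>

text \<open>A measure is only a functional on trigonometric polynomials here, so it cannot be cut
  along Borel sets, the usual way to show that an extreme point has few atoms. Multiplication by a
  real trigonometric polynomial \<open>w\<close> with \<open>supnorm w \<le> 1\<close> replaces the
  cutting: the factors \<open>1 + w\<close> and \<open>1 - w\<close> are nonnegative and add up to
  2, so the two products with \<open>u\<close> have total mass at most twice that of
  \<open>u\<close>. Reality of \<open>w\<close> also keeps the perturbed element in the real native
  space. Trigonometric polynomials do not localise, but they separate finitely many points, which is
  all that the counting asks for. The count is \<open>CARD('m)\<close> because null frequencies cost
  nothing in the end: each imposes a condition on the perturbing measure, but the null space absorbs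
  equally many measurements. Linear independence of the measurements enters through surjectivity of
  the measurement map, which provides an element of finite cost. Injectivity on the null space
  controls the part of \<open>f\<close> that the norm of \<open>Lop L f\<close> does not
  see.\<close>

lemma tp_eval_superset:
  assumes "finite S" "{k. \<phi> k \<noteq> 0} \<subseteq> S"
  shows "tp_eval \<phi> x = (\<Sum>k\<in>S. \<phi> k * cis (x \<bullet> rvec k))"
  unfolding tp_eval_def using assms by (intro sum.mono_neutral_left) auto

lemma dpair_superset:
  assumes "finite S" "{k. \<phi> k \<noteq> 0} \<subseteq> S"
  shows "dpair u \<phi> = (\<Sum>k\<in>S. u (- k) * \<phi> k)"
  unfolding dpair_def using assms by (intro sum.mono_neutral_left) auto

lemma trigpoly_add:
  assumes "trigpoly \<phi>" "trigpoly \<psi>"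
  shows "trigpoly (\<lambda>k. \<phi> k + \<psi> k)"
  unfolding trigpoly_def
  by (rule finite_subset[of _ "{k. \<phi> k \<noteq> 0} \<union> {k. \<psi> k \<noteq> 0}"])
    (use assms in \<open>auto simp: trigpoly_def\<close>)

lemma trigpoly_cmul: "trigpoly \<phi> \<Longrightarrow> trigpoly (\<lambda>k. c * \<phi> k)"
  unfolding trigpoly_def by (erule rev_finite_subset) auto

lemma tp_eval_add:
  assumes "trigpoly \<phi>" "trigpoly \<psi>"
  shows "tp_eval (\<lambda>k. \<phi> k + \<psi> k) x = tp_eval \<phi> x + tp_eval \<psi> x"
proof -
  let ?S = "{k. \<phi> k \<noteq> 0} \<union> {k. \<psi> k \<noteq> 0}"
  have f: "finite ?S" using assms by (auto simp: trigpoly_def)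
  show ?thesis
    by (subst (1 2 3) tp_eval_superset[OF f]) (auto simp: algebra_simps sum.distrib)
qed

lemma dpair_add:
  assumes "trigpoly \<phi>" "trigpoly \<psi>"
  shows "dpair u (\<lambda>k. \<phi> k + \<psi> k) = dpair u \<phi> + dpair u \<psi>"
proof -
  let ?S = "{k. \<phi> k \<noteq> 0} \<union> {k. \<psi> k \<noteq> 0}"
  have f: "finite ?S" using assms by (auto simp: trigpoly_def)
  show ?thesis
    by (subst (1 2 3) dpair_superset[OF f]) (auto simp: algebra_simps sum.distrib)
qed

lemma tp_eval_cmul:
  assumes "trigpoly \<phi>"
  shows "tp_eval (\<lambda>k. c * \<phi> k) x = c * tp_eval \<phi> x"
proof -
  have f: "finite {k. \<phi> k \<noteq> 0}" using assms by (auto simp: trigpoly_def)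
  show ?thesis
    by (subst (1 2) tp_eval_superset[OF f]) (auto simp: algebra_simps sum_distrib_left)
qed

lemma dpair_cmul:
  assumes "trigpoly \<phi>"
  shows "dpair u (\<lambda>k. c * \<phi> k) = c * dpair u \<phi>"
proof -
  have f: "finite {k. \<phi> k \<noteq> 0}" using assms by (auto simp: trigpoly_def)
  show ?thesis
    by (subst (1 2) dpair_superset[OF f]) (auto simp: algebra_simps sum_distrib_left)
qed

lemma dpair_left_linear:
  "dpair (\<lambda>k. a * u k + b * v k) \<phi> = a * dpair u \<phi> + b * dpair v \<phi>"
  by (simp add: dpair_def algebra_simps sum.distrib sum_distrib_left)

lemma trigpoly_diff:
  assumes "trigpoly \<phi>" "trigpoly \<psi>"
  shows "trigpoly (\<lambda>k. \<phi> k - \<psi> k)"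
  using trigpoly_add[OF assms(1) trigpoly_cmul[OF assms(2), of "-1"]] by simp

lemma tp_eval_diff:
  assumes "trigpoly \<phi>" "trigpoly \<psi>"
  shows "tp_eval (\<lambda>k. \<phi> k - \<psi> k) x = tp_eval \<phi> x - tp_eval \<psi> x"
  using tp_eval_add[OF assms(1) trigpoly_cmul[OF assms(2), of "-1"]] tp_eval_cmul[OF assms(2), of "-1"] by simp

lemma dpair_diff:
  assumes "trigpoly \<phi>" "trigpoly \<psi>"
  shows "dpair u (\<lambda>k. \<phi> k - \<psi> k) = dpair u \<phi> - dpair u \<psi>"
  using dpair_add[OF assms(1) trigpoly_cmul[OF assms(2), of "-1"]] dpair_cmul[OF assms(2), of u "-1"] by simp

lemma trigpoly_zero: "trigpoly (\<lambda>_. 0)"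
  by (simp add: trigpoly_def)

lemma trigpoly_sum:
  assumes "\<And>i. i \<in> I \<Longrightarrow> trigpoly (\<phi> i)"
  shows "trigpoly (\<lambda>k. \<Sum>i\<in>I. \<phi> i k)"
  using assms
  by (induction I rule: infinite_finite_induct) (auto intro: trigpoly_add trigpoly_zero)

lemma tp_eval_sum:
  assumes "\<And>i. i \<in> I \<Longrightarrow> trigpoly (\<phi> i)"
  shows "tp_eval (\<lambda>k. \<Sum>i\<in>I. \<phi> i k) x = (\<Sum>i\<in>I. tp_eval (\<phi> i) x)"
  using assms
proof (induction I rule: infinite_finite_induct)
  case (insert i I)
  then show ?case
    by (simp add: tp_eval_add trigpoly_sum)
qed (auto simp: tp_eval_def)

lemma dpair_sum:
  assumes "\<And>i. i \<in> I \<Longrightarrow> trigpoly (\<phi> i)"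
  shows "dpair u (\<lambda>k. \<Sum>i\<in>I. \<phi> i k) = (\<Sum>i\<in>I. dpair u (\<phi> i))"
  using assms
proof (induction I rule: infinite_finite_induct)
  case (insert i I)
  then show ?case
    by (simp add: dpair_add trigpoly_sum)
qed (auto simp: dpair_def)

definition tchar :: "int^'d \<Rightarrow> complex \<Rightarrow> ('d::finite) tdist" where
  "tchar j a = (\<lambda>k. if k = j then a else 0)"

lemma trigpoly_tchar: "trigpoly (tchar j a)"
  unfolding trigpoly_def tchar_def by (rule finite_subset[of _ "{j}"]) auto

lemma tp_eval_tchar: "tp_eval (tchar j a) x = a * cis (x \<bullet> rvec j)"
  by (subst tp_eval_superset[of "{j}"]) (auto simp: tchar_def)

lemma dpair_tchar: "dpair u (tchar j a) = u (- j) * a"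
  by (subst dpair_superset[of "{j}"]) (auto simp: tchar_def)

lemma rvec_add: "rvec (j + k) = rvec j + rvec k"
  by (simp add: rvec_def vec_eq_iff)

lemma rvec_minus: "rvec (- k) = - rvec k"
  by (simp add: rvec_def vec_eq_iff)

lemma rvec_0 [simp]: "rvec 0 = 0"
  by (simp add: rvec_def vec_eq_iff)

text \<open>The product of a trigonometric polynomial and a distribution is the convolution of
their coefficients.\<close>
definition tmult :: "('d::finite) tdist \<Rightarrow> 'd tdist \<Rightarrow> 'd tdist" where
  "tmult \<phi> u = (\<lambda>k. \<Sum>j | \<phi> j \<noteq> 0. \<phi> j * u (k - j))"

lemma tmult_superset:
  assumes "finite S" "{k. \<phi> k \<noteq> 0} \<subseteq> S"
  shows "tmult \<phi> u k = (\<Sum>j\<in>S. \<phi> j * u (k - j))"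
  unfolding tmult_def using assms by (intro sum.mono_neutral_left) auto

lemma tmult_support:
  "{k. tmult \<phi> \<psi> k \<noteq> 0} \<subseteq> (\<lambda>(j, l). j + l) ` ({j. \<phi> j \<noteq> 0} \<times> {l. \<psi> l \<noteq> 0})"
proof
  fix k assume "k \<in> {k. tmult \<phi> \<psi> k \<noteq> 0}"
  then obtain j where "\<phi> j \<noteq> 0" "\<psi> (k - j) \<noteq> 0"
    unfolding tmult_def by (smt (verit) mem_Collect_eq mult_eq_0_iff sum.neutral)
  then show "k \<in> (\<lambda>(j, l). j + l) ` ({j. \<phi> j \<noteq> 0} \<times> {l. \<psi> l \<noteq> 0})"
    by (intro image_eqI[of _ _ "(j, k - j)"]) auto
qed

lemma trigpoly_tmult: "trigpoly \<phi> \<Longrightarrow> trigpoly \<psi> \<Longrightarrow> trigpoly (tmult \<phi> \<psi>)"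
  unfolding trigpoly_def by (rule finite_subset[OF tmult_support]) auto

text \<open>Reindexing by \<open>k = j + l\<close>. With \<open>g\<close> a character it makes
  \<open>tp_eval\<close> multiplicative; with \<open>g k = u (- k)\<close> it moves a factor across
  \<open>dpair\<close>.\<close>

lemma sum_tmult:
  assumes "trigpoly \<phi>" "trigpoly \<psi>"
    and S: "finite S" "{k. tmult \<phi> \<psi> k \<noteq> 0} \<subseteq> S"
  shows "(\<Sum>k\<in>S. tmult \<phi> \<psi> k * g k) = (\<Sum>j | \<phi> j \<noteq> 0. \<phi> j * (\<Sum>l | \<psi> l \<noteq> 0. \<psi> l * g (j + l)))"
proof -
  let ?A = "{j. \<phi> j \<noteq> 0}" and ?B = "{l. \<psi> l \<noteq> 0}"
  let ?S = "(\<lambda>(j, l). j + l) ` (?A \<times> ?B)"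
  have fin: "finite ?A" "finite ?B" using assms by (auto simp: trigpoly_def)
  then have fS: "finite ?S" by auto
  have "(\<Sum>k\<in>S. tmult \<phi> \<psi> k * g k) = (\<Sum>k | tmult \<phi> \<psi> k \<noteq> 0. tmult \<phi> \<psi> k * g k)"
    using S by (intro sum.mono_neutral_right) auto
  also have "\<dots> = (\<Sum>k\<in>?S. tmult \<phi> \<psi> k * g k)"
    using fS tmult_support[of \<phi> \<psi>] by (intro sum.mono_neutral_left) auto
  also have "\<dots> = (\<Sum>j\<in>?A. \<phi> j * (\<Sum>k\<in>?S. \<psi> (k - j) * g k))"
    unfolding tmult_def sum_distrib_right sum_distrib_left
    by (subst sum.swap) (simp add: mult.assoc)
  also have "\<dots> = (\<Sum>j\<in>?A. \<phi> j * (\<Sum>l\<in>?B. \<psi> l * g (j + l)))"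
  proof (rule sum.cong[OF refl])
    fix j assume j: "j \<in> ?A"
    have "(\<Sum>l\<in>?B. \<psi> l * g (j + l)) = (\<Sum>k\<in>(+) j ` ?B. \<psi> (k - j) * g k)"
      by (subst sum.reindex) auto
    also have "\<dots> = (\<Sum>k\<in>?S. \<psi> (k - j) * g k)"
    proof (intro sum.mono_neutral_left ballI fS)
      show "(+) j ` ?B \<subseteq> ?S" using j by force
      fix k assume k: "k \<in> ?S - (+) j ` ?B"
      then have "k - j \<notin> ?B" using imageI[of "k - j" ?B "(+) j"] by auto
      then show "\<psi> (k - j) * g k = 0" by simp
    qed
    finally show "\<phi> j * (\<Sum>k\<in>?S. \<psi> (k - j) * g k) = \<phi> j * (\<Sum>l\<in>?B. \<psi> l * g (j + l))"
      by simp
  qed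
  finally show ?thesis .
qed

lemma tp_eval_tmult:
  assumes "trigpoly \<phi>" "trigpoly \<psi>"
  shows "tp_eval (tmult \<phi> \<psi>) x = tp_eval \<phi> x * tp_eval \<psi> x"
proof -
  have "tp_eval (tmult \<phi> \<psi>) x
      = (\<Sum>j | \<phi> j \<noteq> 0. \<phi> j * (\<Sum>l | \<psi> l \<noteq> 0. \<psi> l * cis (x \<bullet> rvec (j + l))))"
    unfolding tp_eval_def
    by (rule sum_tmult) (use assms trigpoly_tmult[OF assms] in \<open>auto simp: trigpoly_def\<close>)
  also have "\<dots> = tp_eval \<phi> x * tp_eval \<psi> x"
    unfolding tp_eval_def sum_product
    by (simp add: rvec_add inner_add_right cis_mult[symmetric] mult_ac sum_distrib_left)
  finally show ?thesis .
qed

text \<open>The pairing is bilinear without conjugation, so multiplication by \<open>\<phi>\<close>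
  is its own transpose. Hence, if \<open>tmult \<phi> u\<close> vanishes, then \<open>u\<close>
  vanishes on the whole ideal generated by \<open>\<phi>\<close>.\<close>

lemma dpair_tmult:
  assumes "trigpoly \<phi>" "trigpoly \<psi>"
  shows "dpair (tmult \<phi> u) \<psi> = dpair u (tmult \<phi> \<psi>)"
proof -
  have "dpair u (tmult \<phi> \<psi>) = (\<Sum>k | tmult \<phi> \<psi> k \<noteq> 0. tmult \<phi> \<psi> k * u (- k))"
    by (simp add: dpair_def mult.commute)
  also have "\<dots> = (\<Sum>j | \<phi> j \<noteq> 0. \<phi> j * (\<Sum>l | \<psi> l \<noteq> 0. \<psi> l * u (- (j + l))))"
    by (rule sum_tmult) (use assms trigpoly_tmult[OF assms] in \<open>auto simp: trigpoly_def\<close>)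
  also have "\<dots> = dpair (tmult \<phi> u) \<psi>"
    unfolding dpair_def tmult_def sum_distrib_left sum_distrib_right
    by (subst sum.swap) (simp add: mult_ac minus_diff_commute)
  finally show ?thesis ..
qed

lemma tmult_left_sum:
  assumes "\<And>i. i \<in> I \<Longrightarrow> trigpoly (w i)"
  shows "tmult (\<lambda>k. \<Sum>i\<in>I. c i * w i k) u = (\<lambda>k. \<Sum>i\<in>I. c i * tmult (w i) u k)"
proof (cases "finite I")
  case True
  let ?S = "\<Union>i\<in>I. {k. w i k \<noteq> 0}"
  have f: "finite ?S" using assms True by (auto simp: trigpoly_def)
  have s: "{k. (\<Sum>i\<in>I. c i * w i k) \<noteq> 0} \<subseteq> ?S"
    by (auto intro: ccontr sum.neutral)
  show ?thesis
  proof
    fix k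
    have "(\<Sum>i\<in>I. c i * tmult (w i) u k) = (\<Sum>i\<in>I. c i * (\<Sum>j\<in>?S. w i j * u (k - j)))"
      using tmult_superset[OF f] by (intro sum.cong refl arg_cong[where f = "(*) _"]) blast
    then show "tmult (\<lambda>k. \<Sum>i\<in>I. c i * w i k) u k = (\<Sum>i\<in>I. c i * tmult (w i) u k)"
      unfolding tmult_superset[OF f s] sum_distrib_left sum_distrib_right
      by (subst sum.swap) (simp add: mult.assoc)
  qed
qed (simp add: tmult_def)

text \<open>Coefficients of the complex conjugate function; the real distributions are its fixed
  points.\<close>

definition tconj :: "('d::finite) tdist \<Rightarrow> 'd tdist" where
  "tconj \<phi> = (\<lambda>k. cnj (\<phi> (- k)))"

lemma tconj_support: "{k. tconj \<phi> k \<noteq> 0} = uminus ` {k. \<phi> k \<noteq> 0}"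
  by (force simp: tconj_def image_iff)

lemma trigpoly_tconj: "trigpoly \<phi> \<Longrightarrow> trigpoly (tconj \<phi>)"
  by (simp add: trigpoly_def tconj_support)

lemma tp_eval_tconj: "tp_eval (tconj \<phi>) x = cnj (tp_eval \<phi> x)"
  unfolding tp_eval_def tconj_support
  by (subst sum.reindex) (auto simp: tconj_def rvec_minus cis_cnj)

lemma dpair_tconj: "real_dist u \<Longrightarrow> dpair u (tconj \<phi>) = cnj (dpair u \<phi>)"
  unfolding dpair_def tconj_support
  by (subst sum.reindex) (auto simp: tconj_def real_dist_def)

lemma real_dist_iff_tconj: "real_dist \<phi> \<longleftrightarrow> tconj \<phi> = \<phi>"
  by (auto simp: real_dist_def tconj_def fun_eq_iff) (metis minus_minus complex_cnj_cnj)+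

lemma real_dist_tmult:
  assumes "real_dist \<phi>" "real_dist u"
  shows "real_dist (tmult \<phi> u)"
  unfolding real_dist_def
proof
  fix k
  have S: "{j. \<phi> j \<noteq> 0} = uminus ` {j. \<phi> j \<noteq> 0}"
    using tconj_support[of \<phi>] assms real_dist_iff_tconj[of \<phi>] by simp
  have "tmult \<phi> u (- k) = (\<Sum>j | \<phi> j \<noteq> 0. \<phi> (- j) * u (- k + j))"
    unfolding tmult_def by (subst S, subst sum.reindex) auto
  also have "\<dots> = (\<Sum>j | \<phi> j \<noteq> 0. cnj (\<phi> j) * cnj (u (k - j)))"
    using assms unfolding real_dist_def by (metis minus_diff_eq uminus_add_conv_diff)
  finally show "tmult \<phi> u (- k) = cnj (tmult \<phi> u k)"
    by (simp add: tmult_def)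
qed

lemma tp_eval_real:
  assumes "real_dist \<phi>"
  shows "tp_eval \<phi> x = complex_of_real (Re (tp_eval \<phi> x))"
  by (metis assms real_dist_iff_tconj tp_eval_tconj Reals_cnj_iff of_real_Re)

lemma dpair_real:
  assumes "real_dist \<phi>" "real_dist u"
  shows "dpair u \<phi> = complex_of_real (Re (dpair u \<phi>))"
  by (metis assms real_dist_iff_tconj dpair_tconj Reals_cnj_iff of_real_Re)

section \<open>The supremum norm of trigonometric polynomials\<close>

lemma tp_eval_bound: "cmod (tp_eval \<phi> x) \<le> (\<Sum>k | \<phi> k \<noteq> 0. cmod (\<phi> k))"
  unfolding tp_eval_def by (rule order_trans[OF norm_sum]) (simp add: norm_mult)

lemma bdd_tp_eval: "bdd_above (range (\<lambda>x. cmod (tp_eval \<phi> x)))"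
  using tp_eval_bound by (auto intro!: bdd_aboveI)

lemma tp_eval_le_supnorm: "cmod (tp_eval \<phi> x) \<le> supnorm \<phi>"
  unfolding supnorm_def by (intro cSUP_upper bdd_tp_eval) simp

lemma supnorm_nonneg: "0 \<le> supnorm \<phi>"
  using tp_eval_le_supnorm[of \<phi> 0] norm_ge_zero order_trans by blast

lemma supnorm_le: "(\<And>x. cmod (tp_eval \<phi> x) \<le> c) \<Longrightarrow> supnorm \<phi> \<le> c"
  unfolding supnorm_def by (rule cSUP_least) auto

lemma continuous_on_tp_eval: "continuous_on S (tp_eval \<phi>)"
  unfolding tp_eval_def [abs_def] cis_conv_exp by (intro continuous_intros)

subsection \<open>Fourier coefficients and density of trigonometric polynomials\<close>

text \<open>Lebesgue measure is defined as the image of a product of one-dimensional measures, so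
  Fubini for product functions transfers to it.\<close>

lemma lborel_integral_prod:
  fixes f :: "'a::euclidean_space \<Rightarrow> real \<Rightarrow> complex"
  assumes f: "\<And>b. b \<in> Basis \<Longrightarrow> integrable lborel (f b)"
  shows "(LINT x|lborel. (\<Prod>b\<in>Basis. f b (x \<bullet> b))) = (\<Prod>b\<in>(Basis :: 'a set). (LINT t|lborel. f b t))"
proof -
  interpret product_sigma_finite "\<lambda>_::'a. interval_measure (\<lambda>x. x)"
    by (simp add: product_sigma_finite_def lborel_eq_real[symmetric] lborel.sigma_finite_measure_axioms)
  have [measurable]: "f b \<in> borel_measurable borel" if "b \<in> Basis" for b
    using borel_measurable_integrable[OF f[OF that]] by simp
  have "(LINT x|lborel. (\<Prod>b\<in>Basis. f b (x \<bullet> b)))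
      = (LINT x|(\<Pi>\<^sub>M b\<in>(Basis::'a set). interval_measure (\<lambda>x. x)). (\<Prod>b\<in>Basis. f b (x b)))"
    unfolding lborel_def by (subst integral_distr) (auto simp: inner_sum_left inner_Basis if_distrib cong: if_cong)
  also have "\<dots> = (\<Prod>b\<in>Basis. (LINT t|lborel. f b t))"
    using f by (subst product_integral_prod) (auto simp: lborel_eq_real)
  finally show ?thesis .
qed

text \<open>For \<open>n \<noteq> 0\<close> the antiderivative is again periodic, so its boundary
  values cancel.\<close>

lemma integral_cis:
  fixes n :: int
  shows "(LINT t|lborel. indicator {0..2*pi} t *\<^sub>R cis (t * real_of_int n)) = (if n = 0 then complex_of_real (2 * pi) else 0)"
proof -
  have "((\<lambda>t. cis (t * real_of_int n)) has_integral (if n = 0 then complex_of_real (2 * pi) else 0)) {0..2*pi}"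
  proof (cases "n = 0")
    case True
    then show ?thesis
      using has_integral_const_real[of "1::complex" 0 "2*pi"] by (simp add: scaleR_conv_of_real)
  next
    case False
    let ?F = "\<lambda>t. cis (t * real_of_int n) / (\<i> * of_int n)"
    have "((\<lambda>t. cis (t * real_of_int n)) has_integral (?F (2*pi) - ?F 0)) {0..2*pi}"
    proof (rule fundamental_theorem_of_calculus)
      show "0 \<le> 2 * pi" by simp
      fix t :: real
      have "((\<lambda>t. exp (\<i> * (of_real t * of_int n)) / (\<i> * of_int n)) has_vector_derivative
              exp (\<i> * (of_real t * of_int n))) (at t within {0..2*pi})"
        using False
        by (intro has_vector_derivative_real_field) (auto intro!: derivative_eq_intros simp: mult.commute[of \<i>])
      then show "(?F has_vector_derivative cis (t * real_of_int n)) (at t within {0..2*pi})"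
        by (simp add: cis_conv_exp)
    qed
    moreover have "cis (2 * pi * real_of_int n) = 1"
      using cis_multiple_2pi[of n] by (simp add: mult_ac)
    ultimately show ?thesis using False by simp
  qed
  moreover have "set_integrable lborel {0..2*pi} (\<lambda>t. cis (t * real_of_int n))"
    unfolding cis_conv_exp by (rule borel_integrable_atLeastAtMost') (intro continuous_intros)
  ultimately show ?thesis
    using set_borel_integral_eq_integral(2)[of "{0..2*pi}" "\<lambda>t. cis (t * real_of_int n)"]
    by (simp add: set_lebesgue_integral_def integral_unique)
qed

lemma integral_character:
  fixes k :: "int^'d::finite"
  shows "integral (cbox 0 (\<chi> i. 2 * pi)) (\<lambda>x. cis (x \<bullet> rvec k)) = (if k = 0 then of_real ((2 * pi) ^ CARD('d)) else 0)"
proof -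
  let ?C = "cbox 0 (\<chi> i. 2 * pi) :: (real^'d) set"
  have cont: "continuous_on ?C (\<lambda>x. cis (x \<bullet> rvec k))"
    unfolding cis_conv_exp by (intro continuous_intros)
  have "set_integrable lborel ?C (\<lambda>x. cis (x \<bullet> rvec k))"
    unfolding set_integrable_def by (rule borel_integrable_compact[OF compact_cbox cont])
  then have "integral ?C (\<lambda>x. cis (x \<bullet> rvec k)) = (LINT x|lborel. indicator ?C x *\<^sub>R cis (x \<bullet> rvec k))"
    by (simp add: set_borel_integral_eq_integral(2)[symmetric] set_lebesgue_integral_def)
  also have "\<dots> = (LINT x|lborel. (\<Prod>b\<in>Basis. indicator {0..2*pi} (x \<bullet> b) *\<^sub>R cis ((x \<bullet> b) * (rvec k \<bullet> b))))"
  proof (intro Bochner_Integration.integral_cong refl)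
    fix x :: "real^'d"
    have i: "(indicator ?C x :: real) = (\<Prod>b\<in>Basis. indicator {0..2*pi} (x \<bullet> b))"
    proof (cases "x \<in> ?C")
      case True
      then have "0 \<le> x \<bullet> b \<and> x \<bullet> b \<le> 2 * pi" if "b \<in> Basis" for b
        using that by (auto simp: mem_box_cart Basis_vec_def inner_axis)
      with True show ?thesis by (subst prod.neutral) (auto simp: mem_box)
    next
      case False
      then obtain i where "\<not> (0 \<le> x $ i \<and> x $ i \<le> 2 * pi)" by (auto simp: mem_box_cart)
      then have "(\<Prod>b\<in>Basis. indicator {0..2*pi} (x \<bullet> b)) = (0::real)"
        by (intro prod_zero) (auto simp: Basis_vec_def inner_axis indicator_def intro!: exI[of _ i])
      then show ?thesis using False by simp
    qed
    have c: "cis (x \<bullet> rvec k) = (\<Prod>b\<in>Basis. cis ((x \<bullet> b) * (rvec k \<bullet> b)))"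
      by (subst euclidean_inner) (simp add: cis_conv_exp exp_sum sum_distrib_left)
    show "indicator ?C x *\<^sub>R cis (x \<bullet> rvec k) = (\<Prod>b\<in>Basis. indicator {0..2*pi} (x \<bullet> b) *\<^sub>R cis ((x \<bullet> b) * (rvec k \<bullet> b)))"
      by (simp add: i c scaleR_conv_of_real prod.distrib)
  qed
  also have "\<dots> = (\<Prod>b\<in>(Basis::(real^'d) set). (LINT t|lborel. indicator {0..2*pi} t *\<^sub>R cis (t * (rvec k \<bullet> b))))"
  proof (rule lborel_integral_prod)
    fix b :: "real^'d"
    show "integrable lborel (\<lambda>t. indicator {0..2*pi} t *\<^sub>R cis (t * (rvec k \<bullet> b)))"
      unfolding cis_conv_exp
      using borel_integrable_atLeastAtMost'[of 0 "2*pi" "\<lambda>t. exp (\<i> * of_real (t * (rvec k \<bullet> b)))"]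
      by (simp add: set_integrable_def continuous_intros)
  qed
  also have "\<dots> = (\<Prod>b\<in>(Basis::(real^'d) set). (if rvec k \<bullet> b = 0 then complex_of_real (2 * pi) else 0))"
  proof (intro prod.cong refl)
    fix b :: "real^'d" assume "b \<in> Basis"
    then obtain i where "b = axis i 1" by (auto simp: Basis_vec_def)
    then have "rvec k \<bullet> b = real_of_int (k $ i)" by (simp add: inner_axis rvec_def)
    then show "(LINT t|lborel. indicator {0..2*pi} t *\<^sub>R cis (t * (rvec k \<bullet> b))) = (if rvec k \<bullet> b = 0 then complex_of_real (2 * pi) else 0)"
      using integral_cis[of "k $ i"] by simp
  qed
  also have "\<dots> = (if k = 0 then of_real ((2 * pi) ^ CARD('d)) else 0)"
  proof (cases "k = 0")
    case False
    then obtain i where "k $ i \<noteq> 0" by (auto simp: vec_eq_iff)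
    then have "rvec k \<bullet> axis i 1 \<noteq> 0" by (simp add: inner_axis rvec_def)
    moreover have "axis i (1::real) \<in> Basis" by (auto simp: Basis_vec_def)
    ultimately have "(\<Prod>b\<in>(Basis::(real^'d) set). (if rvec k \<bullet> b = 0 then complex_of_real (2 * pi) else 0)) = 0"
      by (intro prod_zero) (auto intro!: bexI[of _ "axis i 1"])
    then show ?thesis using False by simp
  qed simp
  finally show ?thesis .
qed

lemma continuous_on_character: "continuous_on S (\<lambda>x. cis (c * (x \<bullet> rvec k)))"
  unfolding cis_conv_exp by (intro continuous_intros)

text \<open>Orthogonality of characters. In particular the values of a trigonometric polynomial
  determine its coefficients.\<close>

lemma fcoef_tp_eval:
  fixes \<phi> :: "('d::finite) tdist"
  assumes "trigpoly \<phi>"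
  shows "fcoef (tp_eval \<phi>) = \<phi>"
proof
  fix k
  let ?C = "cbox 0 (\<chi> i. 2 * pi) :: (real^'d) set"
  let ?S = "{j. \<phi> j \<noteq> 0}"
  have fin: "finite ?S" using assms by (simp add: trigpoly_def)
  have "integral ?C (\<lambda>x. tp_eval \<phi> x * cis (- (x \<bullet> rvec k)))
      = integral ?C (\<lambda>x. \<Sum>j\<in>?S. \<phi> j * cis (x \<bullet> rvec (j - k)))"
    by (intro integral_cong)
      (simp add: tp_eval_def sum_distrib_right mult.assoc cis_mult inner_diff_right rvec_add[of _ "- k", simplified] rvec_minus)
  also have "\<dots> = (\<Sum>j\<in>?S. \<phi> j * integral ?C (\<lambda>x. cis (x \<bullet> rvec (j - k))))"
    using fin continuous_on_character[of ?C 1]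
    by (subst integral_sum) (auto intro!: integrable_continuous continuous_intros)
  also have "\<dots> = (\<Sum>j\<in>?S. if j = k then \<phi> j * of_real ((2 * pi) ^ CARD('d)) else 0)"
    by (intro sum.cong refl) (auto simp: integral_character)
  also have "\<dots> = \<phi> k * of_real ((2 * pi) ^ CARD('d))"
    using fin by simp
  finally show "fcoef (tp_eval \<phi>) k = \<phi> k"
    by (simp add: fcoef_def)
qed

text \<open>The constant is 1 because \<open>fcoef\<close> divides by the volume of the
  cube.\<close>

lemma cmod_fcoef_diff_le:
  fixes F G :: "real^'d::finite \<Rightarrow> complex"
  assumes F: "continuous_on UNIV F" and G: "continuous_on UNIV G"
    and le: "\<And>x. cmod (F x - G x) \<le> \<delta>"
  shows "cmod (fcoef F k - fcoef G k) \<le> \<delta>"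
proof -
  let ?C = "cbox 0 (\<chi> i. 2 * pi) :: (real^'d) set"
  let ?e = "\<lambda>x::real^'d. cis (- (x \<bullet> rvec k))"
  have e: "continuous_on ?C ?e" using continuous_on_character[of ?C "-1" k] by simp
  have intF: "(\<lambda>x. F x * ?e x) integrable_on ?C" and intG: "(\<lambda>x. G x * ?e x) integrable_on ?C"
    using F G e by (auto intro!: integrable_continuous continuous_intros intro: continuous_on_subset)
  have "cmod (integral ?C (\<lambda>x. F x * ?e x - G x * ?e x)) \<le> \<delta> * measure lborel ?C"
  proof (rule integrable_bound)
    show "0 \<le> \<delta>" using le[of 0] norm_ge_zero order_trans by blast
    show "(\<lambda>x. F x * ?e x - G x * ?e x) integrable_on ?C"
      by (rule integrable_diff[OF intF intG])
    show "cmod (F x * ?e x - G x * ?e x) \<le> \<delta>" for x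
      using le[of x] by (simp add: left_diff_distrib[symmetric] norm_mult)
  qed
  moreover have "measure lborel ?C = (2 * pi) ^ CARD('d)"
    by (subst content_cbox_cart) (auto simp: interval_eq_empty_cart)
  ultimately have "cmod (integral ?C (\<lambda>x. F x * ?e x) - integral ?C (\<lambda>x. G x * ?e x)) \<le> \<delta> * (2 * pi) ^ CARD('d)"
    by (simp add: integral_diff[OF intF intG])
  then show ?thesis
    by (simp add: fcoef_def diff_divide_distrib[symmetric] norm_divide norm_power norm_mult
        pos_divide_le_eq del: of_real_power)
qed

lemma cmod_coeff_le_supnorm:
  fixes \<phi> :: "('d::finite) tdist"
  assumes "trigpoly \<phi>"
  shows "cmod (\<phi> k) \<le> supnorm \<phi>"
proof -
  have "tp_eval (\<lambda>_. 0) x = 0" for x :: "real^'d" by (simp add: tp_eval_def)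
  then have "cmod (fcoef (tp_eval \<phi>) k - fcoef (tp_eval (\<lambda>_. 0)) k) \<le> supnorm \<phi>"
    by (intro cmod_fcoef_diff_le continuous_on_tp_eval) (simp add: tp_eval_le_supnorm)
  then show ?thesis by (simp only: fcoef_tp_eval assms trigpoly_zero diff_zero)
qed

text \<open>Two vectors represent the same torus point exactly when their images agree. The image is
  a compact set to which Stone-Weierstrass applies, and counting torus points means counting
  images.\<close>

definition torus_map :: "real^'d \<Rightarrow> complex^('d::finite)" where
  "torus_map x = (\<chi> i. cis (x $ i))"

lemma torus_map_eq_iff: "torus_map x = torus_map y \<longleftrightarrow> (\<forall>i. cis (x $ i) = cis (y $ i))"
  by (simp add: torus_map_def vec_eq_iff)

lemma torus_map_eqD:
  assumes "torus_map x = torus_map y"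
  obtains n :: "'d::finite \<Rightarrow> int" where "x = y + (\<Sum>i\<in>UNIV. (2 * pi * n i) *\<^sub>R axis i 1)"
proof -
  have "\<forall>i. \<exists>n::int. x $ i = y $ i + 2 * pi * n"
    using assms unfolding torus_map_eq_iff
    by (metis sin_cos_eq_iff cis.sel)
  then obtain n :: "'d \<Rightarrow> int" where n: "\<And>i. x $ i = y $ i + 2 * pi * n i" by metis
  have "x = y + (\<Sum>i\<in>UNIV. (2 * pi * n i) *\<^sub>R axis i 1)"
    by (simp add: vec_eq_iff n axis_def if_distrib cong: if_cong)
  then show thesis by (rule that)
qed

text \<open>\<open>periodic_cont\<close> only gives one period in one coordinate. Induction extends
  this to natural multiples, then to integers, then to all coordinates one after another.\<close>

lemma periodic_cont_torus_map:
  assumes F: "periodic_cont F" and eq: "torus_map x = torus_map y"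
  shows "F x = F y"
proof -
  have nat: "F (z + (2 * pi * real n) *\<^sub>R axis i 1) = F z" for z i and n :: nat
  proof (induction n)
    case (Suc n)
    have "F (z + (2 * pi * real (Suc n)) *\<^sub>R axis i 1) = F ((z + (2 * pi * real n) *\<^sub>R axis i 1) + (2 * pi) *\<^sub>R axis i 1)"
      by (simp add: algebra_simps)
    also have "\<dots> = F z" using F Suc by (simp only: periodic_cont_def)
    finally show ?case .
  qed simp
  have int: "F (z + (2 * pi * real_of_int n) *\<^sub>R axis i 1) = F z" for z i and n :: int
  proof (cases n)
    case (nonneg m)
    then show ?thesis using nat[of z m i] by simp
  next
    case (neg m)
    \<comment> \<open>A negative shift is undone by \<open>Suc m\<close> forward periods, so the
      natural case is applied at the already shifted point.\<close>
    then have "real_of_int n = - real (Suc m)" by simp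
    then show ?thesis
      using nat[of "z + (2 * pi * real_of_int n) *\<^sub>R axis i 1" "Suc m" i]
      by (simp only: add.assoc scaleR_left_distrib[symmetric] distrib_left[symmetric]) simp
  qed
  obtain n where n: "x = y + (\<Sum>i\<in>UNIV. (2 * pi * real_of_int (n i)) *\<^sub>R axis i 1)"
    using torus_map_eqD[OF eq] by blast
  have "F (y + (\<Sum>i\<in>I. (2 * pi * real_of_int (n i)) *\<^sub>R axis i 1)) = F y" if "finite I" for I
    using that
  proof induction
    case (insert i I)
    have "F (y + (\<Sum>i\<in>insert i I. (2 * pi * real_of_int (n i)) *\<^sub>R axis i 1))
       = F ((y + (\<Sum>i\<in>I. (2 * pi * real_of_int (n i)) *\<^sub>R axis i 1)) + (2 * pi * real_of_int (n i)) *\<^sub>R axis i 1)"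
      using insert.hyps by (simp add: algebra_simps)
    then show ?case using int insert.IH by simp
  qed simp
  from this[of UNIV] show ?thesis using n by simp
qed

lemma ex_cube_torus_map: "\<exists>y\<in>cbox 0 (\<chi> i. 2 * pi). torus_map y = torus_map x"
proof
  let ?y = "\<chi> i. x $ i - 2 * pi * of_int \<lfloor>x $ i / (2 * pi)\<rfloor>"
  have "cis (x $ i - 2 * pi * of_int \<lfloor>x $ i / (2 * pi)\<rfloor>) = cis (x $ i)" for i
    using cis_multiple_2pi[of "real_of_int \<lfloor>x $ i / (2 * pi)\<rfloor>"] by (simp add: cis_divide[symmetric])
  then show "torus_map ?y = torus_map x" by (simp add: torus_map_eq_iff)
  have "0 \<le> x $ i - 2 * pi * of_int \<lfloor>x $ i / (2 * pi)\<rfloor> \<and> x $ i - 2 * pi * of_int \<lfloor>x $ i / (2 * pi)\<rfloor> \<le> 2 * pi" for i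
  proof -
    define n where "n = real_of_int \<lfloor>x $ i / (2 * pi)\<rfloor>"
    have "n \<le> x $ i / (2 * pi)" "x $ i / (2 * pi) < n + 1"
      unfolding n_def using floor_correct[of "x $ i / (2 * pi)"] by auto
    then show ?thesis
      unfolding n_def[symmetric] by (simp add: field_simps)
  qed
  then show "?y \<in> cbox 0 (\<chi> i. 2 * pi)" by (simp add: mem_box_cart)
qed

lemma continuous_on_torus_map: "continuous_on S torus_map"
  unfolding torus_map_def [abs_def] cis_conv_exp by (intro continuous_intros)

lemma torus_map_image_cube: "torus_map ` cbox 0 (\<chi> i. 2 * pi) = range torus_map"
  by (auto simp: image_iff) (metis ex_cube_torus_map)

lemma compact_torus: "compact (range torus_map)"
  unfolding torus_map_image_cube[symmetric]
  by (intro compact_continuous_image continuous_on_torus_map compact_cbox)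

lemma torus_density_real:
  fixes G :: "real^'d::finite \<Rightarrow> real"
  assumes cont: "continuous_on UNIV G"
    and per: "\<And>x y. torus_map x = torus_map y \<Longrightarrow> G x = G y" and e: "e > 0"
  shows "\<exists>\<phi>. trigpoly \<phi> \<and> (\<forall>x. cmod (tp_eval \<phi> x - of_real (G x)) < e)"
proof -
  \<comment> \<open>\<open>G\<close> descends to the image of the torus; periodicity makes the
    choice of the preimage irrelevant.\<close>
  define H where "H z = G (SOME x. torus_map x = z)" for z
  have H: "H (torus_map x) = G x" for x
    unfolding H_def by (rule per) (rule someI[of _ x], simp)
  let ?T = "range torus_map :: (complex^'d) set"
  \<comment> \<open>The cube already covers the torus and is compact, so the preimage of a closed
    set under \<open>H\<close> is the image of a compact set, hence closed.\<close>
  have Hc: "continuous_on ?T H"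
    unfolding continuous_on_closed_vimage[OF compact_imp_closed[OF compact_torus]]
  proof (intro allI impI)
    fix B :: "real set" assume B: "closed B"
    have "H -` B \<inter> ?T = torus_map ` (cbox 0 (\<chi> i. 2 * pi) \<inter> G -` B)"
    proof (intro equalityI subsetI)
      fix z assume "z \<in> H -` B \<inter> ?T"
      then obtain x where x: "z = torus_map x" "H z \<in> B" by auto
      then obtain y where "y \<in> cbox 0 (\<chi> i. 2 * pi)" "torus_map y = z" using ex_cube_torus_map by metis
      then show "z \<in> torus_map ` (cbox 0 (\<chi> i. 2 * pi) \<inter> G -` B)" using x(2) H[of y] by auto
    qed (auto simp: H)
    moreover have "compact (torus_map ` (cbox 0 (\<chi> i. 2 * pi) \<inter> G -` B))"
      by (intro compact_continuous_image continuous_on_torus_map compact_Int_closed compact_cbox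
          closed_vimage B cont)
    ultimately show "closed (H -` B \<inter> ?T)" using compact_imp_closed by simp
  qed
  define P where "P f \<longleftrightarrow> continuous_on ?T f \<and> (\<exists>\<phi>. trigpoly \<phi> \<and> (\<forall>x. tp_eval \<phi> x = of_real (f (torus_map x))))" for f :: "complex^'d \<Rightarrow> real"
  have "\<exists>f. P f \<and> (\<forall>z\<in>?T. \<bar>H z - f z\<bar> < e)"
  proof (rule Stone_Weierstrass_HOL[where S = ?T and P = P])
    show "compact ?T" by (rule compact_torus)
    show "P (\<lambda>x. c)" for c
      unfolding P_def using trigpoly_tchar[of 0 "of_real c"] tp_eval_tchar[of 0 "of_real c"] by auto
    show "P f \<Longrightarrow> continuous_on ?T f" for f by (simp add: P_def)
    show "P (\<lambda>x. f x + g x)" if "P f \<and> P g" for f g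
      using that unfolding P_def by (auto intro!: continuous_intros) (metis tp_eval_add trigpoly_add)
    show "P (\<lambda>x. f x * g x)" if "P f \<and> P g" for f g
      using that unfolding P_def by (auto intro!: continuous_intros) (metis tp_eval_tmult trigpoly_tmult)
    show "\<exists>f. P f \<and> f z \<noteq> f w" if zw: "z \<in> ?T \<and> w \<in> ?T \<and> z \<noteq> w" for z w
    proof -
      have r: "rvec (axis i 1 :: int^'d) = axis i 1" for i by (simp add: rvec_def axis_def vec_eq_iff)
      \<comment> \<open>The choices \<open>c = 1\<close> and \<open>c = - \<i>\<close> give the real
        and imaginary parts of a coordinate; together these separate points within the algebra of
        real-valued trigonometric polynomials.\<close>
      have inner: "P (\<lambda>z. Re (c * z $ i))" for i c
        unfolding P_def
      proof (intro conjI exI allI)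
        let ?k = "axis i 1 :: int^'d"
        show "continuous_on ?T (\<lambda>z. Re (c * z $ i))" by (intro continuous_intros)
        show "trigpoly (\<lambda>k. tchar ?k (c/2) k + tchar (- ?k) (cnj c/2) k)"
          by (intro trigpoly_add trigpoly_tchar)
        show "tp_eval (\<lambda>k. tchar ?k (c/2) k + tchar (- ?k) (cnj c/2) k) x = of_real (Re (c * torus_map x $ i))" for x
          by (simp add: tp_eval_add trigpoly_tchar tp_eval_tchar rvec_minus r inner_axis torus_map_def complex_eq_iff field_simps)
      qed
      from zw obtain i where "z $ i \<noteq> w $ i" by (auto simp: vec_eq_iff)
      then have "Re (1 * z $ i) \<noteq> Re (1 * w $ i) \<or> Re (- \<i> * z $ i) \<noteq> Re (- \<i> * w $ i)"
        by (auto simp: complex_eq_iff)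
      then show ?thesis using inner by blast
    qed
    show "continuous_on ?T H" by (rule Hc)
    show "e > 0" by (rule e)
  qed
  then obtain f where f: "P f" "\<And>x. \<bar>G x - f (torus_map x)\<bar> < e" using H by auto
  then obtain \<phi> where \<phi>: "trigpoly \<phi>" "\<And>x. tp_eval \<phi> x = of_real (f (torus_map x))"
    by (auto simp: P_def)
  have "cmod (tp_eval \<phi> x - of_real (G x)) < e" for x
    using f(2)[of x] by (simp add: \<phi>(2) of_real_diff[symmetric] abs_minus_commute del: of_real_diff)
  with \<phi>(1) show ?thesis by blast
qed

lemma trigpoly_dense:
  fixes F :: "real^'d::finite \<Rightarrow> complex"
  assumes cont: "continuous_on UNIV F"
    and per: "\<And>x y. torus_map x = torus_map y \<Longrightarrow> F x = F y" and e: "e > 0"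
  shows "\<exists>\<phi>. trigpoly \<phi> \<and> (\<forall>x. cmod (tp_eval \<phi> x - F x) < e)"
proof -
  obtain \<phi> where \<phi>: "trigpoly \<phi>" "\<And>x. cmod (tp_eval \<phi> x - of_real (Re (F x))) < e / 2"
    using torus_density_real[OF continuous_on_Re[OF cont], of "e/2"] per e by (metis half_gt_zero)
  obtain \<psi> where \<psi>: "trigpoly \<psi>" "\<And>x. cmod (tp_eval \<psi> x - of_real (Im (F x))) < e / 2"
    using torus_density_real[OF continuous_on_Im[OF cont], of "e/2"] per e by (metis half_gt_zero)
  show ?thesis
  proof (intro exI conjI allI)
    show "trigpoly (\<lambda>k. \<phi> k + \<i> * \<psi> k)" by (intro trigpoly_add trigpoly_cmul \<phi> \<psi>)
    fix x
    have "tp_eval (\<lambda>k. \<phi> k + \<i> * \<psi> k) x - F x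
       = (tp_eval \<phi> x - of_real (Re (F x))) + \<i> * (tp_eval \<psi> x - of_real (Im (F x)))"
      using complex_eq[of "F x"]
      by (simp add: tp_eval_add tp_eval_cmul trigpoly_cmul \<phi> \<psi> algebra_simps)
    then have "cmod (tp_eval (\<lambda>k. \<phi> k + \<i> * \<psi> k) x - F x)
      \<le> cmod (tp_eval \<phi> x - of_real (Re (F x))) + cmod (tp_eval \<psi> x - of_real (Im (F x)))"
      by (metis norm_triangle_ineq norm_mult norm_ii mult_1)
    then show "cmod (tp_eval (\<lambda>k. \<phi> k + \<i> * \<psi> k) x - F x) < e" using \<phi>(2)[of x] \<psi>(2)[of x] by simp
  qed
qed

subsection \<open>Measures and their pairing with continuous functions\<close>

text \<open>A bound on the dual norm that is meaningful before \<open>u\<close> is known to be a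
  measure, whereas \<open>mnorm\<close> is a real \<open>Sup\<close> and needs boundedness. Being a
  family of inequalities in finitely many coefficients each, it survives pointwise limits.\<close>

definition mbound :: "('d::finite) tdist \<Rightarrow> real \<Rightarrow> bool" where
  "mbound u C \<longleftrightarrow> (\<forall>\<phi>. trigpoly \<phi> \<longrightarrow> cmod (dpair u \<phi>) \<le> C * supnorm \<phi>)"

lemma supnorm_tchar: "supnorm (tchar k 1) = 1"
  by (simp add: supnorm_def tp_eval_tchar)

lemma mbound_coeff:
  assumes "mbound u C"
  shows "cmod (u k) \<le> C"
  using assms[unfolded mbound_def, rule_format, OF trigpoly_tchar[of "- k" 1]]
  by (simp add: dpair_tchar supnorm_tchar)

lemma mbound_nonneg: "mbound u C \<Longrightarrow> 0 \<le> C"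
  using mbound_coeff[of u C 0] norm_ge_zero order_trans by blast

lemma mbound_dpair_le:
  assumes "mbound u C" "trigpoly \<phi>" "\<And>x. cmod (tp_eval \<phi> x) \<le> \<delta>"
  shows "cmod (dpair u \<phi>) \<le> C * \<delta>"
  using assms mbound_nonneg supnorm_le[of \<phi> \<delta>] unfolding mbound_def
  by (meson mult_left_mono order_trans)

lemma mbound_slowly_growing:
  assumes "mbound u C"
  shows "slowly_growing u"
  unfolding slowly_growing_def by (rule exI[of _ C], rule exI[of _ 0]) (simp add: mbound_coeff[OF assms])

text \<open>Testing against characters bounds all coefficients by \<open>C\<close>, so slow growth
  is automatic.\<close>

lemma is_measure_iff_mbound: "is_measure u \<longleftrightarrow> (\<exists>C. mbound u C)"
  unfolding is_measure_def using mbound_slowly_growing by (auto simp: mbound_def)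

lemma supnorm_scale:
  assumes "trigpoly \<phi>"
  shows "supnorm (\<lambda>k. c * \<phi> k) \<le> cmod c * supnorm \<phi>"
  by (rule supnorm_le) (simp add: tp_eval_cmul assms norm_mult mult_left_mono tp_eval_le_supnorm)

lemma bdd_above_mnorm_set:
  assumes "mbound u C"
  shows "bdd_above {cmod (dpair u \<phi>) | \<phi>. trigpoly \<phi> \<and> supnorm \<phi> \<le> 1}"
proof (rule bdd_aboveI)
  fix r assume "r \<in> {cmod (dpair u \<phi>) | \<phi>. trigpoly \<phi> \<and> supnorm \<phi> \<le> 1}"
  then obtain \<phi> where \<phi>: "r = cmod (dpair u \<phi>)" "trigpoly \<phi>" "supnorm \<phi> \<le> 1" by auto
  then show "r \<le> C"
    using mbound_dpair_le[OF assms, of \<phi> 1] tp_eval_le_supnorm[of \<phi>] order_trans by fastforce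
qed

lemma mnorm_upper:
  assumes "is_measure u" "trigpoly \<phi>" "supnorm \<phi> \<le> 1"
  shows "cmod (dpair u \<phi>) \<le> mnorm u"
proof -
  obtain C where "mbound u C" using assms is_measure_iff_mbound by blast
  then show ?thesis
    unfolding mnorm_def using assms by (intro cSup_upper bdd_above_mnorm_set) auto
qed

lemma mnorm_least:
  assumes "\<And>\<phi>. trigpoly \<phi> \<Longrightarrow> supnorm \<phi> \<le> 1 \<Longrightarrow> cmod (dpair u \<phi>) \<le> C"
  shows "mnorm u \<le> C"
  unfolding mnorm_def
proof (rule cSup_least)
  have "supnorm (tchar 0 1 :: 'a tdist) \<le> 1" by (simp add: supnorm_tchar)
  then show "{cmod (dpair u \<phi>) | \<phi>. trigpoly \<phi> \<and> supnorm \<phi> \<le> 1} \<noteq> {}"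
    using trigpoly_tchar by blast
qed (use assms in auto)

text \<open>By homogeneity. A polynomial with \<open>supnorm \<phi> = 0\<close> cannot be
  normalised, but its coefficients vanish by \<open>cmod_coeff_le_supnorm\<close>.\<close>

lemma mbound_mnorm:
  assumes "is_measure u"
  shows "mbound u (mnorm u)"
  unfolding mbound_def
proof (intro allI impI)
  fix \<phi> :: "'a tdist" assume \<phi>: "trigpoly \<phi>"
  show "cmod (dpair u \<phi>) \<le> mnorm u * supnorm \<phi>"
  proof (cases "supnorm \<phi> = 0")
    case True
    then have "\<phi> = (\<lambda>_. 0)" using cmod_coeff_le_supnorm[OF \<phi>] by auto
    then show ?thesis using True by (simp add: dpair_def)
  next
    case False
    then have pos: "supnorm \<phi> > 0" using supnorm_nonneg[of \<phi>] by simp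
    let ?c = "complex_of_real (1 / supnorm \<phi>)"
    have "supnorm (\<lambda>k. ?c * \<phi> k) \<le> 1"
      using supnorm_scale[OF \<phi>, of ?c] pos by (simp add: norm_divide)
    from mnorm_upper[OF assms trigpoly_cmul[OF \<phi>] this]
    have "cmod ?c * cmod (dpair u \<phi>) \<le> mnorm u" by (simp only: dpair_cmul[OF \<phi>] norm_mult)
    then show ?thesis
      using pos by (simp add: norm_divide field_simps)
  qed
qed

lemma mnorm_le:
  assumes "mbound u C"
  shows "mnorm u \<le> C"
proof (rule mnorm_least)
  fix \<phi> :: "'a tdist" assume "trigpoly \<phi>" "supnorm \<phi> \<le> 1"
  then show "cmod (dpair u \<phi>) \<le> C"
    using mbound_dpair_le[OF assms, of \<phi> 1] tp_eval_le_supnorm[of \<phi>] order_trans by fastforce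
qed

lemma mnorm_nonneg: "is_measure u \<Longrightarrow> 0 \<le> mnorm u"
  using mbound_mnorm mbound_nonneg by blast

lemma mbound_linear:
  assumes "mbound u C" "mbound v D"
  shows "mbound (\<lambda>k. a * u k + b * v k) (cmod a * C + cmod b * D)"
  unfolding mbound_def
proof (intro allI impI)
  fix \<phi> :: "'a tdist" assume \<phi>: "trigpoly \<phi>"
  have "cmod (dpair (\<lambda>k. a * u k + b * v k) \<phi>) \<le> cmod a * cmod (dpair u \<phi>) + cmod b * cmod (dpair v \<phi>)"
    unfolding dpair_left_linear by (metis norm_mult norm_triangle_ineq)
  also have "\<dots> \<le> cmod a * (C * supnorm \<phi>) + cmod b * (D * supnorm \<phi>)"
    using assms \<phi> by (intro add_mono mult_left_mono) (auto simp: mbound_def)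
  finally show "cmod (dpair (\<lambda>k. a * u k + b * v k) \<phi>) \<le> (cmod a * C + cmod b * D) * supnorm \<phi>"
    by (simp add: algebra_simps)
qed

text \<open>The index set now depends on \<open>u\<close> alone, so the pairing is a fixed finite
  combination of coefficients of \<open>\<phi>\<close>, each controlled by the supremum
  norm.\<close>

lemma dpair_swap:
  assumes "trigpoly u" "trigpoly \<phi>"
  shows "dpair u \<phi> = (\<Sum>k\<in>uminus ` {k. u k \<noteq> 0}. u (- k) * \<phi> k)"
proof -
  let ?S = "uminus ` {k. u k \<noteq> 0}"
  have fin: "finite ({k. \<phi> k \<noteq> 0} \<union> ?S)" using assms by (auto simp: trigpoly_def)
  have "dpair u \<phi> = (\<Sum>k\<in>{k. \<phi> k \<noteq> 0} \<union> ?S. u (- k) * \<phi> k)"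
    by (rule dpair_superset[OF fin]) auto
  also have "\<dots> = (\<Sum>k\<in>?S. u (- k) * \<phi> k)"
  proof (intro sum.mono_neutral_right fin ballI)
    fix k assume "k \<in> ({k. \<phi> k \<noteq> 0} \<union> ?S) - ?S"
    then have "u (- k) = 0" using imageI[of "- k" "{k. u k \<noteq> 0}" uminus] by auto
    then show "u (- k) * \<phi> k = 0" by simp
  qed auto
  finally show ?thesis .
qed

lemma mbound_trigpoly:
  assumes "trigpoly u"
  shows "mbound u (\<Sum>k\<in>uminus ` {k. u k \<noteq> 0}. cmod (u (- k)))"
  unfolding mbound_def
proof (intro allI impI)
  fix \<phi> :: "'a tdist" assume \<phi>: "trigpoly \<phi>"
  show "cmod (dpair u \<phi>) \<le> (\<Sum>k\<in>uminus ` {k. u k \<noteq> 0}. cmod (u (- k))) * supnorm \<phi>"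
    unfolding dpair_swap[OF assms \<phi>] sum_distrib_right
    by (rule sum_norm_le) (simp add: norm_mult mult_left_mono cmod_coeff_le_supnorm[OF \<phi>])
qed

lemma cfun_spec:
  assumes "is_cont w"
  shows "periodic_cont (cfun w)" "fcoef (cfun w) = w"
  using assms someI_ex[of "\<lambda>F. periodic_cont F \<and> fcoef F = w"] by (auto simp: is_cont_def cfun_def)

lemma cfun_approx:
  assumes "is_cont w" "e > 0"
  shows "\<exists>\<phi>. trigpoly \<phi> \<and> (\<forall>x. cmod (tp_eval \<phi> x - cfun w x) < e)"
proof (rule trigpoly_dense)
  show "continuous_on UNIV (cfun w)" using cfun_spec(1)[OF assms(1)] by (simp add: periodic_cont_def)
qed (use assms cfun_spec(1) periodic_cont_torus_map in blast)+

lemma cfun_bounded: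
  assumes "is_cont w"
  obtains B where "B > 0" "\<And>x. cmod (cfun w x) \<le> B"
proof -
  obtain \<phi> where \<phi>: "\<And>x. cmod (tp_eval \<phi> x - cfun w x) < 1"
    using cfun_approx[OF assms, of 1] by auto
  have "cmod (cfun w x) \<le> supnorm \<phi> + 1" for x
    using \<phi>[of x] tp_eval_le_supnorm[of \<phi> x] norm_triangle_ineq3[of "tp_eval \<phi> x" "cfun w x"] by linarith
  then show thesis using supnorm_nonneg[of \<phi>] by (intro that[of "supnorm \<phi> + 1"]) auto
qed

text \<open>An error bound linear in the uniform distance gives the limit property in the definite
  description of \<open>mc_pair\<close>, and density of trigonometric polynomials makes that limit
  unique. All later values of \<open>mc_pair\<close> are identified this way.\<close>

lemma mc_pair_unique:
  assumes w: "is_cont w" and C: "C \<ge> 0"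
    and z: "\<And>\<phi> \<delta>. trigpoly \<phi> \<Longrightarrow> (\<And>x. cmod (tp_eval \<phi> x - cfun w x) \<le> \<delta>) \<Longrightarrow> cmod (dpair u \<phi> - z) \<le> C * \<delta>"
  shows "mc_pair u w = z"
  unfolding mc_pair_def
proof (rule the_equality)
  obtain B where B: "\<And>x. cmod (cfun w x) \<le> B" using cfun_bounded[OF w] by blast
  \<comment> \<open>The \<open>SUP\<close> in \<open>mc_pair_def\<close> is a real supremum and
    bounds the single values only once the range is known to be bounded.\<close>
  have bdd: "bdd_above (range (\<lambda>x. cmod (tp_eval \<phi> x - cfun w x)))" for \<phi>
  proof (rule bdd_aboveI2)
    show "cmod (tp_eval \<phi> x - cfun w x) \<le> supnorm \<phi> + B" for x
      using norm_triangle_ineq4[of "tp_eval \<phi> x" "cfun w x"] tp_eval_le_supnorm[of \<phi> x] B[of x] by linarith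
  qed
  show "\<forall>e>0. \<exists>\<delta>>0. \<forall>\<phi>. trigpoly \<phi> \<and> (SUP x. cmod (tp_eval \<phi> x - cfun w x)) < \<delta> \<longrightarrow> cmod (dpair u \<phi> - z) < e"
  proof (intro allI impI)
    fix e :: real assume e: "e > 0"
    show "\<exists>\<delta>>0. \<forall>\<phi>. trigpoly \<phi> \<and> (SUP x. cmod (tp_eval \<phi> x - cfun w x)) < \<delta> \<longrightarrow> cmod (dpair u \<phi> - z) < e"
    proof (intro exI conjI allI impI)
      \<comment> \<open>\<open>C + 1\<close> instead of \<open>C\<close> covers \<open>C = 0\<close>
        and makes the final inequality strict.\<close>
      show "e / (C + 1) > 0" using e C by simp
      fix \<phi> assume \<phi>: "trigpoly \<phi> \<and> (SUP x. cmod (tp_eval \<phi> x - cfun w x)) < e / (C + 1)"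
      have "cmod (tp_eval \<phi> x - cfun w x) \<le> e / (C + 1)" for x
        using cSUP_upper[OF UNIV_I bdd, of \<phi> x] \<phi> by linarith
      then have "cmod (dpair u \<phi> - z) \<le> C * (e / (C + 1))" using z \<phi> by blast
      also have "\<dots> < e" using e C by (simp add: field_simps)
      finally show "cmod (dpair u \<phi> - z) < e" .
    qed
  qed
  fix z' assume z': "\<forall>e>0. \<exists>\<delta>>0. \<forall>\<phi>. trigpoly \<phi> \<and> (SUP x. cmod (tp_eval \<phi> x - cfun w x)) < \<delta> \<longrightarrow> cmod (dpair u \<phi> - z') < e"
  show "z' = z"
  proof (rule ccontr)
    assume "z' \<noteq> z"
    define e where "e = cmod (z' - z) / 2"
    have e: "e > 0" using \<open>z' \<noteq> z\<close> by (simp add: e_def)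
    obtain \<delta> where \<delta>: "\<delta> > 0" "\<And>\<phi>. trigpoly \<phi> \<Longrightarrow> (SUP x. cmod (tp_eval \<phi> x - cfun w x)) < \<delta> \<Longrightarrow> cmod (dpair u \<phi> - z') < e"
      using z' e by blast
    \<comment> \<open>One polynomial within \<open>\<eta>\<close> of \<open>cfun w\<close> has a
      pairing close to both candidates: \<open>\<eta> < \<delta>\<close> serves \<open>z'\<close>,
      and \<open>C * \<eta> < e\<close> serves \<open>z\<close>.\<close>
    define \<eta> where "\<eta> = min (\<delta> / 2) (e / (C + 1))"
    have \<eta>: "\<eta> > 0" "\<eta> < \<delta>" "C * \<eta> < e"
    proof -
      show "\<eta> > 0" "\<eta> < \<delta>" using \<delta>(1) e C by (auto simp: \<eta>_def min_less_iff_disj)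
      have "C * \<eta> \<le> C * (e / (C + 1))" using C by (intro mult_left_mono) (auto simp: \<eta>_def)
      also have "\<dots> < e" using e C by (simp add: field_simps)
      finally show "C * \<eta> < e" .
    qed
    obtain \<phi> where \<phi>: "trigpoly \<phi>" "\<And>x. cmod (tp_eval \<phi> x - cfun w x) < \<eta>"
      using cfun_approx[OF w \<eta>(1)] by blast
    have "(SUP x. cmod (tp_eval \<phi> x - cfun w x)) \<le> \<eta>"
      by (rule cSUP_least) (use \<phi>(2) less_imp_le in auto)
    then have 1: "cmod (dpair u \<phi> - z') < e" using \<delta>(2)[OF \<phi>(1)] \<eta> by simp
    have 2: "cmod (dpair u \<phi> - z) < e" using z[OF \<phi>(1), of \<eta>] \<phi>(2) \<eta>(3) less_imp_le by fastforce
    have "cmod (z' - z) \<le> cmod (dpair u \<phi> - z') + cmod (dpair u \<phi> - z)"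
      by (metis norm_minus_commute norm_triangle_ineq add_diff_eq diff_add_cancel)
    then show False using 1 2 by (simp add: e_def)
  qed
qed

text \<open>Existence of the pairing: along polynomials converging uniformly to
  \<open>cfun w\<close> the pairings with \<open>u\<close> form a Cauchy sequence, and its limit
  satisfies the error bound required by \<open>mc_pair_unique\<close>.\<close>

lemma mc_pair_approx:
  assumes u: "mbound u C" and w: "is_cont w"
    and \<phi>: "trigpoly \<phi>" "\<And>x. cmod (tp_eval \<phi> x - cfun w x) \<le> \<delta>"
  shows "cmod (dpair u \<phi> - mc_pair u w) \<le> C * \<delta>"
proof -
  have "\<forall>n. \<exists>\<psi>. trigpoly \<psi> \<and> (\<forall>x. cmod (tp_eval \<psi> x - cfun w x) < inverse (real (Suc n)))"
    by (intro allI cfun_approx[OF w]) simp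
  then obtain \<psi> where \<psi>: "\<And>n. trigpoly (\<psi> n)" "\<And>n x. cmod (tp_eval (\<psi> n) x - cfun w x) < inverse (real (Suc n))"
    by metis
  have diff: "cmod (dpair u \<phi> - dpair u \<phi>') \<le> C * (\<delta> + \<delta>')"
    if "trigpoly \<phi>" "trigpoly \<phi>'" "\<And>x. cmod (tp_eval \<phi> x - cfun w x) \<le> \<delta>"
      "\<And>x. cmod (tp_eval \<phi>' x - cfun w x) \<le> \<delta>'" for \<phi> \<phi>' \<delta> \<delta>'
  proof -
    have "cmod (tp_eval (\<lambda>k. \<phi> k - \<phi>' k) x) \<le> \<delta> + \<delta>'" for x
      using norm_triangle_ineq4[of "tp_eval \<phi> x - cfun w x" "tp_eval \<phi>' x - cfun w x"] that(3)[of x] that(4)[of x]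
      by (simp add: tp_eval_diff that(1,2))
    then show ?thesis
      using mbound_dpair_le[OF u trigpoly_diff[OF that(1,2)]] by (simp add: dpair_diff that)
  qed
  have C: "C \<ge> 0" by (rule mbound_nonneg[OF u])
  have lim: "(\<lambda>n. C * (\<delta> + inverse (real (Suc n)))) \<longlonglongrightarrow> C * (\<delta> + 0)" for \<delta>
    by (intro tendsto_intros LIMSEQ_inverse_real_of_nat)
  have "Cauchy (\<lambda>n. dpair u (\<psi> n))"
  proof (rule CauchyI)
    fix e :: real assume e: "e > 0"
    have "(\<lambda>n. C * (0 + inverse (real (Suc n)))) \<longlonglongrightarrow> 0" using lim[of 0] by simp
    then obtain N where N: "\<And>n. n \<ge> N \<Longrightarrow> C * inverse (real (Suc n)) < e / 2"
      using order_tendstoD(2)[of _ 0 sequentially "e/2"] e by (fastforce simp: eventually_sequentially)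
    have "cmod (dpair u (\<psi> m) - dpair u (\<psi> n)) < e" if "m \<ge> N" "n \<ge> N" for m n
      using diff[OF \<psi>(1) \<psi>(1) less_imp_le[OF \<psi>(2)] less_imp_le[OF \<psi>(2)], of m n] N[OF that(1)] N[OF that(2)]
      by (simp add: distrib_left)
    then show "\<exists>M. \<forall>m\<ge>M. \<forall>n\<ge>M. cmod (dpair u (\<psi> m) - dpair u (\<psi> n)) < e" by blast
  qed
  then obtain z where z: "(\<lambda>n. dpair u (\<psi> n)) \<longlonglongrightarrow> z" using Cauchy_convergent convergent_def by blast
  have approx: "cmod (dpair u \<phi> - z) \<le> C * \<delta>"
    if "trigpoly \<phi>" "\<And>x. cmod (tp_eval \<phi> x - cfun w x) \<le> \<delta>" for \<phi> \<delta>
  proof (rule LIMSEQ_le)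
    show "(\<lambda>n. cmod (dpair u \<phi> - dpair u (\<psi> n))) \<longlonglongrightarrow> cmod (dpair u \<phi> - z)"
      by (intro tendsto_intros z)
    show "(\<lambda>n. C * (\<delta> + inverse (real (Suc n)))) \<longlonglongrightarrow> C * \<delta>" using lim[of \<delta>] by simp
    show "\<exists>N. \<forall>n\<ge>N. cmod (dpair u \<phi> - dpair u (\<psi> n)) \<le> C * (\<delta> + inverse (real (Suc n)))"
      using diff[OF that(1) \<psi>(1) that(2) less_imp_le[OF \<psi>(2)]] by blast
  qed
  then have "mc_pair u w = z" by (rule mc_pair_unique[OF w C])
  then show ?thesis using approx[OF \<phi>] by simp
qed

lemma mc_pair_le:
  assumes "mbound u C" "is_cont w" "\<And>x. cmod (cfun w x) \<le> B"
  shows "cmod (mc_pair u w) \<le> C * B"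
  using mc_pair_approx[OF assms(1,2) trigpoly_zero, of B] assms(3)
  by (simp add: tp_eval_def dpair_def)

lemma mc_pair_linear:
  assumes u: "mbound u C" and v: "mbound v D" and w: "is_cont w"
  shows "mc_pair (\<lambda>k. a * u k + b * v k) w = a * mc_pair u w + b * mc_pair v w"
proof (rule mc_pair_unique[OF w, where C = "cmod a * C + cmod b * D"])
  show "0 \<le> cmod a * C + cmod b * D" using mbound_nonneg[OF u] mbound_nonneg[OF v] by auto
  fix \<phi> \<delta> assume \<phi>: "trigpoly \<phi>" "\<And>x. cmod (tp_eval \<phi> x - cfun w x) \<le> \<delta>"
  have "cmod (dpair (\<lambda>k. a * u k + b * v k) \<phi> - (a * mc_pair u w + b * mc_pair v w))
      = cmod (a * (dpair u \<phi> - mc_pair u w) + b * (dpair v \<phi> - mc_pair v w))"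
    by (simp add: dpair_left_linear algebra_simps)
  also have "\<dots> \<le> cmod a * cmod (dpair u \<phi> - mc_pair u w) + cmod b * cmod (dpair v \<phi> - mc_pair v w)"
    by (metis norm_triangle_ineq norm_mult)
  also have "\<dots> \<le> cmod a * (C * \<delta>) + cmod b * (D * \<delta>)"
    by (intro add_mono mult_left_mono mc_pair_approx u v w \<phi>) auto
  finally show "cmod (dpair (\<lambda>k. a * u k + b * v k) \<phi> - (a * mc_pair u w + b * mc_pair v w)) \<le> (cmod a * C + cmod b * D) * \<delta>"
    by (simp add: algebra_simps)
qed

text \<open>A finite Parseval sum: uniform approximation of \<open>cfun w\<close> forces
  approximation of each coefficient of \<open>w\<close> with the same error.\<close>

lemma mc_pair_trigpoly:
  assumes u: "trigpoly u" and w: "is_cont w"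
  shows "mc_pair u w = (\<Sum>k\<in>uminus ` {k. u k \<noteq> 0}. u (- k) * w k)"
proof (rule mc_pair_unique[OF w, where C = "\<Sum>k\<in>uminus ` {k. u k \<noteq> 0}. cmod (u (- k))"])
  fix \<phi> \<delta> assume \<phi>: "trigpoly \<phi>" "\<And>x. cmod (tp_eval \<phi> x - cfun w x) \<le> \<delta>"
  have le: "cmod (\<phi> k - w k) \<le> \<delta>" for k
    using cmod_fcoef_diff_le[OF continuous_on_tp_eval _ \<phi>(2), of k] cfun_spec[OF w] fcoef_tp_eval[OF \<phi>(1)]
    by (simp add: periodic_cont_def)
  show "cmod (dpair u \<phi> - (\<Sum>k\<in>uminus ` {k. u k \<noteq> 0}. u (- k) * w k))
      \<le> (\<Sum>k\<in>uminus ` {k. u k \<noteq> 0}. cmod (u (- k))) * \<delta>"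
    unfolding dpair_swap[OF u \<phi>(1)] sum_distrib_right sum_subtractf[symmetric]
    by (rule sum_norm_le) (use le in \<open>simp add: right_diff_distrib[symmetric] norm_mult mult_left_mono\<close>)
qed (auto intro: sum_nonneg)

lemma mc_pair_zero: "is_cont w \<Longrightarrow> mc_pair (\<lambda>_. 0) w = 0"
  using mc_pair_trigpoly[OF trigpoly_zero] by simp

lemma continuous_on_coordinate: "continuous_on S (\<lambda>f::'a \<Rightarrow> complex. f k)"
  by (rule continuous_on_subset[OF continuous_on_product_coordinates]) simp

text \<open>On a set with a common bound \<open>C\<close> the pairing is a uniform limit of pairings
  with polynomials, and each of those depends on finitely many coefficients. This is what reduces
  weak* questions to pointwise convergence.\<close>

lemma continuous_on_mc_pair:
  assumes X: "\<And>f. f \<in> X \<Longrightarrow> mbound (Lop L f) C" and w: "is_cont w"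
  shows "continuous_on X (\<lambda>f. mc_pair (Lop L f) w)"
proof -
  have "\<forall>n. \<exists>\<psi>. trigpoly \<psi> \<and> (\<forall>x. cmod (tp_eval \<psi> x - cfun w x) < inverse (real (Suc n)))"
    by (intro allI cfun_approx[OF w]) simp
  then obtain \<psi> where \<psi>: "\<And>n. trigpoly (\<psi> n)" "\<And>n x. cmod (tp_eval (\<psi> n) x - cfun w x) < inverse (real (Suc n))"
    by metis
  have "uniform_limit X (\<lambda>n f. dpair (Lop L f) (\<psi> n)) (\<lambda>f. mc_pair (Lop L f) w) sequentially"
  proof (rule uniform_limitI)
    fix e :: real assume e: "e > 0"
    have "(\<lambda>n. C * inverse (real (Suc n))) \<longlonglongrightarrow> C * 0"
      by (intro tendsto_intros LIMSEQ_inverse_real_of_nat)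
    then have "\<forall>\<^sub>F n in sequentially. C * inverse (real (Suc n)) < e"
      using e by (auto dest: order_tendstoD)
    then show "\<forall>\<^sub>F n in sequentially. \<forall>f\<in>X. dist (dpair (Lop L f) (\<psi> n)) (mc_pair (Lop L f) w) < e"
    proof eventually_elim
      case (elim n)
      show ?case
        unfolding dist_norm
        using mc_pair_approx[OF X w \<psi>(1) less_imp_le[OF \<psi>(2)], of _ n] elim by (auto intro: le_less_trans)
    qed
  qed
  moreover have "\<forall>\<^sub>F n in sequentially. continuous_on X (\<lambda>f. dpair (Lop L f) (\<psi> n))"
    unfolding dpair_def Lop_def
    by (intro always_eventually allI continuous_on_sum continuous_on_mult continuous_on_const continuous_on_coordinate)
  ultimately show ?thesis by (intro uniform_limit_theorem) auto
qed

lemma continuous_on_nu_pair: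
  assumes X: "\<And>f. f \<in> X \<Longrightarrow> mbound (Lop L f) C" and g: "g \<in> meas_sp L"
  shows "continuous_on X (\<lambda>f. nu_pair L g f)"
proof -
  have "continuous_on X (\<lambda>f. mc_pair (Lop L f) (Lop (adj (pinv L)) g))"
    using g by (intro continuous_on_mc_pair[where C = C]) (auto simp: meas_sp_def X)
  moreover have "continuous_on X (\<lambda>f. \<Sum>k\<in>nullset L. g k * f (- k))"
    by (intro continuous_on_sum continuous_on_mult continuous_on_const continuous_on_coordinate)
  ultimately show ?thesis
    unfolding nu_pair_def by (rule continuous_on_add)
qed

subsection \<open>Existence of minimisers and weak* compactness\<close>

lemma slowly_growing_mult:
  assumes "slowly_growing c" "slowly_growing d"
  shows "slowly_growing (\<lambda>k. c k * d k)"
proof -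
  obtain C N D M where c: "\<And>k. cmod (c k) \<le> C * (1 + norm (rvec k)) ^ N"
    and d: "\<And>k. cmod (d k) \<le> D * (1 + norm (rvec k)) ^ M"
    using assms unfolding slowly_growing_def by blast
  have "cmod (c k * d k) \<le> (C * D) * (1 + norm (rvec k)) ^ (N + M)" for k
    using mult_mono[OF c[of k] d[of k] order_trans[OF norm_ge_zero c[of k]] norm_ge_zero]
    by (simp add: norm_mult power_add mult_ac)
  then show ?thesis unfolding slowly_growing_def by blast
qed

lemma slowly_growing_add:
  assumes "slowly_growing c" "slowly_growing d"
  shows "slowly_growing (\<lambda>k. c k + d k)"
proof -
  obtain C N D M where c: "\<And>k. cmod (c k) \<le> C * (1 + norm (rvec k)) ^ N"
    and d: "\<And>k. cmod (d k) \<le> D * (1 + norm (rvec k)) ^ M"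
    using assms unfolding slowly_growing_def by blast
  have C: "C \<ge> 0" "D \<ge> 0"
    using order_trans[OF norm_ge_zero c[of 0]] order_trans[OF norm_ge_zero d[of 0]] by auto
  have "cmod (c k + d k) \<le> (C + D) * (1 + norm (rvec k)) ^ (max N M)" for k
  proof -
    have "cmod (c k + d k) \<le> C * (1 + norm (rvec k)) ^ N + D * (1 + norm (rvec k)) ^ M"
      using norm_triangle_ineq[of "c k" "d k"] c[of k] d[of k] by linarith
    also have "\<dots> \<le> C * (1 + norm (rvec k)) ^ (max N M) + D * (1 + norm (rvec k)) ^ (max N M)"
      using C by (intro add_mono mult_left_mono power_increasing) auto
    finally show ?thesis by (simp add: algebra_simps)
  qed
  then show ?thesis unfolding slowly_growing_def by blast
qed

lemma slowly_growing_cmul: "slowly_growing c \<Longrightarrow> slowly_growing (\<lambda>k. a * c k)"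
proof -
  have "slowly_growing (\<lambda>_::int^'a. a)"
    unfolding slowly_growing_def by (rule exI[of _ "cmod a"], rule exI[of _ 0]) simp
  then show "slowly_growing c \<Longrightarrow> slowly_growing (\<lambda>k. a * c k)" by (rule slowly_growing_mult)
qed

lemma slowly_growing_trigpoly:
  assumes "trigpoly c"
  shows "slowly_growing c"
  using mbound_slowly_growing[OF mbound_trigpoly[OF assms]] .

lemma real_dist_linear:
  "real_dist f \<Longrightarrow> real_dist g \<Longrightarrow> real_dist (\<lambda>k. complex_of_real a * f k + complex_of_real b * g k)"
  by (simp add: real_dist_def)

lemma Lop_linear: "Lop L (\<lambda>k. a * f k + b * g k) = (\<lambda>k. a * Lop L f k + b * Lop L g k)"
  by (auto simp: Lop_def algebra_simps)

lemma native_sp_mbound: "f \<in> native_sp L \<Longrightarrow> \<exists>C. mbound (Lop L f) C"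
  by (simp add: native_sp_def is_measure_iff_mbound)

lemma native_sp_linear:
  assumes "f \<in> native_sp L" "g \<in> native_sp L"
  shows "(\<lambda>k. complex_of_real a * f k + complex_of_real b * g k) \<in> native_sp L"
proof -
  obtain C D where "mbound (Lop L f) C" "mbound (Lop L g) D"
    using assms[THEN native_sp_mbound] by blast
  then have "is_measure (Lop L (\<lambda>k. complex_of_real a * f k + complex_of_real b * g k))"
    unfolding Lop_linear is_measure_iff_mbound using mbound_linear by blast
  then show ?thesis
    using assms unfolding native_sp_def
    by (simp add: real_dist_linear slowly_growing_add slowly_growing_cmul)
qed

lemma nu_pair_linear:
  assumes "f \<in> native_sp L" "h \<in> native_sp L" "g \<in> meas_sp L"
  shows "nu_pair L g (\<lambda>k. a * f k + b * h k) = a * nu_pair L g f + b * nu_pair L g h"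
proof -
  obtain C D where "mbound (Lop L f) C" "mbound (Lop L h) D"
    using assms(1,2)[THEN native_sp_mbound] by blast
  moreover have "is_cont (Lop (adj (pinv L)) g)" using assms by (simp add: meas_sp_def)
  ultimately have "mc_pair (Lop L (\<lambda>k. a * f k + b * h k)) (Lop (adj (pinv L)) g)
     = a * mc_pair (Lop L f) (Lop (adj (pinv L)) g) + b * mc_pair (Lop L h) (Lop (adj (pinv L)) g)"
    unfolding Lop_linear by (rule mc_pair_linear)
  then show ?thesis
    unfolding nu_pair_def by (simp add: algebra_simps sum.distrib sum_distrib_left)
qed

section \<open>Compact sets for pointwise convergence of coefficients\<close>

lemma compact_pointwise_bounded:
  "compact {f :: 'a \<Rightarrow> complex. \<forall>k. cmod (f k) \<le> b k}"
proof -
  have "compactin (product_topology (\<lambda>i. euclidean) UNIV) (PiE UNIV (\<lambda>k::'a. cball (0::complex) (b k)))"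
    unfolding compactin_PiE by simp
  then have "compact (PiE UNIV (\<lambda>k::'a. cball (0::complex) (b k)))"
    unfolding euclidean_product_topology by simp
  moreover have "PiE UNIV (\<lambda>k::'a. cball (0::complex) (b k)) = {f. \<forall>k. cmod (f k) \<le> b k}"
    by (auto simp: PiE_UNIV_domain Pi_def)
  ultimately show ?thesis by simp
qed

lemma closed_real_dist: "closed {f :: ('d::finite) tdist. real_dist f}"
  unfolding real_dist_def
  by (intro closed_Collect_all closed_Collect_eq continuous_on_cnj continuous_on_coordinate)

lemma closed_mbound: "closed {f. mbound (Lop L f) C}"
  unfolding mbound_def dpair_def Lop_def
  by (intro closed_Collect_all closed_Collect_imp closed_Collect_le continuous_on_norm
      continuous_on_sum continuous_on_mult continuous_on_const continuous_on_coordinate) simp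

text \<open>Off the null frequencies a bound \<open>R\<close> on \<open>Lop L f\<close> gives the
  coefficient bound \<open>R * cmod (pinv L k)\<close>; on them \<open>pinv L k = 0\<close>, and the
  summand 1 leaves the bound \<open>R\<close>. The coefficient bounds supply the
  compactness.\<close>

definition nat_ball :: "('d::finite) tdist \<Rightarrow> real \<Rightarrow> 'd tdist set" where
  "nat_ball L R = {f. real_dist f \<and> mbound (Lop L f) R \<and> (\<forall>k. cmod (f k) \<le> R * (1 + cmod (pinv L k)))}"

lemma compact_nat_ball: "compact (nat_ball L R)"
proof -
  have "nat_ball L R = {f. \<forall>k. cmod (f k) \<le> R * (1 + cmod (pinv L k))} \<inter>
     ({f. real_dist f} \<inter> {f. mbound (Lop L f) R})"
    by (auto simp: nat_ball_def)
  then show ?thesis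
    by (simp add: compact_Int_closed compact_pointwise_bounded closed_Int closed_real_dist closed_mbound)
qed

locale spline_problem =
  fixes L :: "('d::finite) tdist"
    and \<nu> :: "'m::finite \<Rightarrow> 'd tdist"
    and E :: "real^'m \<Rightarrow> real^'m \<Rightarrow> ennreal"
    and y :: "real^'m"
    and lam :: real
  assumes adm: "spline_admissible L"
    and real_L: "real_op L"
    and nu_CL: "\<And>m. \<nu> m \<in> meas_sp L"
    and nu_indep: "\<And>c :: 'm \<Rightarrow> real.
         (\<forall>k. (\<Sum>m\<in>UNIV. complex_of_real (c m) * \<nu> m k) = 0) \<Longrightarrow> c = (\<lambda>_. 0)"
    and nu_inj: "\<And>p. p \<in> null_sp L \<Longrightarrow> (\<forall>m. nu_pair L (\<nu> m) p = 0) \<Longrightarrow> p = (\<lambda>_. 0)"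
    and E_lsc: "\<And>z x X. X \<longlonglongrightarrow> x \<Longrightarrow> E z x \<le> liminf (\<lambda>n. E z (X n))"
    and E_convex: "\<And>z a b t. 0 \<le> t \<Longrightarrow> t \<le> 1 \<Longrightarrow>
         E z (t *\<^sub>R a + (1 - t) *\<^sub>R b) \<le> ennreal t * E z a + ennreal (1 - t) * E z b"
    and E_coercive: "\<And>z (C::real). \<exists>R. \<forall>x. R \<le> norm x \<longrightarrow> ennreal C \<le> E z x"
    and E_proper: "\<And>z. \<exists>x. E z x < \<infinity>"
    and lam: "lam > 0"
begin

abbreviation "mv \<equiv> meas_vec L \<nu>"

definition cost :: "'d tdist \<Rightarrow> ennreal" where
  "cost f = E y (mv f) + ennreal (lam * mnorm (Lop L f))"

lemma finite_nullset: "finite (nullset L)"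
  using adm by (simp add: spline_admissible_def)

lemma nullset_minus: "- k \<in> nullset L \<longleftrightarrow> k \<in> nullset L"
  using real_L by (simp add: nullset_def real_op_def)

text \<open>The Penrose equations, read at each frequency, determine the pseudoinverse, so the
  witness \<open>D\<close> of admissibility is \<open>pinv L\<close>.\<close>

lemma slowly_growing_pinv: "slowly_growing (pinv L)"
proof -
  obtain D where D: "slowly_growing D" "\<And>k. L k * D k * L k = L k" "\<And>k. D k * L k * D k = D k"
    using adm unfolding spline_admissible_def by blast
  have "D k = pinv L k" for k
    using D(2)[of k] D(3)[of k] by (auto simp: pinv_def field_simps)
  then have "D = pinv L" by auto
  then show ?thesis using D by simp
qed

lemma pinv_minus: "pinv L (- k) = cnj (pinv L k)"
  using real_L by (simp add: pinv_def real_op_def)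

lemma real_dist_Lop: "real_dist f \<Longrightarrow> real_dist (Lop L f)"
  using real_L by (simp add: real_dist_def Lop_def real_op_def)

lemma cont_nu: "is_cont (Lop (adj (pinv L)) (\<nu> m))"
  using nu_CL by (simp add: meas_sp_def)

lemma null_spD:
  assumes "p \<in> null_sp L"
  shows "real_dist p" "\<And>k. k \<notin> nullset L \<Longrightarrow> p k = 0" "Lop L p = (\<lambda>_. 0)"
  using assms by (auto simp: null_sp_def Lop_def nullset_def fun_eq_iff)

lemma null_spI:
  assumes "real_dist p" "\<And>k. k \<notin> nullset L \<Longrightarrow> p k = 0"
  shows "p \<in> null_sp L"
proof -
  have "trigpoly p" unfolding trigpoly_def
    by (rule finite_subset[OF _ finite_nullset]) (use assms in auto)
  then show ?thesis
    using assms by (auto simp: null_sp_def Lop_def nullset_def fun_eq_iff slowly_growing_trigpoly)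
qed

lemma null_sp_native: "p \<in> null_sp L \<Longrightarrow> p \<in> native_sp L"
  unfolding native_sp_def is_measure_iff_mbound
  using mbound_trigpoly[OF trigpoly_zero] by (auto simp: null_sp_def)

lemma zero_native: "(\<lambda>_. 0) \<in> native_sp L"
  by (rule null_sp_native, rule null_spI) (auto simp: real_dist_def)

lemma null_sp_linear:
  assumes "p \<in> null_sp L" "q \<in> null_sp L"
  shows "(\<lambda>k. complex_of_real a * p k + complex_of_real b * q k) \<in> null_sp L"
  using assms[THEN null_spD(1)] assms[THEN null_spD(2)] by (intro null_spI real_dist_linear) auto

lemma nu_pair_null:
  assumes "p \<in> null_sp L"
  shows "nu_pair L (\<nu> m) p = (\<Sum>k\<in>nullset L. \<nu> m k * p (- k))"
  using null_spD(3)[OF assms] by (simp add: nu_pair_def mc_pair_zero cont_nu)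

text \<open>The null frequencies are symmetric under negation, and conjugation exchanges the terms
  at \<open>k\<close> and \<open>- k\<close>. This links \<open>nu_inj\<close>, which speaks of
  complex pairings, to \<open>meas_vec\<close>, which keeps real parts.\<close>

lemma nu_pair_null_real:
  assumes "p \<in> null_sp L"
  shows "nu_pair L (\<nu> m) p = complex_of_real (Re (nu_pair L (\<nu> m) p))"
proof -
  have r: "real_dist (\<nu> m)" "real_dist p" using nu_CL null_spD[OF assms] by (auto simp: meas_sp_def)
  have "cnj (\<Sum>k\<in>nullset L. \<nu> m k * p (- k)) = (\<Sum>k\<in>nullset L. \<nu> m (- k) * p k)"
    using r by (simp add: real_dist_def)
  also have "\<dots> = (\<Sum>k\<in>nullset L. \<nu> m k * p (- k))"
    by (rule sum.reindex_bij_witness[of _ uminus uminus]) (auto simp: nullset_minus)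
  finally show ?thesis
    by (metis Reals_cnj_iff nu_pair_null[OF assms] of_real_Re)
qed

lemma mv_linear:
  assumes "f \<in> native_sp L" "h \<in> native_sp L"
  shows "mv (\<lambda>k. complex_of_real a * f k + complex_of_real b * h k) = a *\<^sub>R mv f + b *\<^sub>R mv h"
  using assms nu_CL by (simp add: meas_vec_def vec_eq_iff nu_pair_linear)

lemma mv_sum:
  assumes "finite I" "\<And>i. i \<in> I \<Longrightarrow> f i \<in> native_sp L"
  shows "(\<lambda>k. \<Sum>i\<in>I. complex_of_real (c i) * f i k) \<in> native_sp L \<and>
    mv (\<lambda>k. \<Sum>i\<in>I. complex_of_real (c i) * f i k) = (\<Sum>i\<in>I. c i *\<^sub>R mv (f i))"
  using assms
proof (induction I)
  case empty
  then show ?case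
    using mv_linear[OF zero_native zero_native, of 0 0] zero_native by simp
next
  case (insert i I)
  then show ?case
    using native_sp_linear[of "f i" L "\<lambda>k. \<Sum>i\<in>I. complex_of_real (c i) * f i k" "c i" 1]
     mv_linear[of "f i" "\<lambda>k. \<Sum>i\<in>I. complex_of_real (c i) * f i k" "c i" 1]
    by simp
qed

lemma mv_null_eq_0:
  assumes "p \<in> null_sp L" "mv p = 0"
  shows "p = (\<lambda>_. 0)"
proof (rule nu_inj[OF assms(1)], rule allI)
  fix m
  have "Re (nu_pair L (\<nu> m) p) = 0" using assms(2) by (simp add: meas_vec_def vec_eq_iff)
  then show "nu_pair L (\<nu> m) p = 0" using nu_pair_null_real[OF assms(1)] by (metis of_real_0)
qed

lemma null_part:
  assumes "real_dist f"
  shows "(\<lambda>k. if L k = 0 then f k else 0) \<in> null_sp L"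
  using assms real_L by (intro null_spI) (auto simp: nullset_def real_dist_def real_op_def)

section \<open>The measurement map and bounds on sublevel sets of the cost\<close>

lemma continuous_on_mv:
  assumes "\<And>f. f \<in> X \<Longrightarrow> mbound (Lop L f) C"
  shows "continuous_on X mv"
  unfolding meas_vec_def [abs_def]
  by (intro continuous_on_vec_lambda continuous_on_Re continuous_on_nu_pair[where C = C] assms nu_CL)

text \<open>An injective linear map on a finite-dimensional space is bounded below:
  \<open>norm (mv p)\<close> attains a positive minimum on the compact unit sphere \<open>S\<close>
  of the null space.\<close>

lemma mv_inj_bound: "\<exists>K\<ge>0. \<forall>p\<in>null_sp L. (\<Sum>k\<in>nullset L. cmod (p k)) \<le> K * norm (mv p)"
proof -
  define S where "S = {p \<in> null_sp L. (\<Sum>k\<in>nullset L. cmod (p k)) = 1}"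
  have "S = {p. \<forall>k. cmod (p k) \<le> 1} \<inter> ({p. real_dist p} \<inter> {p. \<forall>k. k \<notin> nullset L \<longrightarrow> p k = 0}
      \<inter> {p. (\<Sum>k\<in>nullset L. cmod (p k)) = 1})" (is "_ = ?B \<inter> ?C")
  proof (intro equalityI subsetI IntI)
    fix p assume p: "p \<in> S"
    then have n: "p \<in> null_sp L" "(\<Sum>k\<in>nullset L. cmod (p k)) = 1" by (auto simp: S_def)
    have "cmod (p k) \<le> 1" for k
    proof (cases "k \<in> nullset L")
      case True
      then show ?thesis using member_le_sum[of k "nullset L" "\<lambda>k. cmod (p k)"] finite_nullset n by simp
    qed (simp add: null_spD(2)[OF n(1)])
    then show "p \<in> ?B" by simp
    show "p \<in> {p. real_dist p}" "p \<in> {p. \<forall>k. k \<notin> nullset L \<longrightarrow> p k = 0}" "p \<in> {p. (\<Sum>k\<in>nullset L. cmod (p k)) = 1}"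
      using n null_spD[OF n(1)] by auto
  next
    fix p assume "p \<in> ?B \<inter> ?C"
    then show "p \<in> S" by (auto simp: S_def intro!: null_spI)
  qed
  moreover have "closed ?C"
    by (intro closed_Int closed_real_dist closed_Collect_all closed_Collect_imp closed_Collect_eq continuous_on_sum
        continuous_on_norm continuous_on_coordinate continuous_on_const) simp
  ultimately have "compact S" by (simp add: compact_Int_closed compact_pointwise_bounded)
  have mb: "mbound (Lop L p) 0" if "p \<in> S" for p
    using that null_spD(3)[of p] by (simp add: S_def mbound_def dpair_def)
  show ?thesis
  \<comment> \<open>If \<open>S\<close> is empty, normalisation shows that the null space is
    trivial, and \<open>K = 0\<close> works. Otherwise \<open>K\<close> is the inverse of the
    minimum over \<open>S\<close>.\<close>
  proof (cases "S = {}")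
    case True
    have "(\<Sum>k\<in>nullset L. cmod (p k)) \<le> 0" if p: "p \<in> null_sp L" for p
    proof (rule ccontr)
      let ?s = "\<Sum>k\<in>nullset L. cmod (p k)"
      assume s: "\<not> ?s \<le> 0"
      have "(\<lambda>k. complex_of_real (1 / ?s) * p k + complex_of_real 0 * p k) \<in> S"
        unfolding S_def using s null_sp_linear[OF p p, of "1 / ?s" 0]
        by (simp add: norm_mult norm_divide sum_divide_distrib[symmetric] del: of_real_sum)
      then show False using True by blast
    qed
    then show ?thesis by (intro exI[of _ 0]) auto
  next
    case False
    have "continuous_on S (\<lambda>p. norm (mv p))"
      by (intro continuous_on_norm continuous_on_mv[OF mb])
    then obtain q where q: "q \<in> S" "\<And>p. p \<in> S \<Longrightarrow> norm (mv q) \<le> norm (mv p)"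
      using continuous_attains_inf[OF \<open>compact S\<close> False] by blast
    have "mv q \<noteq> 0"
      using q(1) mv_null_eq_0[of q] by (auto simp: S_def)
    then have pos: "norm (mv q) > 0" by simp
    have "(\<Sum>k\<in>nullset L. cmod (p k)) \<le> 1 / norm (mv q) * norm (mv p)" if p: "p \<in> null_sp L" for p
    proof (cases "(\<Sum>k\<in>nullset L. cmod (p k)) = 0")
      case False
      let ?s = "\<Sum>k\<in>nullset L. cmod (p k)"
      have s: "?s > 0" using False by (simp add: sum_nonneg order_less_le)
      let ?p = "\<lambda>k. complex_of_real (1 / ?s) * p k + complex_of_real 0 * p k"
      have "?p \<in> S"
        unfolding S_def using s null_sp_linear[OF p p, of "1 / ?s" 0]
        by (simp add: norm_mult norm_divide sum_divide_distrib[symmetric] del: of_real_sum)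
      from q(2)[OF this] have "norm (mv q) \<le> norm ((1 / ?s) *\<^sub>R mv p)"
        using mv_linear[OF null_sp_native[OF p] null_sp_native[OF p], of "1 / ?s" 0] by simp
      then show ?thesis using s pos by (simp add: field_simps)
    qed simp
    then show ?thesis using pos by (intro exI[of _ "1 / norm (mv q)"]) auto
  qed
qed

text \<open>Without a null-space part only the pairing of \<open>Lop L f\<close> with fixed
  continuous functions remains; \<open>B\<close> is the sum of bounds for these functions.\<close>

lemma mv_range_bound:
  "\<exists>B\<ge>0. \<forall>f C. f \<in> native_sp L \<longrightarrow> mbound (Lop L f) C \<longrightarrow> (\<forall>k\<in>nullset L. f k = 0) \<longrightarrow> norm (mv f) \<le> B * C"
proof -
  have "\<forall>m. \<exists>B>0. \<forall>x. cmod (cfun (Lop (adj (pinv L)) (\<nu> m)) x) \<le> B"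
    using cfun_bounded[OF cont_nu] by metis
  then obtain B where B: "\<And>m. B m > 0" "\<And>m x. cmod (cfun (Lop (adj (pinv L)) (\<nu> m)) x) \<le> B m" by metis
  show ?thesis
  proof (intro exI conjI allI impI)
    show "0 \<le> (\<Sum>m\<in>UNIV. B m)" using B(1) by (intro sum_nonneg) (simp add: less_imp_le)
    fix f C assume f: "f \<in> native_sp L" "mbound (Lop L f) C" "\<forall>k\<in>nullset L. f k = 0"
    have "\<bar>mv f $ m\<bar> \<le> C * B m" for m
    proof -
      have "(\<Sum>k\<in>nullset L. \<nu> m k * f (- k)) = 0" using f(3) by (simp add: nullset_minus)
      then have "nu_pair L (\<nu> m) f = mc_pair (Lop L f) (Lop (adj (pinv L)) (\<nu> m))"
        by (simp add: nu_pair_def)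
      then have "cmod (nu_pair L (\<nu> m) f) \<le> C * B m"
        using mc_pair_le[OF f(2) cont_nu B(2)] by simp
      then show ?thesis using abs_Re_le_cmod[of "nu_pair L (\<nu> m) f"] by (simp add: meas_vec_def)
    qed
    then have "(\<Sum>m\<in>UNIV. \<bar>mv f $ m\<bar>) \<le> (\<Sum>m\<in>UNIV. C * B m)" by (intro sum_mono)
    then show "norm (mv f) \<le> (\<Sum>m\<in>UNIV. B m) * C"
      using norm_le_l1_cart[of "mv f"] by (simp add: sum_distrib_left[symmetric] mult.commute)
  qed
qed

lemma nat_ball_native: "nat_ball L R \<subseteq> native_sp L"
proof
  fix f assume f: "f \<in> nat_ball L R"
  then have le: "cmod (f k) \<le> R * (1 + cmod (pinv L k))" for k by (simp add: nat_ball_def)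
  obtain C N where C: "\<And>k. cmod (pinv L k) \<le> C * (1 + norm (rvec k)) ^ N"
    using slowly_growing_pinv unfolding slowly_growing_def by blast
  have R: "R \<ge> 0" using f mbound_nonneg by (auto simp: nat_ball_def)
  have "cmod (f k) \<le> (R * (1 + C)) * (1 + norm (rvec k)) ^ N" for k
  proof -
    have "1 + cmod (pinv L k) \<le> (1 + norm (rvec k)) ^ N + C * (1 + norm (rvec k)) ^ N"
      by (intro add_mono C one_le_power) simp
    then show ?thesis using le[of k] R mult_left_mono[OF _ R] by (fastforce simp: algebra_simps)
  qed
  then have "slowly_growing f" unfolding slowly_growing_def by blast
  then show "f \<in> native_sp L" using f by (auto simp: native_sp_def nat_ball_def is_measure_iff_mbound)
qed

text \<open>The regulariser bounds \<open>Lop L f\<close> but is blind to the null space. Coercivity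
  of \<open>E\<close> bounds the measurements of \<open>f\<close>; subtracting those of the part off
  the null frequencies bounds the measurements of the null part, and with them, by
  \<open>mv_inj_bound\<close>, the null part itself.\<close>

lemma cost_sublevel_bounded: "\<exists>R. {f \<in> native_sp L. cost f \<le> ennreal c} \<subseteq> nat_ball L R"
proof -
  obtain K where K: "K \<ge> 0" "\<And>p. p \<in> null_sp L \<Longrightarrow> (\<Sum>k\<in>nullset L. cmod (p k)) \<le> K * norm (mv p)"
    using mv_inj_bound by blast
  obtain B where B: "B \<ge> 0" "\<And>f C. f \<in> native_sp L \<Longrightarrow> mbound (Lop L f) C \<Longrightarrow> (\<forall>k\<in>nullset L. f k = 0) \<Longrightarrow> norm (mv f) \<le> B * C"
    using mv_range_bound by blast
  \<comment> \<open>\<open>ennreal\<close> sends negative reals to 0, so a nonnegative level is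
    used. Coercivity is then invoked at \<open>c' + 1\<close> to leave a strict gap.\<close>
  define c' where "c' = max c 0"
  obtain Q where Q: "\<And>x. Q \<le> norm x \<Longrightarrow> ennreal (c' + 1) \<le> E y x" using E_coercive[of "c' + 1" y] by blast
  \<comment> \<open>\<open>C\<close> bounds the measure norm. In \<open>R\<close>,
    \<open>max Q 0\<close> bounds the measurements of \<open>f\<close>, \<open>B * C\<close> those
    of \<open>f\<close> without its null part, and \<open>K\<close> turns the resulting bound into
    one on null coefficients.\<close>
  define C where "C = c' / lam"
  define R where "R = C + K * (max Q 0 + B * C)"
  have C: "C \<ge> 0" using lam by (simp add: C_def c'_def)
  show ?thesis
  proof (intro exI subsetI)
    fix f assume f': "f \<in> {f \<in> native_sp L. cost f \<le> ennreal c}"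
    then have f: "f \<in> native_sp L" and cost: "cost f \<le> ennreal c'"
      by (auto simp: c'_def intro: order_trans ennreal_leI)
    have rf: "real_dist f" and me: "is_measure (Lop L f)" using f by (auto simp: native_sp_def)
    have "ennreal (lam * mnorm (Lop L f)) \<le> ennreal c'"
      using cost by (metis cost_def add.commute le_iff_add order_trans)
    then have "mnorm (Lop L f) \<le> C"
      using lam by (simp add: C_def ennreal_le_iff c'_def field_simps)
    then have mb: "mbound (Lop L f) C"
      using mbound_mnorm[OF me] unfolding mbound_def
      by (meson mult_right_mono order_trans supnorm_nonneg)
    have "\<not> Q \<le> norm (mv f)"
    proof
      assume "Q \<le> norm (mv f)"
      then have "ennreal (c' + 1) \<le> ennreal c'" using Q cost unfolding cost_def
        by (meson le_iff_add order_trans)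
      then show False by (simp add: c'_def ennreal_le_iff)
    qed
    then have nv: "norm (mv f) \<le> max Q 0" by simp
    define p where "p = (\<lambda>k. if L k = 0 then f k else 0)"
    have p: "p \<in> null_sp L" unfolding p_def by (rule null_part[OF rf])
    \<comment> \<open>Removing the null part leaves \<open>Lop L f\<close> unchanged and makes
      \<open>mv_range_bound\<close> applicable.\<close>
    define g where "g = (\<lambda>k. complex_of_real 1 * f k + complex_of_real (- 1) * p k)"
    have g: "g \<in> native_sp L" unfolding g_def by (rule native_sp_linear[OF f null_sp_native[OF p]])
    have "Lop L g = Lop L f" by (auto simp: Lop_def g_def p_def)
    then have "norm (mv g) \<le> B * C"
      using B(2)[OF g, of C] mb by (simp add: g_def p_def nullset_def)
    moreover have "mv g = mv f - mv p"
      unfolding g_def by (subst mv_linear[OF f null_sp_native[OF p]]) simp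
    ultimately have "norm (mv p) \<le> max Q 0 + B * C"
      using nv norm_triangle_ineq4[of "mv f" "mv g"] by simp
    then have s: "(\<Sum>k\<in>nullset L. cmod (p k)) \<le> K * (max Q 0 + B * C)"
      using K(2)[OF p] mult_left_mono[OF _ K(1)] order_trans by blast
    have R: "C \<le> R" using K B C by (simp add: R_def)
    have "cmod (f k) \<le> R * (1 + cmod (pinv L k))" for k
    proof (cases "L k = 0")
      case True
      then have "cmod (f k) \<le> (\<Sum>k\<in>nullset L. cmod (p k))"
        using member_le_sum[of k "nullset L" "\<lambda>k. cmod (p k)"] finite_nullset by (simp add: p_def nullset_def)
      then show ?thesis using s True C by (simp add: pinv_def R_def)
    next
      case False
      then have "f k = pinv L k * Lop L f k" by (simp add: pinv_def Lop_def)
      then have "cmod (f k) \<le> cmod (pinv L k) * R"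
        using mbound_coeff[OF mb, of k] R by (simp add: norm_mult mult_left_mono)
      also have "\<dots> \<le> R * (1 + cmod (pinv L k))" using R C by (simp add: algebra_simps)
      finally show ?thesis .
    qed
    moreover have "mbound (Lop L f) R"
      using mb R unfolding mbound_def by (meson mult_right_mono order_trans supnorm_nonneg)
    ultimately show "f \<in> nat_ball L R" using rf by (simp add: nat_ball_def)
  qed
qed

text \<open>Compactness and lower semicontinuity in one statement. Levels decreasing to the infimum
  yield a minimiser; a constant level yields compactness of a sublevel set.\<close>

lemma cost_limit:
  assumes f: "\<And>n. f n \<in> nat_ball L R" and cost: "\<And>n. cost (f n) \<le> ennreal (c n)"
    and c: "\<And>n. c n \<ge> 0" "c \<longlonglongrightarrow> c0"
  shows "\<exists>g r. g \<in> nat_ball L R \<and> strict_mono r \<and> (f \<circ> r) \<longlonglongrightarrow> g \<and> cost g \<le> ennreal c0"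
proof -
  have fn: "f n \<in> native_sp L" for n using f nat_ball_native by blast
  have me: "is_measure (Lop L (f n))" for n using fn by (simp add: native_sp_def)
  define e where "e n = enn2real (E y (mv (f n)))" for n
  define s where "s n = mnorm (Lop L (f n))" for n
  have s0: "s n \<ge> 0" for n using mnorm_nonneg[OF me] by (simp add: s_def)
  have le: "E y (mv (f n)) \<le> ennreal (c n)" for n
    using cost[of n] unfolding cost_def by (meson le_iff_add order_trans)
  \<comment> \<open>The level bound makes the data term finite, so \<open>enn2real\<close> loses
    nothing and the two terms can be handled as reals.\<close>
  have Ee: "E y (mv (f n)) = ennreal (e n)" for n
    unfolding e_def using le[of n] by (simp add: ennreal_enn2real_if top_unique) (metis ennreal_neq_top top_unique)
  have e0: "e n \<ge> 0" for n by (simp add: e_def)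
  have sum: "e n + lam * s n \<le> c n" for n
    using cost[of n] e0[of n] s0[of n] lam c(1)[of n] unfolding cost_def Ee s_def[symmetric]
    by (simp add: ennreal_plus[symmetric] ennreal_le_iff del: ennreal_plus)
  obtain D where D: "\<And>n. c n \<le> D"
    using convergent_imp_Bseq[of c] c(2) by (metis BseqE abs_le_D1 convergent_def real_norm_def)
  \<comment> \<open>Adjoining the two cost terms as coordinates gives one subsequence along which
    the element and both terms converge, so each limit can be compared separately.\<close>
  have "compact (nat_ball L R \<times> ({0..D} \<times> {0..D / lam}))"
    by (intro compact_Times compact_nat_ball compact_Icc)
  moreover have "(f n, e n, s n) \<in> nat_ball L R \<times> ({0..D} \<times> {0..D / lam})" for n
  proof -
    have "0 \<le> lam * s n" using lam s0 by simp
    then have "e n \<le> D" "lam * s n \<le> D" using sum[of n] D[of n] e0[of n] by linarith+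
    then show ?thesis using f[of n] e0[of n] s0[of n] lam by (simp add: field_simps)
  qed
  ultimately obtain l r where l: "l \<in> nat_ball L R \<times> ({0..D} \<times> {0..D / lam})" "strict_mono r"
      "((\<lambda>n. (f n, e n, s n)) \<circ> r) \<longlonglongrightarrow> l"
    unfolding compact_eq_seq_compact_metric seq_compact_def by meson
  obtain g e' s' where l_eq: "l = (g, e', s')" by (cases l) auto
  have lim: "(\<lambda>n. f (r n)) \<longlonglongrightarrow> g" "(\<lambda>n. e (r n)) \<longlonglongrightarrow> e'" "(\<lambda>n. s (r n)) \<longlonglongrightarrow> s'"
    using tendsto_fst[OF l(3)] tendsto_fst[OF tendsto_snd[OF l(3)]] tendsto_snd[OF tendsto_snd[OF l(3)]]
    by (simp_all add: l_eq o_def)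
  have g: "g \<in> nat_ball L R" and s': "s' \<ge> 0" and e': "e' \<ge> 0" using l(1) l_eq by auto
  have contmv: "continuous_on (nat_ball L R) mv"
    by (rule continuous_on_mv[where C = R]) (simp add: nat_ball_def)
  have "(\<lambda>n. mv (f (r n))) \<longlonglongrightarrow> mv g"
    by (rule continuous_on_tendsto_compose[OF contmv lim(1) g]) (simp add: f)
  from E_lsc[OF this, of y] have "E y (mv g) \<le> liminf (\<lambda>n. ennreal (e (r n)))" by (simp add: Ee)
  also have "\<dots> = ennreal e'" by (intro lim_imp_Liminf tendsto_ennrealI lim(2)) simp
  finally have Eg: "E y (mv g) \<le> ennreal e'" .
  \<comment> \<open>The norm is a supremum of functionals that are continuous in the coefficients,
    hence lower semicontinuous.\<close>
  have "mnorm (Lop L g) \<le> s'"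
  proof (rule mnorm_least)
    fix \<phi> :: "'d tdist" assume \<phi>: "trigpoly \<phi>" "supnorm \<phi> \<le> 1"
    have "continuous_on UNIV (\<lambda>f. dpair (Lop L f) \<phi>)"
      unfolding dpair_def Lop_def
      by (intro continuous_on_sum continuous_on_mult continuous_on_const continuous_on_coordinate)
    then have "(\<lambda>n. dpair (Lop L (f (r n))) \<phi>) \<longlonglongrightarrow> dpair (Lop L g) \<phi>"
      by (rule continuous_on_tendsto_compose[OF _ lim(1)]) auto
    then have "(\<lambda>n. cmod (dpair (Lop L (f (r n))) \<phi>)) \<longlonglongrightarrow> cmod (dpair (Lop L g) \<phi>)"
      by (rule tendsto_norm)
    moreover have "cmod (dpair (Lop L (f (r n))) \<phi>) \<le> s (r n)" for n
      unfolding s_def by (rule mnorm_upper[OF me \<phi>])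
    ultimately show "cmod (dpair (Lop L g) \<phi>) \<le> s'" using lim(3) LIMSEQ_le by blast
  qed
  then have "ennreal (lam * mnorm (Lop L g)) \<le> ennreal (lam * s')" using lam by (intro ennreal_leI) simp
  then have "cost g \<le> ennreal e' + ennreal (lam * s')" unfolding cost_def by (intro add_mono Eg)
  also have "\<dots> = ennreal (e' + lam * s')" using s' e' lam by (simp add: ennreal_plus)
  also have "\<dots> \<le> ennreal c0"
  proof (rule ennreal_leI, rule LIMSEQ_le)
    show "(\<lambda>n. e (r n) + lam * s (r n)) \<longlonglongrightarrow> e' + lam * s'" by (intro tendsto_intros lim)
    show "(\<lambda>n. c (r n)) \<longlonglongrightarrow> c0" using LIMSEQ_subseq_LIMSEQ[OF c(2) l(2)] by (simp add: o_def)
  qed (use sum in blast)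
  finally show ?thesis using g l(2) lim(1) by (auto simp: o_def)
qed

text \<open>Off the null frequencies the multiplier \<open>L (- k)\<close> cancels the conjugate of
  \<open>1 / L k\<close>, because \<open>L\<close> is real; the second summand of
  \<open>nu_pair\<close> supplies exactly the frequencies lost there.\<close>

lemma nu_pair_trigpoly:
  assumes f: "trigpoly f" "g \<in> meas_sp L"
  shows "nu_pair L g f = (\<Sum>k\<in>uminus ` {k. f k \<noteq> 0}. g k * f (- k))"
proof -
  let ?S = "uminus ` {k. f k \<noteq> 0}"
  have fin: "finite ?S" using f by (simp add: trigpoly_def)
  have tp: "trigpoly (Lop L f)"
    using f(1) unfolding trigpoly_def Lop_def by (auto elim: rev_finite_subset)
  have "mc_pair (Lop L f) (Lop (adj (pinv L)) g)
     = (\<Sum>k\<in>uminus ` {k. Lop L f k \<noteq> 0}. Lop L f (- k) * Lop (adj (pinv L)) g k)"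
    using f by (intro mc_pair_trigpoly tp) (simp add: meas_sp_def)
  also have "\<dots> = (\<Sum>k\<in>?S. Lop L f (- k) * Lop (adj (pinv L)) g k)"
    by (intro sum.mono_neutral_left fin) (auto simp: Lop_def)
  also have "\<dots> = (\<Sum>k\<in>?S. if k \<in> nullset L then 0 else g k * f (- k))"
    using real_L by (intro sum.cong refl) (auto simp: Lop_def adj_def pinv_def nullset_def real_op_def)
  finally have 1: "mc_pair (Lop L f) (Lop (adj (pinv L)) g) = (\<Sum>k\<in>?S. if k \<in> nullset L then 0 else g k * f (- k))" .
  have "(\<Sum>k\<in>nullset L. g k * f (- k)) = (\<Sum>k\<in>?S \<inter> nullset L. g k * f (- k))"
    using imageI[of _ "{k. f k \<noteq> 0}" uminus]
    by (intro sum.mono_neutral_right finite_nullset) (force simp: image_iff)+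
  also have "\<dots> = (\<Sum>k\<in>?S. if k \<in> nullset L then g k * f (- k) else 0)"
    by (simp add: sum.inter_restrict[OF fin])
  finally have "nu_pair L g f = (\<Sum>k\<in>?S. (if k \<in> nullset L then 0 else g k * f (- k)) + (if k \<in> nullset L then g k * f (- k) else 0))"
    using 1 unfolding nu_pair_def by (simp only: sum.distrib)
  also have "\<dots> = (\<Sum>k\<in>?S. g k * f (- k))" by (intro sum.cong refl) auto
  finally show ?thesis .
qed

lemma trigpoly_native:
  assumes "trigpoly f" "real_dist f"
  shows "f \<in> native_sp L"
proof -
  have "trigpoly (Lop L f)"
    using assms(1) unfolding trigpoly_def Lop_def by (auto elim: rev_finite_subset)
  then show ?thesis
    using assms mbound_trigpoly slowly_growing_trigpoly by (auto simp: native_sp_def is_measure_iff_mbound)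
qed

text \<open>A vector \<open>c\<close> orthogonal to a proper range gives a combination
  \<open>s\<close> of the measurements that kills the native space. Testing against pieces of
  \<open>s\<close> itself shows \<open>s = 0\<close>, contrary to linear independence.\<close>

lemma mv_surj: "\<exists>f\<in>native_sp L. mv f = z"
proof -
  let ?S = "mv ` native_sp L"
  have "subspace ?S"
    unfolding subspace_def
  proof (intro conjI ballI allI)
    show "0 \<in> ?S"
      using mv_linear[OF zero_native zero_native, of 0 0] zero_native by (auto intro!: image_eqI[of _ _ "\<lambda>_. 0"])
  next
    fix a b assume "a \<in> ?S" "b \<in> ?S"
    then obtain f g where fg: "f \<in> native_sp L" "g \<in> native_sp L" "a = mv f" "b = mv g" by auto
    show "a + b \<in> ?S"
      using mv_linear[OF fg(1,2), of 1 1] native_sp_linear[OF fg(1,2), of 1 1] fg(3,4)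
      by (auto intro!: image_eqI)
  next
    fix t a assume "a \<in> ?S"
    then obtain f where fg: "f \<in> native_sp L" "a = mv f" by auto
    show "t *\<^sub>R a \<in> ?S"
      using mv_linear[OF fg(1,1), of t 0] native_sp_linear[OF fg(1,1), of t 0] fg(2)
      by (auto intro!: image_eqI)
  qed
  then have sp: "span ?S = ?S" by (simp add: span_eq_iff)
  have "?S = UNIV"
  proof (rule ccontr)
    assume "?S \<noteq> UNIV"
    then obtain c where c: "c \<noteq> 0" "\<And>f. f \<in> native_sp L \<Longrightarrow> c \<bullet> mv f = 0"
      using span_not_UNIV_orthogonal[of ?S] sp by auto
    define s where "s k = (\<Sum>m\<in>UNIV. complex_of_real (c $ m) * \<nu> m k)" for k
    have rs: "real_dist s"
      using nu_CL by (simp add: s_def real_dist_def meas_sp_def)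
    have "s k0 = 0" for k0
    proof -
      \<comment> \<open>Both \<open>k0\<close> and \<open>- k0\<close> are kept so that
        \<open>f\<close> is real; the pairing of \<open>s\<close> with \<open>f\<close> is then a
        sum of squares \<open>(cmod (f (- k)))\<^sup>2\<close>.\<close>
      define f where "f k = (if k = k0 \<or> k = - k0 then s k else 0)" for k
      have tf: "trigpoly f" unfolding trigpoly_def f_def by (rule finite_subset[of _ "{k0, - k0}"]) auto
      have "(- k = k0 \<or> - k = - k0) \<longleftrightarrow> (k = k0 \<or> k = - k0)" for k by (metis minus_minus)
      then have rf: "real_dist f" using rs by (simp add: real_dist_def f_def)
      let ?S = "uminus ` {k. f k \<noteq> 0}"
      have fin: "finite ?S" using tf by (simp add: trigpoly_def)
      have "0 = c \<bullet> mv f" using c(2)[OF trigpoly_native[OF tf rf]] by simp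
      also have "\<dots> = Re (\<Sum>m\<in>UNIV. c $ m * nu_pair L (\<nu> m) f)"
        by (simp add: inner_vec_def meas_vec_def)
      also have "(\<Sum>m\<in>UNIV. c $ m * nu_pair L (\<nu> m) f) = (\<Sum>k\<in>?S. s k * f (- k))"
        unfolding nu_pair_trigpoly[OF tf nu_CL] s_def sum_distrib_left sum_distrib_right
        by (subst sum.swap) (simp add: mult.assoc)
      also have "\<dots> = (\<Sum>k\<in>?S. complex_of_real ((cmod (f (- k)))\<^sup>2))"
      proof (rule sum.cong[OF refl])
        fix k assume "k \<in> ?S"
        then have "f (- k) \<noteq> 0" by auto
        then have "f (- k) = s (- k)" by (metis f_def)
        moreover have "s (- k) = cnj (s k)" using rs by (simp add: real_dist_def)
        ultimately show "s k * f (- k) = complex_of_real ((cmod (f (- k)))\<^sup>2)"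
          by (simp add: complex_norm_square complex_mod_cnj mult.commute del: of_real_power)
      qed
      finally have "(\<Sum>k\<in>?S. (cmod (f (- k)))\<^sup>2) = 0" by simp
      then have "\<forall>k\<in>?S. (cmod (f (- k)))\<^sup>2 = 0" using fin by (subst (asm) sum_nonneg_eq_0_iff) auto
      then have "f k0 = 0" by auto
      then show ?thesis by (simp add: f_def)
    qed
    then have "(\<lambda>m. c $ m) = (\<lambda>_. 0)" by (intro nu_indep) (simp add: s_def)
    then show False using c(1) by (simp add: vec_eq_iff fun_eq_iff)
  qed
  then show ?thesis by (metis UNIV_I image_iff)
qed

text \<open>Properness and \<open>mv_surj\<close> make the infimum finite, and
  \<open>cost_limit\<close> along a minimising sequence attains it. Describing the solutions as a
  sublevel set opens them to the preceding bounds.\<close>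

lemma solset_eq_sublevel:
  obtains c where "c \<ge> 0" "solset L E y \<nu> lam = {f \<in> native_sp L. cost f \<le> ennreal c}"
    "solset L E y \<nu> lam \<noteq> {}" "\<forall>f\<in>native_sp L. ennreal c \<le> cost f"
proof -
  have sol: "solset L E y \<nu> lam = {f \<in> native_sp L. \<forall>g\<in>native_sp L. cost f \<le> cost g}"
    by (simp add: solset_def cost_def)
  define m where "m = (INF f\<in>native_sp L. cost f)"
  have mle: "m \<le> cost f" if "f \<in> native_sp L" for f unfolding m_def by (rule INF_lower[OF that])
  obtain z where "E y z < \<infinity>" using E_proper by blast
  moreover obtain f0 where f0: "f0 \<in> native_sp L" "mv f0 = z" using mv_surj by blast
  ultimately have "cost f0 < \<infinity>" by (simp add: cost_def)
  then have "m < \<infinity>" using mle[OF f0(1)] by (rule le_less_trans[rotated])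
  then obtain c where c: "m = ennreal c" "c \<ge> 0" by (cases m) auto
  have "\<exists>f\<in>native_sp L. cost f \<le> ennreal (c + inverse (real (Suc n)))" for n
  proof -
    have "m < ennreal (c + inverse (real (Suc n)))" using c by (simp add: ennreal_less_iff)
    then show ?thesis unfolding m_def INF_less_iff using less_imp_le by blast
  qed
  then obtain f where f: "\<And>n. f n \<in> native_sp L" "\<And>n. cost (f n) \<le> ennreal (c + inverse (real (Suc n)))"
    by metis
  obtain R where R: "{f \<in> native_sp L. cost f \<le> ennreal (c + 1)} \<subseteq> nat_ball L R"
    using cost_sublevel_bounded by blast
  have "f n \<in> nat_ball L R" for n
  proof -
    have "ennreal (c + inverse (real (Suc n))) \<le> ennreal (c + 1)"
      by (intro ennreal_leI add_left_mono) (simp add: field_simps)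
    then show ?thesis using f[of n] R order_trans by blast
  qed
  moreover have "(\<lambda>n. c + inverse (real (Suc n))) \<longlonglongrightarrow> c"
    using tendsto_add[OF tendsto_const LIMSEQ_inverse_real_of_nat, of c] by simp
  ultimately obtain g where g: "g \<in> nat_ball L R" "cost g \<le> ennreal c"
    using cost_limit[of f R "\<lambda>n. c + inverse (real (Suc n))" c] f(2) c(2) by auto
  have eq: "solset L E y \<nu> lam = {f \<in> native_sp L. cost f \<le> ennreal c}"
  proof -
    have gn: "g \<in> native_sp L" using g nat_ball_native by blast
    show ?thesis unfolding sol using g(2) mle gn unfolding c(1) by (auto intro: order_trans)
  qed
  show thesis
    by (rule that[OF c(2) eq]) (use g nat_ball_native eq mle c in auto)
qed

text \<open>Compactness for pointwise convergence. Sequences suffice because there are only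
  countably many frequencies, so the product topology is metrisable.\<close>

lemma compact_solset: "compact (solset L E y \<nu> lam)"
proof -
  obtain c where c: "c \<ge> 0" "solset L E y \<nu> lam = {f \<in> native_sp L. cost f \<le> ennreal c}"
    by (rule solset_eq_sublevel)
  obtain R where R: "solset L E y \<nu> lam \<subseteq> nat_ball L R"
    using cost_sublevel_bounded[of c] c(2) by auto
  show ?thesis
    unfolding compact_eq_seq_compact_metric seq_compact_def
  proof (intro allI impI)
    fix f :: "nat \<Rightarrow> 'd tdist" assume f: "\<forall>n. f n \<in> solset L E y \<nu> lam"
    obtain g r where "g \<in> nat_ball L R" "strict_mono r" "(f \<circ> r) \<longlonglongrightarrow> g" "cost g \<le> ennreal c"
      using cost_limit[of f R "\<lambda>_. c" c] f R c by auto
    then show "\<exists>l\<in>solset L E y \<nu> lam. \<exists>r. strict_mono r \<and> (f \<circ> r) \<longlonglongrightarrow> l"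
      unfolding c(2) using nat_ball_native by auto
  qed
qed

text \<open>All pairings are continuous on \<open>nat_ball L R\<close>, so the identity from the
  pointwise topology on the solution set to \<open>weakstar L\<close> is continuous and carries
  compactness over.\<close>

lemma compactin_weakstar_solset: "compactin (weakstar L) (solset L E y \<nu> lam)"
proof -
  let ?V = "solset L E y \<nu> lam"
  obtain c where c: "c \<ge> 0" "?V = {f \<in> native_sp L. cost f \<le> ennreal c}"
    by (rule solset_eq_sublevel)
  obtain R where R: "?V \<subseteq> nat_ball L R"
    using cost_sublevel_bounded[of c] c(2) by auto
  have V: "?V \<subseteq> native_sp L" using c by auto
  have "continuous_map (top_of_set ?V) (weakstar L) id"
    unfolding weakstar_def
  proof (rule continuous_on_generated_topo)
    fix U assume U: "U \<in> insert (native_sp L) {{f \<in> native_sp L. nu_pair L g f \<in> U} | g U. g \<in> meas_sp L \<and> open U}"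
    show "openin (top_of_set ?V) (id -` U \<inter> topspace (top_of_set ?V))"
    proof (cases "U = native_sp L")
      case True
      then have "id -` U \<inter> topspace (top_of_set ?V) = ?V" using V by auto
      then show ?thesis by simp
    next
      case False
      then obtain g W where gW: "U = {f \<in> native_sp L. nu_pair L g f \<in> W}" "g \<in> meas_sp L" "open W"
        using U by auto
      have "continuous_on ?V (nu_pair L g)"
        by (rule continuous_on_nu_pair[where C = R]) (use R gW in \<open>auto simp: nat_ball_def\<close>)
      moreover have "id -` U \<inter> topspace (top_of_set ?V) = ?V \<inter> nu_pair L g -` W" using V gW by auto
      ultimately show ?thesis using gW(3) by (simp add: continuous_openin_preimage_gen)
    qed
  qed (use V in auto)
  moreover have "compactin (top_of_set ?V) ?V"
    using compact_solset by (simp add: compactin_subtopology)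
  ultimately have "compactin (weakstar L) (id ` ?V)" by (rule image_compactin[rotated])
  then show ?thesis by simp
qed

lemma convex_solset: "convex_dset (solset L E y \<nu> lam)"
proof -
  obtain c where c: "c \<ge> 0" "solset L E y \<nu> lam = {f \<in> native_sp L. cost f \<le> ennreal c}"
    by (rule solset_eq_sublevel)
  show ?thesis
    unfolding convex_dset_def c(2)
  proof (intro ballI allI impI)
    fix f g and t :: real
    assume f': "f \<in> {f \<in> native_sp L. cost f \<le> ennreal c}" and g': "g \<in> {f \<in> native_sp L. cost f \<le> ennreal c}"
      and t: "0 \<le> t \<and> t \<le> 1"
    have f: "f \<in> native_sp L" and g: "g \<in> native_sp L" using f' g' by auto
    let ?h = "\<lambda>k. complex_of_real t * f k + complex_of_real (1 - t) * g k"
    have h: "?h \<in> native_sp L" by (rule native_sp_linear[OF f g])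
    have mf: "is_measure (Lop L f)" and mg: "is_measure (Lop L g)" using f g by (auto simp: native_sp_def)
    have "mbound (Lop L ?h) (cmod (complex_of_real t) * mnorm (Lop L f) + cmod (complex_of_real (1 - t)) * mnorm (Lop L g))"
      unfolding Lop_linear by (intro mbound_linear mbound_mnorm mf mg)
    from mnorm_le[OF this] have "mnorm (Lop L ?h) \<le> t * mnorm (Lop L f) + (1 - t) * mnorm (Lop L g)"
      unfolding norm_of_real using t by simp
    then have "lam * mnorm (Lop L ?h) \<le> lam * (t * mnorm (Lop L f) + (1 - t) * mnorm (Lop L g))"
      using lam by simp
    also have "\<dots> = t * (lam * mnorm (Lop L f)) + (1 - t) * (lam * mnorm (Lop L g))" by (simp add: algebra_simps)
    finally have "ennreal (lam * mnorm (Lop L ?h)) \<le> ennreal (t * (lam * mnorm (Lop L f)) + (1 - t) * (lam * mnorm (Lop L g)))"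
      by (rule ennreal_leI)
    also have "\<dots> = ennreal t * ennreal (lam * mnorm (Lop L f)) + ennreal (1 - t) * ennreal (lam * mnorm (Lop L g))"
      using t lam mnorm_nonneg[OF mf] mnorm_nonneg[OF mg] by (simp add: ennreal_plus ennreal_mult)
    finally have 1: "ennreal (lam * mnorm (Lop L ?h)) \<le> ennreal t * ennreal (lam * mnorm (Lop L f)) + ennreal (1 - t) * ennreal (lam * mnorm (Lop L g))" .
    have 2: "E y (mv ?h) \<le> ennreal t * E y (mv f) + ennreal (1 - t) * E y (mv g)"
      unfolding mv_linear[OF f g] using t by (intro E_convex) auto
    have "cost ?h \<le> ennreal t * cost f + ennreal (1 - t) * cost g"
      unfolding cost_def using add_mono[OF 2 1] by (simp add: distrib_left add_ac)
    also have "\<dots> \<le> ennreal t * ennreal c + ennreal (1 - t) * ennreal c"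
      using f' g' by (intro add_mono mult_left_mono) auto
    also have "\<dots> = ennreal c"
      using t by (simp add: distrib_right[symmetric] ennreal_plus[symmetric] del: ennreal_plus)
    finally show "?h \<in> {f \<in> native_sp L. cost f \<le> ennreal c}" using h by simp
  qed
qed

end

subsection \<open>Measures carried by finitely many points\<close>

lemma tp_eval_torus_map:
  assumes "torus_map x = torus_map y"
  shows "tp_eval \<phi> x = tp_eval \<phi> y"
proof (rule periodic_cont_torus_map[OF _ assms])
  have "cis ((x + (2 * pi) *\<^sub>R axis i 1) \<bullet> rvec k) = cis (x \<bullet> rvec k)" for x i and k :: "int^'a"
  proof -
    have "(x + (2 * pi) *\<^sub>R axis i 1) \<bullet> rvec k = x \<bullet> rvec k + 2 * pi * of_int (k $ i)"
      by (simp add: inner_add_left inner_axis' rvec_def)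
    then show ?thesis by (simp add: cis_mult[symmetric] cis_multiple_2pi)
  qed
  then show "periodic_cont (tp_eval \<phi>)"
    unfolding periodic_cont_def by (intro conjI continuous_on_tp_eval) (simp add: tp_eval_def)
qed

lemma real_dist_trigpolyI:
  assumes "trigpoly \<phi>" "\<And>x. cnj (tp_eval \<phi> x) = tp_eval \<phi> x"
  shows "real_dist \<phi>"
proof -
  have "tp_eval (tconj \<phi>) = tp_eval \<phi>" using assms(2) by (auto simp: tp_eval_tconj)
  then have "tconj \<phi> = \<phi>" by (metis assms(1) fcoef_tp_eval trigpoly_tconj)
  then show ?thesis by (simp add: real_dist_iff_tconj)
qed

text \<open>A product of factors \<open>cis (x $ i) - cis (a $ i)\<close>, one for each point
  \<open>a\<close>, with \<open>i\<close> a coordinate in which \<open>a\<close> and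
  \<open>x0\<close> differ on the torus.\<close>

lemma trigpoly_vanishing:
  fixes x0 :: "real^'d::finite"
  assumes "finite X" "\<And>a. a \<in> X \<Longrightarrow> torus_map a \<noteq> torus_map x0"
  shows "\<exists>q. trigpoly q \<and> tp_eval q x0 \<noteq> 0 \<and> (\<forall>a\<in>X. tp_eval q a = 0)"
  using assms
proof (induction X)
  case empty
  show ?case
    using trigpoly_tchar[of "0::int^'d" 1] tp_eval_tchar[of "0::int^'d" 1 x0] by auto
next
  case (insert a X)
  then obtain q where q: "trigpoly q" "tp_eval q x0 \<noteq> 0" "\<forall>a\<in>X. tp_eval q a = 0" by auto
  obtain i where i: "cis (x0 $ i) \<noteq> cis (a $ i)" using insert.prems[of a] unfolding torus_map_eq_iff by (metis insertI1)
  let ?g = "\<lambda>k. tchar (axis i 1) 1 k - tchar 0 (cis (a $ i)) k"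
  have r: "rvec (axis i 1 :: int^'d) = axis i 1" by (simp add: rvec_def axis_def vec_eq_iff)
  have g: "trigpoly ?g" by (intro trigpoly_diff trigpoly_tchar)
  have eg: "tp_eval ?g x = cis (x $ i) - cis (a $ i)" for x
    by (simp add: tp_eval_diff trigpoly_tchar tp_eval_tchar r inner_axis)
  show ?case
    by (rule exI[of _ "tmult ?g q"]) (use q g eg i in \<open>auto simp: tp_eval_tmult trigpoly_tmult\<close>)
qed

text \<open>The squared modulus of the product from \<open>trigpoly_vanishing\<close>, normalised at
  \<open>x0\<close>; the square makes the values real.\<close>

lemma trigpoly_lagrange:
  fixes x0 :: "real^'d::finite"
  assumes "finite X" "\<And>a. a \<in> X \<Longrightarrow> torus_map a \<noteq> torus_map x0"
  shows "\<exists>w. trigpoly w \<and> real_dist w \<and> tp_eval w x0 = 1 \<and> (\<forall>a\<in>X. tp_eval w a = 0)"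
proof -
  obtain q where q: "trigpoly q" "tp_eval q x0 \<noteq> 0" "\<forall>a\<in>X. tp_eval q a = 0"
    using trigpoly_vanishing[OF assms] by blast
  let ?c = "complex_of_real (1 / (cmod (tp_eval q x0))\<^sup>2)"
  let ?w = "\<lambda>k. ?c * tmult (tconj q) q k"
  have t: "trigpoly (tmult (tconj q) q)" by (intro trigpoly_tmult trigpoly_tconj q)
  have e: "tp_eval ?w x = complex_of_real ((cmod (tp_eval q x))\<^sup>2 / (cmod (tp_eval q x0))\<^sup>2)" for x
    unfolding tp_eval_cmul[OF t] tp_eval_tmult[OF trigpoly_tconj[OF q(1)] q(1)] tp_eval_tconj
    by (simp add: complex_norm_square mult.commute del: of_real_power)
  have w: "trigpoly ?w" by (intro trigpoly_cmul t)
  show ?thesis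
  proof (intro exI conjI ballI)
    show "trigpoly ?w" by (rule w)
    show "real_dist ?w" by (rule real_dist_trigpolyI[OF w]) (simp only: e complex_cnj_complex_of_real)
    show "tp_eval ?w x0 = 1" unfolding e using q(2) by simp
    show "tp_eval ?w a = 0" if "a \<in> X" for a unfolding e using q(3) that by simp
  qed
qed

text \<open>For a measure this is the Zariski closure of the support with respect to trigonometric
  polynomials, possibly larger than the support itself. It contains every representative of each of
  its torus points, so its size is measured through \<open>torus_map\<close>.\<close>

definition zero_set :: "('d::finite) tdist \<Rightarrow> (real^'d) set" where
  "zero_set u = {x. \<forall>w. trigpoly w \<longrightarrow> tmult w u = (\<lambda>_. 0) \<longrightarrow> tp_eval w x = 0}"

text \<open>Where \<open>\<phi>\<close> is not small, finitely many annihilators of \<open>u\<close>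
  have no common zero, and the sum \<open>G\<close> of their squared moduli is positive there. So
  \<open>\<phi>\<close> is uniformly close to a product of \<open>G\<close> with a polynomial, and
  such products pair to zero with \<open>u\<close>.\<close>

lemma dpair_eq_0_of_vanishing:
  assumes u: "mbound u C" and \<phi>: "trigpoly \<phi>" "\<And>x. x \<in> zero_set u \<Longrightarrow> tp_eval \<phi> x = 0"
  shows "dpair u \<phi> = 0"
proof -
  have C: "C \<ge> 0" by (rule mbound_nonneg[OF u])
  have "cmod (dpair u \<phi>) \<le> C * (2 * e)" if e: "e > 0" for e
  proof -
    let ?Q = "cbox 0 (\<chi> i. 2 * pi) :: (real^'a) set"
    define K where "K = ?Q \<inter> {x. e \<le> cmod (tp_eval \<phi> x)}"
    have "compact K"
      unfolding K_def
      by (intro compact_Int_closed compact_cbox closed_Collect_le continuous_on_const continuous_on_norm continuous_on_tp_eval)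
    have "\<forall>x\<in>K. \<exists>w. trigpoly w \<and> tmult w u = (\<lambda>_. 0) \<and> tp_eval w x \<noteq> 0"
    proof
      fix x assume "x \<in> K"
      then have "tp_eval \<phi> x \<noteq> 0" using e by (auto simp: K_def)
      then have "x \<notin> zero_set u" using \<phi>(2) by blast
      then show "\<exists>w. trigpoly w \<and> tmult w u = (\<lambda>_. 0) \<and> tp_eval w x \<noteq> 0" by (auto simp: zero_set_def)
    qed
    then obtain g where g: "\<And>x. x \<in> K \<Longrightarrow> trigpoly (g x)" "\<And>x. x \<in> K \<Longrightarrow> tmult (g x) u = (\<lambda>_. 0)"
      "\<And>x. x \<in> K \<Longrightarrow> tp_eval (g x) x \<noteq> 0" by metis
    have "open {y. tp_eval (g x) y \<noteq> 0}" for x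
      by (intro open_Collect_neq continuous_on_tp_eval continuous_on_const)
    moreover have "K \<subseteq> (\<Union>x\<in>K. {y. tp_eval (g x) y \<noteq> 0})" using g(3) by fastforce
    ultimately obtain D where D: "D \<subseteq> K" "finite D" "K \<subseteq> (\<Union>x\<in>D. {y. tp_eval (g x) y \<noteq> 0})"
      by (rule compactE_image[OF \<open>compact K\<close>, of K "\<lambda>x. {y. tp_eval (g x) y \<noteq> 0}"])
    \<comment> \<open>Squared moduli prevent cancellation between the annihilators, and each remains
      a polynomial multiple of some \<open>g x\<close>.\<close>
    define G where "G y = (\<Sum>x\<in>D. (cmod (tp_eval (g x) y))\<^sup>2)" for y
    have G0: "G y \<ge> 0" for y by (simp add: G_def sum_nonneg)
    have Gc: "continuous_on S G" for S
      unfolding G_def by (intro continuous_intros continuous_on_tp_eval)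
    have Gper: "G y = G y'" if "torus_map y = torus_map y'" for y y'
      using tp_eval_torus_map[OF that] by (simp add: G_def)
    have Gpos: "G y > 0" if y: "y \<in> K" for y
    proof -
      obtain x where x: "x \<in> D" "tp_eval (g x) y \<noteq> 0" using D(3) y by blast
      then have "(cmod (tp_eval (g x) y))\<^sup>2 \<le> G y"
        unfolding G_def by (intro member_le_sum D(2)) auto
      then show ?thesis using x(2) by (smt (verit) zero_less_norm_iff zero_less_power)
    qed
    obtain \<eta> where \<eta>: "\<eta> > 0" "\<And>y. y \<in> K \<Longrightarrow> \<eta> \<le> G y"
    proof (cases "K = {}")
      case True
      then show thesis using that[of 1] by auto
    next
      case False
      then obtain q where "q \<in> K" "\<And>y. y \<in> K \<Longrightarrow> G q \<le> G y"
        using continuous_attains_inf[OF \<open>compact K\<close> False Gc] by blast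
      then show thesis using that[of "G q"] Gpos by auto
    qed
    \<comment> \<open>On \<open>K\<close> this is the quotient of \<open>\<phi>\<close> by
      \<open>G\<close>; the floor \<open>\<eta>\<close> keeps it continuous at zeros of
      \<open>G\<close>.\<close>
    define F where "F y = tp_eval \<phi> y / complex_of_real (max (G y) \<eta>)" for y
    have m: "max (G y) \<eta> > 0" for y using \<eta>(1) by simp
    have Fc: "continuous_on UNIV F"
      unfolding F_def
    proof (intro continuous_on_divide continuous_on_tp_eval continuous_on_of_real continuous_on_max Gc continuous_on_const ballI)
      show "complex_of_real (max (G y) \<eta>) \<noteq> 0" for y using m[of y] unfolding of_real_eq_0_iff by linarith
    qed
    have Fper: "F y = F y'" if "torus_map y = torus_map y'" for y y'
      using tp_eval_torus_map[OF that] Gper[OF that] by (simp add: F_def)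
    \<comment> \<open>\<open>B\<close> bounds \<open>G\<close>, so approximating \<open>F\<close>
      within \<open>e / (B + 1)\<close> costs at most \<open>e\<close> after multiplication by
      \<open>G\<close>.\<close>
    define B where "B = (\<Sum>x\<in>D. (supnorm (g x))\<^sup>2)"
    have B0: "B \<ge> 0" by (simp add: B_def sum_nonneg)
    have GB: "G y \<le> B" for y
      unfolding G_def B_def by (intro sum_mono power_mono tp_eval_le_supnorm) auto
    obtain \<psi> where \<psi>: "trigpoly \<psi>" "\<And>y. cmod (tp_eval \<psi> y - F y) < e / (B + 1)"
      using trigpoly_dense[OF Fc Fper, of "e / (B + 1)"] e B0 by auto
    \<comment> \<open>\<open>P\<close> has the values of \<open>G\<close> times those of
      \<open>\<psi>\<close>. With \<open>g x\<close> outermost, \<open>dpair_tmult\<close> moves it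
      onto \<open>u\<close>, where the product is zero.\<close>
    define P where "P k = (\<Sum>x\<in>D. tmult (g x) (tmult (tconj (g x)) \<psi>) k)" for k
    have gD: "trigpoly (g x)" if "x \<in> D" for x using g(1) D(1) that by blast
    have tP: "trigpoly (tmult (g x) (tmult (tconj (g x)) \<psi>))" if "x \<in> D" for x
      by (intro trigpoly_tmult trigpoly_tconj gD that \<psi>)
    have P: "trigpoly P" unfolding P_def by (intro trigpoly_sum tP)
    have "dpair u (tmult (g x) (tmult (tconj (g x)) \<psi>)) = 0" if "x \<in> D" for x
    proof -
      have "dpair u (tmult (g x) (tmult (tconj (g x)) \<psi>)) = dpair (tmult (g x) u) (tmult (tconj (g x)) \<psi>)"
        by (rule dpair_tmult[symmetric]) (intro trigpoly_tmult trigpoly_tconj gD that \<psi>)+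
      also have "\<dots> = 0" using g(2)[of x] D(1) that by (auto simp: dpair_def)
      finally show ?thesis .
    qed
    then have dP: "dpair u P = 0" unfolding P_def by (subst dpair_sum) (auto simp: tP)
    have eP: "tp_eval P y = complex_of_real (G y) * tp_eval \<psi> y" for y
    proof -
      have "tp_eval P y = (\<Sum>x\<in>D. tp_eval (g x) y * (cnj (tp_eval (g x) y) * tp_eval \<psi> y))"
        unfolding P_def using gD \<psi>(1)
        by (subst tp_eval_sum) (auto simp: tP tp_eval_tmult trigpoly_tmult trigpoly_tconj tp_eval_tconj)
      also have "\<dots> = (\<Sum>x\<in>D. complex_of_real ((cmod (tp_eval (g x) y))\<^sup>2)) * tp_eval \<psi> y"
        unfolding sum_distrib_right by (intro sum.cong refl) (simp add: complex_norm_square mult.assoc del: of_real_power)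
      finally show ?thesis by (simp add: G_def)
    qed
    \<comment> \<open>The difference is zero on \<open>K\<close>. Elsewhere it is
      \<open>\<phi>\<close> times a factor in the unit interval, and \<open>\<phi>\<close> is at
      most \<open>e\<close> in modulus.\<close>
    have close: "cmod (tp_eval \<phi> y - complex_of_real (G y) * F y) \<le> e" if y: "y \<in> ?Q" for y
    proof (cases "y \<in> K")
      case True
      then have "max (G y) \<eta> = G y" using \<eta>(2)[OF True] by simp
      then show ?thesis using m[of y] e by (simp add: F_def)
    next
      case False
      then have le: "cmod (tp_eval \<phi> y) \<le> e" using y by (auto simp: K_def)
      have "tp_eval \<phi> y - complex_of_real (G y) * F y = complex_of_real (1 - G y / max (G y) \<eta>) * tp_eval \<phi> y"
        using m[of y] by (simp add: F_def field_simps)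
      then have "cmod (tp_eval \<phi> y - complex_of_real (G y) * F y) = \<bar>1 - G y / max (G y) \<eta>\<bar> * cmod (tp_eval \<phi> y)"
        by (simp only: norm_mult norm_of_real)
      also have "\<bar>1 - G y / max (G y) \<eta>\<bar> \<le> 1"
      proof -
        have "0 \<le> G y / max (G y) \<eta>" "G y / max (G y) \<eta> \<le> 1"
          using G0[of y] m[of y] by (auto simp: divide_le_eq_1)
        then show ?thesis by linarith
      qed
      then have "\<bar>1 - G y / max (G y) \<eta>\<bar> * cmod (tp_eval \<phi> y) \<le> 1 * cmod (tp_eval \<phi> y)"
        by (intro mult_right_mono) auto
      finally show ?thesis using le by simp
    qed
    have "cmod (tp_eval (\<lambda>k. \<phi> k - P k) y) \<le> 2 * e" for y
    proof -
      \<comment> \<open>The estimate \<open>close\<close> holds on the cube only; periodicity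
        extends it.\<close>
      obtain y' where y': "y' \<in> ?Q" "torus_map y' = torus_map y" using ex_cube_torus_map by blast
      have "tp_eval (\<lambda>k. \<phi> k - P k) y = tp_eval (\<lambda>k. \<phi> k - P k) y'" using tp_eval_torus_map[OF y'(2)] by simp
      also have "\<dots> = (tp_eval \<phi> y' - G y' * F y') - G y' * (tp_eval \<psi> y' - F y')"
        by (simp add: tp_eval_diff \<phi>(1) P eP algebra_simps)
      also have "cmod \<dots> \<le> cmod (tp_eval \<phi> y' - G y' * F y') + cmod (G y' * (tp_eval \<psi> y' - F y'))"
        by (rule norm_triangle_ineq4)
      also have "cmod (G y' * (tp_eval \<psi> y' - F y')) \<le> B * (e / (B + 1))"
        using GB[of y'] G0[of y'] less_imp_le[OF \<psi>(2)[of y']] B0 by (simp add: norm_mult mult_mono del: times_divide_eq_right)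
      also have "B * (e / (B + 1)) \<le> e" using B0 e by (simp add: field_simps)
      finally show ?thesis using close[OF y'(1)] by simp
    qed
    then have "cmod (dpair u (\<lambda>k. \<phi> k - P k)) \<le> C * (2 * e)"
      by (rule mbound_dpair_le[OF u trigpoly_diff[OF \<phi>(1) P]])
    then show ?thesis by (simp add: dpair_diff[OF \<phi>(1) P] dP)
  qed
  note bound = this
  have "cmod (dpair u \<phi>) \<le> 0 + e" if "e > 0" for e
  proof -
    have "cmod (dpair u \<phi>) \<le> C * (2 * (e / (2 * (C + 1))))"
      using that C by (intro bound) simp
    also have "\<dots> \<le> e" using that C by (simp add: field_simps)
    finally show ?thesis by simp
  qed
  then have "cmod (dpair u \<phi>) \<le> 0" by (rule field_le_epsilon)
  then show ?thesis by simp
qed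

text \<open>The dual of Lagrange interpolation: a polynomial minus its interpolant at the points of
  the zero set pairs to zero with \<open>u\<close>. The weights are the pairings of \<open>u\<close>
  with the interpolation basis, real because both are real.\<close>

lemma dirac_combination_of_finite_zero_set:
  fixes u :: "('d::finite) tdist"
  assumes u: "mbound u C" "real_dist u" and fin: "finite (torus_map ` zero_set u)"
  obtains a :: "nat \<Rightarrow> real" and x :: "nat \<Rightarrow> real^'d"
  where "\<forall>k. u k = (\<Sum>j<card (torus_map ` zero_set u). complex_of_real (a j) * cis (- (rvec k \<bullet> x j)))"
proof -
  let ?T = "torus_map ` zero_set u"
  let ?K = "card ?T"
  obtain z where z: "bij_betw z {..<?K} ?T" using ex_bij_betw_nat_finite[OF fin] by (auto simp: atLeast0LessThan)
  have "\<exists>x\<in>zero_set u. torus_map x = z j" if "j < ?K" for j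
  proof -
    have "z j \<in> ?T" using bij_betwE[OF z] that by blast
    then show ?thesis by auto
  qed
  then obtain x where x: "\<And>j. j < ?K \<Longrightarrow> x j \<in> zero_set u" "\<And>j. j < ?K \<Longrightarrow> torus_map (x j) = z j" by metis
  have inj: "i = j" if "i < ?K" "j < ?K" "z i = z j" for i j
    using z that by (auto simp: bij_betw_def inj_on_def)
  have "\<forall>j<?K. \<exists>w. trigpoly w \<and> real_dist w \<and> tp_eval w (x j) = 1 \<and> (\<forall>a\<in>x ` ({..<?K} - {j}). tp_eval w a = 0)"
  proof (intro allI impI trigpoly_lagrange)
    fix j a assume "j < ?K" "a \<in> x ` ({..<?K} - {j})"
    then show "torus_map a \<noteq> torus_map (x j)" using inj x(2) by auto
  qed simp
  then obtain w where w: "\<And>j. j < ?K \<Longrightarrow> trigpoly (w j)" "\<And>j. j < ?K \<Longrightarrow> real_dist (w j)"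
    "\<And>j. j < ?K \<Longrightarrow> tp_eval (w j) (x j) = 1"
    "\<And>j a. j < ?K \<Longrightarrow> a \<in> x ` ({..<?K} - {j}) \<Longrightarrow> tp_eval (w j) a = 0" by metis
  have main: "dpair u \<phi> = (\<Sum>j<?K. tp_eval \<phi> (x j) * dpair u (w j))" if \<phi>: "trigpoly \<phi>" for \<phi>
  proof -
    define s where "s k = (\<Sum>j<?K. tp_eval \<phi> (x j) * w j k)" for k
    have s: "trigpoly s" unfolding s_def by (intro trigpoly_sum trigpoly_cmul w) simp
    have es: "tp_eval s y = (\<Sum>j<?K. tp_eval \<phi> (x j) * tp_eval (w j) y)" for y
      unfolding s_def by (subst tp_eval_sum) (auto intro: trigpoly_cmul w simp: tp_eval_cmul[OF w(1)])
    have ds: "dpair u s = (\<Sum>j<?K. tp_eval \<phi> (x j) * dpair u (w j))"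
      unfolding s_def by (subst dpair_sum) (auto intro: trigpoly_cmul w simp: dpair_cmul[OF w(1)])
    have "dpair u (\<lambda>k. \<phi> k - s k) = 0"
    proof (rule dpair_eq_0_of_vanishing[OF u(1) trigpoly_diff[OF \<phi> s]])
      fix y assume "y \<in> zero_set u"
      then obtain i where i: "i < ?K" "torus_map y = z i" using z by (auto simp: bij_betw_def)
      then have "torus_map y = torus_map (x i)" using x(2) by simp
      then have "tp_eval (\<lambda>k. \<phi> k - s k) y = tp_eval (\<lambda>k. \<phi> k - s k) (x i)" by (rule tp_eval_torus_map)
      also have "\<dots> = tp_eval \<phi> (x i) - (\<Sum>j<?K. tp_eval \<phi> (x j) * tp_eval (w j) (x i))"
        by (simp add: tp_eval_diff[OF \<phi> s] es)
      also have "(\<Sum>j<?K. tp_eval \<phi> (x j) * tp_eval (w j) (x i)) = (\<Sum>j<?K. if j = i then tp_eval \<phi> (x i) else 0)"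
        using i(1) w(3,4) by (intro sum.cong refl) auto
      finally show "tp_eval (\<lambda>k. \<phi> k - s k) y = 0" using i(1) by simp
    qed
    then show ?thesis by (simp add: dpair_diff[OF \<phi> s] ds)
  qed
  show thesis
  proof (rule that, rule allI)
    fix k
    have "u k = dpair u (tchar (- k) 1)" by (simp add: dpair_tchar)
    also have "\<dots> = (\<Sum>j<?K. cis (- (rvec k \<bullet> x j)) * dpair u (w j))"
      unfolding main[OF trigpoly_tchar] by (simp add: tp_eval_tchar rvec_minus inner_commute)
    also have "\<dots> = (\<Sum>j<?K. complex_of_real (Re (dpair u (w j))) * cis (- (rvec k \<bullet> x j)))"
      using dpair_real[OF w(2) u(2)] by (intro sum.cong refl) (simp add: mult.commute)
    finally show "u k = (\<Sum>j<?K. complex_of_real (Re (dpair u (w j))) * cis (- (rvec k \<bullet> x j)))" .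
  qed
qed

section \<open>Total mass under multiplication by a trigonometric polynomial\<close>

lemma mbound_tmult:
  assumes u: "mbound u C" and w: "trigpoly w"
  shows "mbound (tmult w u) (C * supnorm w)"
  unfolding mbound_def
proof (intro allI impI)
  fix \<phi> :: "'a tdist" assume \<phi>: "trigpoly \<phi>"
  have "cmod (dpair u (tmult w \<phi>)) \<le> C * (supnorm w * supnorm \<phi>)"
    by (rule mbound_dpair_le[OF u trigpoly_tmult[OF w \<phi>]])
      (simp add: tp_eval_tmult w \<phi> norm_mult mult_mono tp_eval_le_supnorm supnorm_nonneg)
  then show "cmod (dpair (tmult w u) \<phi>) \<le> C * supnorm w * supnorm \<phi>"
    by (simp add: dpair_tmult w \<phi> mult.assoc)
qed

text \<open>Multiplying \<open>u\<close> by \<open>1 + w\<close> and \<open>1 - w\<close>, both nonnegative, splits \<open>2 * u\<close> without loss of mass.\<close>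
lemma mnorm_add_diff_tmult_le:
  assumes u: "is_measure u" and w: "trigpoly w" "real_dist w" "supnorm w \<le> 1"
  shows "mnorm (\<lambda>k. u k + tmult w u k) + mnorm (\<lambda>k. u k - tmult w u k) \<le> 2 * mnorm u"
proof -
  let ?a = "\<lambda>k. u k + tmult w u k" and ?b = "\<lambda>k. u k - tmult w u k"
  have da: "dpair ?a \<phi> = dpair u (\<lambda>k. \<phi> k + tmult w \<phi> k)" if "trigpoly \<phi>" for \<phi>
    using dpair_left_linear[of 1 u 1 "tmult w u" \<phi>] dpair_tmult[OF w(1) that, of u] dpair_add[OF that trigpoly_tmult[OF w(1) that], of u]
    by simp
  have db: "dpair ?b \<phi> = dpair u (\<lambda>k. \<phi> k - tmult w \<phi> k)" if "trigpoly \<phi>" for \<phi>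
    using dpair_left_linear[of 1 u "-1" "tmult w u" \<phi>] dpair_tmult[OF w(1) that, of u] dpair_diff[OF that trigpoly_tmult[OF w(1) that], of u]
    by simp
  \<comment> \<open>A phase factor makes the pairing nonnegative, so that two moduli can be added
    inside one pairing. If the pairing is 0, so is \<open>sgn\<close>, and the rotated polynomial is
    zero.\<close>
  have rot: "\<exists>\<phi>'. trigpoly \<phi>' \<and> supnorm \<phi>' \<le> 1 \<and> dpair v \<phi>' = complex_of_real (cmod (dpair v \<phi>))"
    if \<phi>: "trigpoly \<phi>" "supnorm \<phi> \<le> 1" for v :: "'a tdist" and \<phi>
  proof (intro exI conjI)
    let ?c = "cnj (sgn (dpair v \<phi>))"
    have c: "cmod ?c \<le> 1" by (simp add: norm_sgn)
    show "trigpoly (\<lambda>k. ?c * \<phi> k)" by (rule trigpoly_cmul[OF \<phi>(1)])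
    show "supnorm (\<lambda>k. ?c * \<phi> k) \<le> 1"
      using supnorm_scale[OF \<phi>(1), of ?c] mult_mono[OF c \<phi>(2)] supnorm_nonneg[of \<phi>] by simp
    have "cnj (sgn z) * z = complex_of_real (cmod z)" for z
      by (simp add: sgn_div_norm scaleR_conv_of_real field_simps complex_norm_square[symmetric] power2_eq_square)
    then show "dpair v (\<lambda>k. ?c * \<phi> k) = complex_of_real (cmod (dpair v \<phi>))" by (simp add: dpair_cmul[OF \<phi>(1)])
  qed
  \<comment> \<open>After rotation both pairings are pairings of \<open>u\<close> with
    \<open>(1 + w) \<phi>'\<close> and \<open>(1 - w) \<psi>'\<close>, and the sum of these test
    functions is at most 2 in modulus at every point.\<close>
  have key: "cmod (dpair ?a \<phi>) + cmod (dpair ?b \<psi>) \<le> 2 * mnorm u"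
    if \<phi>0: "trigpoly \<phi>" "supnorm \<phi> \<le> 1" and \<psi>0: "trigpoly \<psi>" "supnorm \<psi> \<le> 1" for \<phi> \<psi>
  proof -
    obtain \<phi>' where \<phi>': "trigpoly \<phi>'" "supnorm \<phi>' \<le> 1" "dpair ?a \<phi>' = complex_of_real (cmod (dpair ?a \<phi>))"
      using rot[OF \<phi>0] by blast
    obtain \<psi>' where \<psi>': "trigpoly \<psi>'" "supnorm \<psi>' \<le> 1" "dpair ?b \<psi>' = complex_of_real (cmod (dpair ?b \<psi>))"
      using rot[OF \<psi>0] by blast
    let ?p = "\<lambda>k. \<phi>' k + tmult w \<phi>' k" and ?q = "\<lambda>k. \<psi>' k - tmult w \<psi>' k"
    have p: "trigpoly ?p" by (intro trigpoly_add trigpoly_tmult w \<phi>')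
    have q: "trigpoly ?q" by (intro trigpoly_diff trigpoly_tmult w \<psi>')
    have "cmod (tp_eval (\<lambda>k. ?p k + ?q k) x) \<le> 2" for x
    proof -
      define r where "r = Re (tp_eval w x)"
      have ew: "tp_eval w x = complex_of_real r" unfolding r_def by (rule tp_eval_real[OF w(2)])
      have r: "\<bar>r\<bar> \<le> 1" using tp_eval_le_supnorm[of w x] w(3) by (simp add: ew)
      have "tp_eval (\<lambda>k. ?p k + ?q k) x = complex_of_real (1 + r) * tp_eval \<phi>' x + complex_of_real (1 - r) * tp_eval \<psi>' x"
        unfolding tp_eval_add[OF p q]
        by (simp add: tp_eval_add tp_eval_diff trigpoly_tmult w \<phi>' \<psi>' tp_eval_tmult ew algebra_simps)
      also have "cmod \<dots> \<le> cmod (complex_of_real (1 + r) * tp_eval \<phi>' x) + cmod (complex_of_real (1 - r) * tp_eval \<psi>' x)"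
        by (rule norm_triangle_ineq)
      also have "\<dots> = (1 + r) * cmod (tp_eval \<phi>' x) + (1 - r) * cmod (tp_eval \<psi>' x)"
        unfolding norm_mult norm_of_real using r by simp
      also have "\<dots> \<le> (1 + r) * 1 + (1 - r) * 1"
        using r tp_eval_le_supnorm[of \<phi>' x] tp_eval_le_supnorm[of \<psi>' x] \<phi>'(2) \<psi>'(2)
        by (intro add_mono mult_left_mono) auto
      finally show ?thesis by simp
    qed
    then have "cmod (dpair u (\<lambda>k. ?p k + ?q k)) \<le> mnorm u * 2"
      by (rule mbound_dpair_le[OF mbound_mnorm[OF u] trigpoly_add[OF p q]])
    moreover have "dpair u (\<lambda>k. ?p k + ?q k) = complex_of_real (cmod (dpair ?a \<phi>) + cmod (dpair ?b \<psi>))"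
      using da[OF \<phi>'(1)] db[OF \<psi>'(1)] \<phi>'(3) \<psi>'(3) by (simp add: dpair_add[OF p q])
    ultimately have "\<bar>cmod (dpair ?a \<phi>) + cmod (dpair ?b \<psi>)\<bar> \<le> mnorm u * 2" by (simp only: norm_of_real)
    then show ?thesis by simp
  qed
  \<comment> \<open>The two test functions in \<open>key\<close> are independent, so the suprema can
    be taken one after the other.\<close>
  have "mnorm ?a \<le> 2 * mnorm u - cmod (dpair ?b \<psi>)" if "trigpoly \<psi>" "supnorm \<psi> \<le> 1" for \<psi>
    by (rule mnorm_least) (use key[OF _ _ that] in force)
  then have "mnorm ?b \<le> 2 * mnorm u - mnorm ?a"
    by (intro mnorm_least) force
  then show ?thesis by simp
qed

text \<open>Stated for families: when \<open>g\<close> repeats a value, its image has too few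
  elements for the dimension count, but the two equal members give the relation directly.\<close>

lemma linear_dependence:
  fixes g :: "nat \<Rightarrow> 'a::euclidean_space"
  shows "\<exists>c. (\<exists>i\<le>DIM('a). c i \<noteq> 0) \<and> (\<Sum>i\<le>DIM('a). c i *\<^sub>R g i) = 0"
proof (cases "inj_on g {..DIM('a)}")
  case True
  let ?S = "g ` {..DIM('a)}"
  have "card ?S = Suc (DIM('a))" using card_image[OF True] by simp
  then have "dependent ?S" by (intro dependent_biggerset) simp
  then obtain u where u: "\<exists>v\<in>?S. u v \<noteq> 0" "(\<Sum>v\<in>?S. u v *\<^sub>R v) = 0"
    using dependent_finite[of ?S] by auto
  have "(\<Sum>i\<le>DIM('a). u (g i) *\<^sub>R g i) = 0" using u(2) by (simp add: sum.reindex[OF True])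
  then show ?thesis using u(1) by (intro exI[of _ "\<lambda>i. u (g i)"]) auto
next
  case False
  then obtain i j where ij: "i \<le> DIM('a)" "j \<le> DIM('a)" "i \<noteq> j" "g i = g j" by (auto simp: inj_on_def)
  let ?c = "\<lambda>k. (if k = i then 1 else 0) - (if k = j then 1 else 0) :: real"
  have "(\<Sum>k\<le>DIM('a). ?c k *\<^sub>R g k) = g i - g j"
    using ij by (simp add: scaleR_diff_left sum_subtractf if_distrib[of "\<lambda>t. t *\<^sub>R _"] cong: if_cong)
  then show ?thesis using ij by (intro exI[of _ ?c]) auto
qed

text \<open>\<open>Q\<close> is the orthogonal projection onto the complement of \<open>W\<close>,
  obtained by subtracting the expansion along an orthogonal spanning set of
  \<open>W\<close>.\<close>

lemma subspace_complement_projection: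
  fixes W :: "'a::euclidean_space set"
  assumes "subspace W"
  shows "\<exists>Q. linear Q \<and> (\<forall>x. \<forall>w\<in>W. Q x \<bullet> w = 0) \<and> (\<forall>x. Q x = 0 \<longrightarrow> x \<in> W)"
proof -
  obtain B where B: "B \<subseteq> span W" "W \<subseteq> span B" "pairwise orthogonal B"
    using orthogonal_basis_exists[of W] by blast
  have sB: "span B = W" using B assms by (metis span_eq span_eq_iff)
  let ?Q = "\<lambda>a. a - (\<Sum>b\<in>B. (b \<bullet> a / (b \<bullet> b)) *\<^sub>R b)"
  have "linear ?Q"
    by (rule linearI)
      (simp_all add: inner_add_right add_divide_distrib scaleR_add_left sum.distrib scaleR_diff_right scaleR_sum_right)
  moreover have "?Q x \<bullet> w = 0" if "w \<in> W" for x w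
    using Gram_Schmidt_step[OF B(3), of w x] that sB by (simp add: orthogonal_def inner_commute)
  moreover have "x \<in> W" if "?Q x = 0" for x
  proof -
    have "x = (\<Sum>b\<in>B. (b \<bullet> x / (b \<bullet> b)) *\<^sub>R b)" using that by simp
    moreover have "(\<Sum>b\<in>B. (b \<bullet> x / (b \<bullet> b)) *\<^sub>R b) \<in> span B" by (intro span_sum span_scale span_base)
    ultimately show ?thesis using sB by metis
  qed
  ultimately show ?thesis by blast
qed

subsection \<open>Extreme points\<close>

context spline_problem
begin

lemma subspace_mv_null: "subspace (mv ` null_sp L)"
proof (rule subspaceI)
  have z: "(\<lambda>_. 0) \<in> null_sp L" by (rule null_spI) (auto simp: real_dist_def)
  have "mv (\<lambda>_. 0) = 0" using mv_linear[OF zero_native zero_native, of 0 0] by simp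
  then show "0 \<in> mv ` null_sp L" using z by (metis image_eqI)
next
  fix a b assume "a \<in> mv ` null_sp L" "b \<in> mv ` null_sp L"
  then obtain p q where p: "p \<in> null_sp L" "a = mv p" and q: "q \<in> null_sp L" "b = mv q" by auto
  have eq: "a + b = mv (\<lambda>k. complex_of_real 1 * p k + complex_of_real 1 * q k)"
    by (subst mv_linear) (use p q null_sp_native in auto)
  show "a + b \<in> mv ` null_sp L" unfolding eq by (rule imageI[OF null_sp_linear[OF p(1) q(1)]])
next
  fix t a assume "a \<in> mv ` null_sp L"
  then obtain p where p: "p \<in> null_sp L" "a = mv p" by auto
  have eq: "t *\<^sub>R a = mv (\<lambda>k. complex_of_real t * p k + complex_of_real 0 * p k)"
    by (subst mv_linear) (use p null_sp_native in auto)
  show "t *\<^sub>R a \<in> mv ` null_sp L" unfolding eq by (rule imageI[OF null_sp_linear[OF p(1) p(1)]])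
qed

lemma null_part_sum:
  assumes "finite I" "\<And>i. i \<in> I \<Longrightarrow> real_dist (v i)"
  shows "(\<lambda>k. \<Sum>i\<in>I. complex_of_real (c i) * (if L k = 0 then v i k else 0)) \<in> null_sp L"
proof -
  have "real_dist (\<lambda>k. \<Sum>i\<in>I. complex_of_real (c i) * v i k)"
    using assms by (simp add: real_dist_def)
  from null_part[OF this] show ?thesis
    by (rule back_subst[where P = "\<lambda>f. f \<in> null_sp L"]) auto
qed

text \<open>Applying \<open>L\<close> after its pseudoinverse only deletes the null frequencies of
  \<open>v\<close>. There are finitely many of them, so what is deleted is a trigonometric
  polynomial and the rest is still a measure.\<close>

lemma pinv_native:
  assumes v: "is_measure v" "real_dist v"
  shows "(\<lambda>k. pinv L k * v k) \<in> native_sp L"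
proof -
  let ?n = "\<lambda>k. if L k = 0 then v k else 0"
  have "trigpoly ?n"
    unfolding trigpoly_def by (rule finite_subset[OF _ finite_nullset]) (auto simp: nullset_def)
  then obtain D where "mbound ?n D" using mbound_trigpoly by blast
  from mbound_linear[OF mbound_mnorm[OF v(1)] this, of 1 "-1"]
  have "is_measure (\<lambda>k. 1 * v k + (-1) * ?n k)" using is_measure_iff_mbound by blast
  moreover have "Lop L (\<lambda>k. pinv L k * v k) = (\<lambda>k. 1 * v k + (-1) * ?n k)"
    by (auto simp: Lop_def pinv_def)
  moreover have "slowly_growing (\<lambda>k. pinv L k * v k)"
    by (rule slowly_growing_mult[OF slowly_growing_pinv]) (use v in \<open>simp add: is_measure_def\<close>)
  moreover have "real_dist (\<lambda>k. pinv L k * v k)" using v(2) by (simp add: real_dist_def pinv_minus)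
  ultimately show ?thesis by (simp add: native_sp_def)
qed

text \<open>The constraints on \<open>c\<close> are \<open>v = 0\<close> on the null frequencies and \<open>mv (pinv L v) \<in> mv (null_sp L)\<close>.
Since \<open>mv\<close> embeds the null space into the measurement space, both are encoded in a single vector of
dimension \<open>CARD('m)\<close>, so \<open>CARD('m) + 1\<close> unknowns admit a nontrivial solution.\<close>
lemma ex_invisible_perturbation:
  assumes v: "\<And>i. i \<le> CARD('m) \<Longrightarrow> is_measure (v i)" "\<And>i. i \<le> CARD('m) \<Longrightarrow> real_dist (v i)"
  obtains c :: "nat \<Rightarrow> real" and h where "\<exists>i\<le>CARD('m). c i \<noteq> 0" "h \<in> native_sp L" "mv h = 0"
    "Lop L h = (\<lambda>k. \<Sum>i\<le>CARD('m). complex_of_real (c i) * v i k)"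
proof -
  let ?I = "{..CARD('m)}"
  define g where "g i = (\<lambda>k. pinv L k * v i k)" for i
  define n where "n i = (\<lambda>k. if L k = 0 then v i k else 0)" for i
  have g: "g i \<in> native_sp L" if "i \<in> ?I" for i unfolding g_def using that v by (intro pinv_native) auto
  have n: "n i \<in> null_sp L" if "i \<in> ?I" for i unfolding n_def using that v by (intro null_part) auto
  obtain Q where Q: "linear Q" "\<And>x w. w \<in> mv ` null_sp L \<Longrightarrow> Q x \<bullet> w = 0" "\<And>x. Q x = 0 \<Longrightarrow> x \<in> mv ` null_sp L"
    using subspace_complement_projection[OF subspace_mv_null] by blast
  obtain c where c: "\<exists>i\<le>CARD('m). c i \<noteq> 0" "(\<Sum>i\<in>?I. c i *\<^sub>R (Q (mv (g i)) + mv (n i))) = 0"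
    using linear_dependence[of "\<lambda>i. Q (mv (g i)) + mv (n i)"] by auto
  define G where "G = (\<lambda>k. \<Sum>i\<in>?I. complex_of_real (c i) * g i k)"
  define N where "N = (\<lambda>k. \<Sum>i\<in>?I. complex_of_real (c i) * n i k)"
  have G: "G \<in> native_sp L" "mv G = (\<Sum>i\<in>?I. c i *\<^sub>R mv (g i))"
    unfolding G_def using mv_sum[of ?I g c] g by auto
  have N: "mv N = (\<Sum>i\<in>?I. c i *\<^sub>R mv (n i))"
    unfolding N_def using mv_sum[of ?I n c] n null_sp_native by auto
  have Nn: "N \<in> null_sp L" unfolding N_def n_def using v(2) by (intro null_part_sum) auto
  have "Q (mv G) = (\<Sum>i\<in>?I. c i *\<^sub>R Q (mv (g i)))"
    unfolding G(2) using Q(1) by (simp add: linear_sum linear_scale)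
  then have sum0: "Q (mv G) + mv N = 0" using c(2) N by (simp add: scaleR_add_right sum.distrib)
  \<comment> \<open>The two constraints occupy orthogonal subspaces, so the vanishing of the sum
    splits into the vanishing of both.\<close>
  have "Q (mv G) \<bullet> mv N = 0" using Q(2) Nn by blast
  then have "mv N \<bullet> mv N = 0" using sum0 by (metis add.commute add.right_neutral inner_add_left inner_zero_left)
  then have mN: "mv N = 0" by simp
  then have N0: "N = (\<lambda>_. 0)" using mv_null_eq_0[OF Nn] by simp
  have "Q (mv G) = 0" using sum0 mN by simp
  then obtain p where p: "p \<in> null_sp L" "mv G = mv p" using Q(3) by blast
  \<comment> \<open>Subtracting \<open>p\<close> cancels the measurements of \<open>G\<close>
    without changing its image under \<open>L\<close>.\<close>
  define h where "h = (\<lambda>k. complex_of_real 1 * G k + complex_of_real (- 1) * p k)"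
  have h: "h \<in> native_sp L" unfolding h_def by (rule native_sp_linear[OF G(1) null_sp_native[OF p(1)]])
  have mh: "mv h = 0" unfolding h_def mv_linear[OF G(1) null_sp_native[OF p(1)]] by (simp add: p)
  have "Lop L h k = (\<Sum>i\<in>?I. complex_of_real (c i) * v i k)" for k
  proof (cases "L k = 0")
    case True
    then have "N k = (\<Sum>i\<in>?I. complex_of_real (c i) * v i k)" by (simp add: N_def n_def)
    then show ?thesis using True N0 by (simp add: Lop_def)
  next
    case False
    then have "p k = 0" using null_spD(2)[OF p(1)] by (simp add: nullset_def)
    then have "Lop L h k = L k * G k" by (simp add: Lop_def h_def)
    also have "\<dots> = (\<Sum>i\<in>?I. complex_of_real (c i) * v i k)"
      unfolding G_def g_def sum_distrib_left using False by (intro sum.cong refl) (simp add: pinv_def)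
    finally show ?thesis .
  qed
  then have "Lop L h = (\<lambda>k. \<Sum>i\<le>CARD('m). complex_of_real (c i) * v i k)" by auto
  with c(1) h mh show thesis by (rule that)
qed

text \<open>The perturbed elements have images \<open>(1 + q) u\<close> and \<open>(1 - q) u\<close>
  under \<open>L\<close>, with \<open>q\<close> a small real polynomial, and the same measurements
  as \<open>f\<close>. Both turn out to be minimisers, with \<open>f\<close> as their
  midpoint.\<close>

lemma extreme_finite_zero_set:
  assumes ext: "extreme_dist f (solset L E y \<nu> lam)"
  shows "finite (torus_map ` zero_set (Lop L f)) \<and> card (torus_map ` zero_set (Lop L f)) \<le> CARD('m)"
proof (rule ccontr)
  let ?u = "Lop L f" and ?V = "solset L E y \<nu> lam" and ?I = "{..CARD('m)}"
  let ?T = "torus_map ` zero_set ?u"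
  assume "\<not> (finite ?T \<and> card ?T \<le> CARD('m))"
  then obtain T where T: "T \<subseteq> ?T" "card T = Suc CARD('m)" "finite T"
    by (metis infinite_arbitrarily_large not_less_eq_eq obtain_subset_with_card_n)
  obtain z where z: "bij_betw z {0..<card T} T" using ex_bij_betw_nat_finite[OF T(3)] by blast
  have I: "{0..<card T} = ?I" using T(2) by auto
  have "\<exists>x\<in>zero_set ?u. torus_map x = z j" if "j \<in> ?I" for j
  proof -
    have "z j \<in> ?T" using bij_betwE[OF z] that T(1) unfolding I by blast
    then show ?thesis by auto
  qed
  then obtain x where x: "\<And>j. j \<in> ?I \<Longrightarrow> x j \<in> zero_set ?u" "\<And>j. j \<in> ?I \<Longrightarrow> torus_map (x j) = z j" by metis
  have inj: "i = j" if "i \<in> ?I" "j \<in> ?I" "z i = z j" for i j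
    using z that unfolding I by (auto simp: bij_betw_def inj_on_def)
  have "\<exists>w. trigpoly w \<and> real_dist w \<and> tp_eval w (x j) = 1 \<and> (\<forall>a\<in>x ` (?I - {j}). tp_eval w a = 0)" if j: "j \<in> ?I" for j
  proof (rule trigpoly_lagrange)
    fix a assume "a \<in> x ` (?I - {j})"
    then obtain i where i: "i \<in> ?I" "i \<noteq> j" "a = x i" by auto
    show "torus_map a \<noteq> torus_map (x j)" using inj[OF i(1) j] i x(2)[OF i(1)] x(2)[OF j] by auto
  qed simp
  then obtain w where w: "\<And>j. j \<in> ?I \<Longrightarrow> trigpoly (w j)" "\<And>j. j \<in> ?I \<Longrightarrow> real_dist (w j)"
    "\<And>j. j \<in> ?I \<Longrightarrow> tp_eval (w j) (x j) = 1"
    "\<And>j a. j \<in> ?I \<Longrightarrow> a \<in> x ` (?I - {j}) \<Longrightarrow> tp_eval (w j) a = 0" by metis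
  obtain e where e: "e \<ge> 0" "?V = {f \<in> native_sp L. cost f \<le> ennreal e}" "?V \<noteq> {}"
     "\<forall>f\<in>native_sp L. ennreal e \<le> cost f"
    by (rule solset_eq_sublevel)
  have fV: "f \<in> ?V" using ext by (simp add: extreme_dist_def)
  then have f: "f \<in> native_sp L" and cf: "cost f \<le> ennreal e" using e(2) by auto
  have mu: "is_measure ?u" and ru: "real_dist ?u" using f real_dist_Lop by (auto simp: native_sp_def)
  obtain c h where c: "\<exists>i\<le>CARD('m). c i \<noteq> 0" and h: "h \<in> native_sp L" "mv h = 0"
    and Lh: "Lop L h = (\<lambda>k. \<Sum>i\<le>CARD('m). complex_of_real (c i) * tmult (w i) ?u k)"
  proof (rule ex_invisible_perturbation[of "\<lambda>i. tmult (w i) ?u"])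
    fix i assume "i \<le> CARD('m)"
    then have i: "i \<in> ?I" by simp
    show "is_measure (tmult (w i) ?u)"
      using mbound_tmult[OF mbound_mnorm[OF mu] w(1)[OF i]] is_measure_iff_mbound by blast
    show "real_dist (tmult (w i) ?u)" by (rule real_dist_tmult[OF w(2)[OF i] ru])
  qed
  define s where "s = (\<lambda>k. \<Sum>i\<in>?I. complex_of_real (c i) * w i k)"
  have s: "trigpoly s" unfolding s_def by (intro trigpoly_sum trigpoly_cmul w)
  have rs: "real_dist s" using w(2) by (simp add: s_def real_dist_def)
  have Ls: "Lop L h = tmult s ?u"
    unfolding s_def Lh by (rule tmult_left_sum[symmetric]) (rule w(1))
  have h0: "h \<noteq> (\<lambda>_. 0)"
  proof
    assume "h = (\<lambda>_. 0)"
    then have "tmult s ?u = (\<lambda>_. 0)" using Ls by (simp add: Lop_def)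
    \<comment> \<open>Here the nodes must lie in the zero set: a combination annihilating
      \<open>u\<close> vanishes at every node, and its value at \<open>x j\<close> is the weight
      \<open>c j\<close>.\<close>
    then have sx: "tp_eval s (x j) = 0" if "j \<in> ?I" for j using x(1)[OF that] s by (simp add: zero_set_def)
    obtain j where j: "j \<in> ?I" "c j \<noteq> 0" using c by auto
    have "tp_eval s (x j) = (\<Sum>i\<in>?I. complex_of_real (c i) * tp_eval (w i) (x j))"
      unfolding s_def by (subst tp_eval_sum) (auto intro!: trigpoly_cmul w sum.cong simp: tp_eval_cmul[OF w(1)])
    also have "\<dots> = (\<Sum>i\<in>?I. if i = j then complex_of_real (c j) else 0)"
      using j(1) w(3,4) by (intro sum.cong refl) auto
    also have "\<dots> = complex_of_real (c j)" using j(1) by simp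
    finally show False using sx[OF j(1)] j(2) by simp
  qed
  \<comment> \<open>The scaling brings the multiplier below 1 in modulus; the summand 1 avoids
    division by zero.\<close>
  define \<epsilon> where "\<epsilon> = 1 / (supnorm s + 1)"
  have \<epsilon>: "\<epsilon> > 0" using supnorm_nonneg[of s] by (simp add: \<epsilon>_def)
  define q where "q = (\<lambda>k. complex_of_real \<epsilon> * s k)"
  have q: "trigpoly q" unfolding q_def by (rule trigpoly_cmul[OF s])
  have rq: "real_dist q" using rs by (simp add: q_def real_dist_def)
  have "supnorm q \<le> \<epsilon> * supnorm s"
    using supnorm_scale[OF s, of "complex_of_real \<epsilon>"] \<epsilon> by (simp add: q_def)
  also have "\<dots> \<le> 1" using supnorm_nonneg[of s] by (simp add: \<epsilon>_def field_simps)
  finally have sq: "supnorm q \<le> 1" .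
  have tq: "tmult q ?u k = complex_of_real \<epsilon> * Lop L h k" for k
    using tmult_left_sum[of "{()}" "\<lambda>_. s" "\<lambda>_. complex_of_real \<epsilon>" ?u] s Ls by (simp add: q_def)
  define fp where "fp = (\<lambda>k. complex_of_real 1 * f k + complex_of_real \<epsilon> * h k)"
  define fm where "fm = (\<lambda>k. complex_of_real 1 * f k + complex_of_real (- \<epsilon>) * h k)"
  have fpm: "fp \<in> native_sp L" "fm \<in> native_sp L"
    unfolding fp_def fm_def by (rule native_sp_linear[OF f h(1)])+
  have mvpm: "mv fp = mv f" "mv fm = mv f"
    unfolding fp_def fm_def mv_linear[OF f h(1)] by (simp_all add: h(2))
  have Lpm: "Lop L fp = (\<lambda>k. ?u k + tmult q ?u k)" "Lop L fm = (\<lambda>k. ?u k - tmult q ?u k)"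
    unfolding fp_def fm_def Lop_linear by (simp_all add: tq)
  have sum: "mnorm (Lop L fp) + mnorm (Lop L fm) \<le> 2 * mnorm ?u"
    unfolding Lpm by (rule mnorm_add_diff_tmult_le[OF mu q rq sq])
  have low: "mnorm ?u \<le> mnorm (Lop L g)" if g: "g \<in> native_sp L" "mv g = mv f" for g
  proof -
    have "cost f \<le> cost g" using cf e(4) g(1) order_trans by blast
    then have le: "E y (mv f) + ennreal (lam * mnorm ?u) \<le> E y (mv f) + ennreal (lam * mnorm (Lop L g))"
      by (simp add: cost_def g)
    \<comment> \<open>Cancelling the common data term in \<open>ennreal\<close> requires it to be
      finite, which holds because the minimal cost is finite.\<close>
    have "E y (mv f) \<le> cost f" by (simp add: cost_def)
    then have "E y (mv f) \<noteq> top" using cf by (auto simp: top_unique)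
    then have "ennreal (lam * mnorm ?u) \<le> ennreal (lam * mnorm (Lop L g))"
      using le by (simp add: ennreal_add_left_cancel_le)
    moreover have "0 \<le> lam * mnorm (Lop L g)" using lam mnorm_nonneg[of "Lop L g"] g(1) by (simp add: native_sp_def)
    ultimately show ?thesis using lam by (simp add: ennreal_le_iff)
  qed
  \<comment> \<open>Neither norm can drop below that of \<open>?u\<close>, and their sum is at most
    twice it.\<close>
  have eq: "mnorm (Lop L fp) = mnorm ?u" "mnorm (Lop L fm) = mnorm ?u"
    using low[OF fpm(1) mvpm(1)] low[OF fpm(2) mvpm(2)] sum by linarith+
  have "fp \<in> ?V" "fm \<in> ?V"
    using cf fpm unfolding e(2) by (simp_all add: cost_def eq mvpm)
  moreover have "fp \<noteq> fm"
  proof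
    assume "fp = fm"
    then have "fp k = fm k" for k by simp
    then have "f k + complex_of_real \<epsilon> * h k = f k - complex_of_real \<epsilon> * h k" for k
      unfolding fp_def fm_def by simp
    moreover have "b = 0" if "a + b = a - b" for a b :: complex
      using that by (simp add: complex_eq_iff)
    ultimately have "complex_of_real \<epsilon> * h k = 0" for k by blast
    then have "h = (\<lambda>_. 0)" using \<epsilon> by auto
    then show False using h0 by simp
  qed
  moreover have "f = (\<lambda>k. complex_of_real (1/2) * fp k + complex_of_real (1 - 1/2) * fm k)"
    by (auto simp: fp_def fm_def field_simps)
  moreover have "(0::real) < 1/2" "(1/2::real) < 1" by auto
  ultimately have "\<exists>g\<in>?V. \<exists>h\<in>?V. g \<noteq> h \<and> (\<exists>t::real. 0 < t \<and> t < 1 \<and>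
      f = (\<lambda>k. complex_of_real t * g k + complex_of_real (1 - t) * h k))" by blast
  then show False using ext unfolding extreme_dist_def by blast
qed

text \<open>Applying \<open>pinv L\<close> to the Dirac combination recovers \<open>f\<close> up to
  its coefficients at the null frequencies, which form \<open>p\<close>. The condition on the
  weights says that \<open>Lop L f\<close> vanishes at these frequencies, which holds because
  \<open>L\<close> does.\<close>

lemma extreme_is_spline:
  assumes extr: "extreme_dist f (solset L E y \<nu> lam)"
  shows "\<exists>K a x p. K \<le> CARD('m) \<and> p \<in> null_sp L \<and>
            f = (\<lambda>k. (\<Sum>j<K. complex_of_real (a j) * green_shift L (x j) k) + p k) \<and>
            (\<forall>n\<in>nullset L. (\<Sum>j<K. complex_of_real (a j) * cis (- (rvec n \<bullet> x j))) = 0)"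
proof -
  let ?u = "Lop L f"
  let ?K = "card (torus_map ` zero_set ?u)"
  have fin: "finite (torus_map ` zero_set ?u)" and K: "?K \<le> CARD('m)"
    using extreme_finite_zero_set[OF extr] by auto
  have f: "f \<in> native_sp L" using extr by (simp add: extreme_dist_def solset_def)
  then have mu: "is_measure ?u" and rf: "real_dist f" and ru: "real_dist ?u"
    using real_dist_Lop by (auto simp: native_sp_def)
  obtain a x where ax': "\<forall>k. ?u k = (\<Sum>j<?K. complex_of_real (a j) * cis (- (rvec k \<bullet> x j)))"
    by (rule dirac_combination_of_finite_zero_set[OF mbound_mnorm[OF mu] ru fin])
  note ax = ax'[rule_format]
  let ?p = "\<lambda>k. if L k = 0 then f k else 0"
  have "f k = (\<Sum>j<?K. complex_of_real (a j) * green_shift L (x j) k) + ?p k" for k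
  proof -
    have "(\<Sum>j<?K. complex_of_real (a j) * green_shift L (x j) k)
        = pinv L k * (\<Sum>j<?K. complex_of_real (a j) * cis (- (rvec k \<bullet> x j)))"
      unfolding green_shift_def sum_distrib_left by (intro sum.cong refl) simp
    also have "\<dots> = pinv L k * ?u k" by (rule arg_cong[where f = "(*) (pinv L k)", OF ax[symmetric]])
    also have "\<dots> = f k - ?p k" by (simp add: Lop_def pinv_def)
    finally show ?thesis by simp
  qed
  then have "f = (\<lambda>k. (\<Sum>j<?K. complex_of_real (a j) * green_shift L (x j) k) + ?p k)" by (rule ext)
  moreover have "\<forall>n\<in>nullset L. (\<Sum>j<?K. complex_of_real (a j) * cis (- (rvec n \<bullet> x j))) = 0"
    by (intro ballI trans[OF ax[symmetric]]) (simp add: Lop_def nullset_def)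
  ultimately show ?thesis using K null_part[OF rf] by blast
qed

end

theorem mainTheorem5:
  fixes L :: "int^'d \<Rightarrow> complex"
    and \<nu> :: "'m::finite \<Rightarrow> int^'d \<Rightarrow> complex"
    and E :: "real^'m \<Rightarrow> real^'m \<Rightarrow> ennreal"
    and y :: "real^'m"
    and lam :: real
  assumes adm: "spline_admissible L"
    and real_L: "real_op L"
    and nu_CL: "\<And>m. \<nu> m \<in> meas_sp L"
    and nu_indep: "\<And>c :: 'm \<Rightarrow> real.
         (\<forall>k. (\<Sum>m\<in>UNIV. complex_of_real (c m) * \<nu> m k) = 0) \<Longrightarrow> c = (\<lambda>_. 0)"
    and M_ge: "card (nullset L) \<le> CARD('m)"
    and nu_inj: "\<And>p. p \<in> null_sp L \<Longrightarrow> (\<forall>m. nu_pair L (\<nu> m) p = 0) \<Longrightarrow> p = (\<lambda>_. 0)"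
    and E_lsc: "\<And>z x X. X \<longlonglongrightarrow> x \<Longrightarrow> E z x \<le> liminf (\<lambda>n. E z (X n))"
    and E_convex: "\<And>z a b t. 0 \<le> t \<Longrightarrow> t \<le> 1 \<Longrightarrow>
         E z (t *\<^sub>R a + (1 - t) *\<^sub>R b) \<le> ennreal t * E z a + ennreal (1 - t) * E z b"
    and E_coercive: "\<And>z (C::real). \<exists>R. \<forall>x. R \<le> norm x \<longrightarrow> ennreal C \<le> E z x"
    and E_proper: "\<And>z. \<exists>x. E z x < \<infinity>"
    and lam: "lam > 0"
  shows "solset L E y \<nu> lam \<noteq> {}
    \<and> convex_dset (solset L E y \<nu> lam)
    \<and> compactin (weakstar L) (solset L E y \<nu> lam)
    \<and> (\<forall>f. extreme_dist f (solset L E y \<nu> lam) \<longrightarrow>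
         (\<exists>K a x p. K \<le> CARD('m) \<and> p \<in> null_sp L \<and>
            f = (\<lambda>k. (\<Sum>j<K. complex_of_real (a j) * green_shift L (x j) k) + p k) \<and>
            (\<forall>n\<in>nullset L. (\<Sum>j<K. complex_of_real (a j) * cis (- (rvec n \<bullet> x j))) = 0)))"
proof -
  interpret spline_problem L \<nu> E y lam
    by (rule spline_problem.intro) (fact assms)+
  show ?thesis
  proof (intro conjI allI impI)
    show "solset L E y \<nu> lam \<noteq> {}" by (rule solset_eq_sublevel)
    show "convex_dset (solset L E y \<nu> lam)" by (rule convex_solset)
    show "compactin (weakstar L) (solset L E y \<nu> lam)" by (rule compactin_weakstar_solset)
  qed (rule extreme_is_spline)
qed

end
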